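(* Let $\mathcal M(\mathfrak s)$ be an $\mathfrak m$-critical closed RW spacetime of Class II and positive type, with cosmological constant $\Lambda$, angular parameter $\vartheta>0$, and positive internal parameter $\mathcal H$. Let $(\widetilde{\mathcal M}_{\mathcal H,\vartheta},\ell_{\mathcal H,\vartheta})$ denote its conformal model. Then $$\Lambda\le\frac{2\cosh3\vartheta-2}{9\mathcal H^2},\qquad \widetilde{\mathcal M}_{\mathcal H,\vartheta}=\mathrm I'\times\mathbb S^3,$$ and $\ell_{\mathcal H,\vartheta}$ is the non-cyclic quadratic form $$\ell_{\mathcal H,\vartheta}=\frac{9\mathcal H^2}{(12\widehat\wp_{\vartheta,1}-1)^2}\,(-d\tau^2+g).$$ The form $\ell_{\mathcal H,\vartheta}$ vanishes along the totally umbilical spacelike hypersurface $$\mathbb S^3_0=\{(\tau,p)\in\widetilde{\mathcal M}_{\mathcal H,\vartheta}\mid\tau=0\}$$ and is nondegenerate of Lorentzian signature on the complement of $\mathbb S^3_0$. The weak and the dominant energy conditions are automatically satisfied. The strong energy condition is satisfied if and only if $\Lambda=\dfrac{2(\cosh3\vartheta-1)}{9\mathcal H^2}$.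
   Context: RW spacetimes. Let $g$ be the standard Riemannian metric of the unit sphere $\mathbb S^3\subset\mathbb R^4$. A closed RW spacetime is $\mathcal M(\mathfrak s)=\mathrm I_{\mathfrak s}\times\mathbb S^3$, with $\mathrm I_{\mathfrak s}\subset\mathbb R$ an open interval, $\mathfrak s$ a nonnegative scale function (smooth where positive), the (possibly degenerate) Lorentz metric $\ell_{\mathfrak s}=-dt^2+\mathfrak s^2(t)g$, a cosmological constant $\Lambda\in\mathbb R$ and perfect fluid stress-energy tensor $\mathrm T=\mathfrak m\,dt^2+\mathfrak p\,\mathfrak s^2g$, satisfying the Einstein equation, equivalent to $$\mathfrak m=\frac{3}{8\pi}\left(\frac{\dot{\mathfrak s}^2}{\mathfrak s^2}+\frac1{\mathfrak s^2}-\frac{\Lambda}{3}\right),\qquad \mathfrak p=-\frac1{4\pi\mathfrak s}\left(\ddot{\mathfrak s}+\frac1{2\mathfrak s}(\dot{\mathfrak s}^2+1)-\frac\Lambda2\mathfrak s\right)$$ (dot $=d/dt$; equations are understood where $\mathfrak s>0$). Part of the definition is that the energy density is nonnegative: $\mathfrak m$ takes values in $[0,+\infty)\cup\{+\infty\}$, while the pressure $\mathfrak p$ takes values in $\mathbb R\cup\{\pm\infty\}$. Conformal model. $\mathfrak s$ may vanish at some points, but the conformal time $\tau_{\mathfrak s}(t)=\int_{t_0}^t du/\mathfrak s(u)$ is assumed continuous and strictly increasing, with differentiable inverse on the open interval $\mathrm J_{\mathfrak s}=\tau_{\mathfrak s}(\mathrm I_{\mathfrak s})$. The conformal scale function is $\mathrm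 S=\mathfrak s\circ\tau_{\mathfrak s}^{-1}:\mathrm J_{\mathfrak s}\to\mathbb R$, a nonnegative differentiable function. Domains are maximal: $\mathrm J_{\mathfrak s}$ is the maximal domain of definition of $\mathrm S$ as a nonnegative differentiable function. The conformal model is $\widetilde{\mathcal M}=\mathrm J_{\mathfrak s}\times\mathbb S^3$ with the quadratic form $\mathrm S^2(-d\tau^2+g)$; it is cyclic if $\mathrm J_{\mathfrak s}=\mathbb R$ and $\mathrm S$ is periodic. The origin of $\tau$ is arbitrary, and the additive constant of integration in $\tau$ is normalized to zero (formulas are up to a translation of $\tau$). At poles of $\widehat\wp_{\vartheta,1}$ the conformal factor is read as $0$. The terms "totally umbilical" and "spacelike" for a hypersurface on which the form vanishes refer to the background Lorentz metric $-d\tau^2+g$. Critical spacetimes. $\mathcal M(\mathfrak s)$ is $\mathfrak m$-critical if $\mathfrak s$ is a critical point of $\int_{[t_0,t_1]\times\mathbb S^3}\mathfrak m\,dV_{\ell_{\mathfrak s}}$ with respect to variations preserving the volume (keeping $\int_{t_0}^{t_1}\mathfrak s^3dt$ constant). It is assumed throughout that $\mathfrak s$ is nonconstant; criticality is then expressed by $\mathfrak s\left(\dot{\mathfrak s}^2+\frac{\mathfrak a}{3}\mathfrak s^2-1\right)=\mathcal H$ with constants $\mathfrak a,\mathcal H$ (the internal parameters), or in conformal time by $\mathrm S'^2+\frac{\mathfrak a}{3}\mathrm S^4-\mathrm S^2-\mathcal H\mathrm S=0$; it is also assumed that $\mathcal H\ne0$. Energy conditions (required at all points where $\mathfrak m,\mathfrak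 p$ are finite): weak: $-\mathfrak m\le\mathfrak p$; dominant: $-\mathfrak m\le\mathfrak p\le\mathfrak m$; strong: $-\mathfrak m/3\le\mathfrak p\le\mathfrak m$. Class II. Put $g_2=\frac1{12}$, $g_3=\frac1{48}(\mathfrak a\mathcal H^2-\frac29)$ and $\Delta=16(g_2^3-27g_3^2)=\frac1{48}\mathfrak a\mathcal H^2(4-9\mathfrak a\mathcal H^2)$. The spacetime is of Class II if $\Delta<0$. Then $4x^3-g_2x-g_3$ has roots $e_1\pm ie_2$ ($e_2>0$) and $-2e_1$, where $e_1=\frac{\varepsilon}{12}\cosh\vartheta$, $e_2=\frac1{4\sqrt3}\sinh\vartheta$ with $\vartheta>0$ (the angular parameter) and $\varepsilon=\pm1$; the spacetime is of positive type if $\varepsilon=1$ and of negative type if $\varepsilon=-1$. One has $g_3=-\frac{\varepsilon\cosh3\vartheta}{216}$ and $\mathfrak a=\frac2{9\mathcal H^2}(1-\varepsilon\cosh3\vartheta)$. Let $\wp_{\vartheta,1}$ be the Weierstrass $\wp$-function with invariants $g_2=\frac1{12}$ and $g_3=-\frac{\cosh3\vartheta}{216}$, $\omega_{\vartheta,1}>0$ its real half-period (so $2\omega_{\vartheta,1}$ is the minimal positive real period), and $\widehat\wp_{\vartheta,1}(\tau)=\wp_{\vartheta,1}(\tau)$ for $\tau\in\mathbb R$. There is a unique $\tau^*\in(0,\omega_{\vartheta,1})$ with $\widehat\wp_{\vartheta,1}(\tau^* )=\frac1{12}$; put $\mathrm I'=(-\tau^*,\tau^* )$. (The function $3\mathcal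 H/(12\widehat\wp_{\vartheta,1}-1)$ is nonnegative, for $\mathcal H>0$, exactly on the translates of $\mathrm I'$ by multiples of $2\omega_{\vartheta,1}$; the domain is normalized to be $\mathrm I'$.) *)

theory Defs
  imports "HOL-Analysis.Analysis"
begin

section \<open>Smooth functions and tangent vectors\<close>

text \<open>
  The set U is meant to be open: f is k times continuously differentiable, expressed by
  iterated directional derivatives.
\<close>

primrec Ck_on :: "nat \<Rightarrow> 'a::real_normed_vector set \<Rightarrow> ('a \<Rightarrow> 'b::real_normed_vector) \<Rightarrow> bool" where
  "Ck_on 0 U f \<longleftrightarrow> continuous_on U f"
| "Ck_on (Suc k) U f \<longleftrightarrow>
     (\<forall>x\<in>U. f differentiable (at x)) \<and> (\<forall>v. Ck_on k U (\<lambda>x. frechet_derivative f (at x) v))"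

definition smooth_on :: "'a::real_normed_vector set \<Rightarrow> ('a \<Rightarrow> 'b::real_normed_vector) \<Rightarrow> bool" where
  "smooth_on U f \<longleftrightarrow> (\<forall>k. Ck_on k U f)"

text \<open>Velocities at q of curves lying in M.\<close>

definition tangent_space :: "'a::real_normed_vector set \<Rightarrow> 'a \<Rightarrow> 'a set" where
  "tangent_space M q =
     {v. \<exists>\<gamma>. \<gamma> 0 = q \<and> (\<forall>\<^sub>F t in nhds (0::real). \<gamma> t \<in> M) \<and> (\<gamma> has_vector_derivative v) (at 0)}"

definition hypersurface :: "'a::real_normed_vector set \<Rightarrow> 'a set \<Rightarrow> bool" where
  "hypersurface M \<Sigma> \<longleftrightarrow> \<Sigma> \<subseteq> M \<and>
     (\<forall>q\<in>\<Sigma>. \<exists>U (f :: 'a \<Rightarrow> real). open U \<and> q \<in> U \<and> smooth_on U f \<and>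
        \<Sigma> \<inter> U = {x \<in> M \<inter> U. f x = 0} \<and>
        (\<exists>X\<in>tangent_space M q. frechet_derivative f (at q) X \<noteq> 0))"


section \<open>Bilinear forms on a subspace\<close>

definition nondegenerate_on :: "'a::real_vector set \<Rightarrow> ('a \<Rightarrow> 'a \<Rightarrow> real) \<Rightarrow> bool" where
  "nondegenerate_on T B \<longleftrightarrow> (\<forall>X\<in>T. (\<forall>Y\<in>T. B X Y = 0) \<longrightarrow> X = 0)"

text \<open>Signature (-,+,...,+): T has a B-orthogonal basis with exactly one timelike vector.\<close>

definition lorentzian_on :: "'a::real_vector set \<Rightarrow> ('a \<Rightarrow> 'a \<Rightarrow> real) \<Rightarrow> bool" where
  "lorentzian_on T B \<longleftrightarrow>
     (\<exists>e E. e \<notin> E \<and> finite E \<and> independent (insert e E) \<and> span (insert e E) = T \<and>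
        B e e < 0 \<and> (\<forall>x\<in>E. B x x > 0) \<and>
        (\<forall>x\<in>insert e E. \<forall>y\<in>insert e E. x \<noteq> y \<longrightarrow> B x y = 0))"


section \<open>Closed RW spacetimes\<close>

text \<open>
  A spacetime is given by the interval I, the scale function s and the cosmological constant.
  Energy density and pressure are determined by the Einstein equation; the formulas are only
  meaningful where s is positive.
\<close>

definition energy_density :: "real \<Rightarrow> (real \<Rightarrow> real) \<Rightarrow> real \<Rightarrow> real" where
  "energy_density \<Lambda> s t = 3 / (8 * pi) * ((deriv s t)\<^sup>2 / (s t)\<^sup>2 + 1 / (s t)\<^sup>2 - \<Lambda> / 3)"

definition pressure :: "real \<Rightarrow> (real \<Rightarrow> real) \<Rightarrow> real \<Rightarrow> real" where
  "pressure \<Lambda> s t =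
     - 1 / (4 * pi * s t) *
       (deriv (deriv s) t + 1 / (2 * s t) * ((deriv s t)\<^sup>2 + 1) - \<Lambda> / 2 * s t)"

text \<open>Conformal time based at t0, with additive constant c.\<close>

definition conformal_time :: "(real \<Rightarrow> real) \<Rightarrow> real \<Rightarrow> real \<Rightarrow> real \<Rightarrow> real" where
  "conformal_time s t0 c t = c + (LBINT u=ereal t0..ereal t. 1 / s u)"

definition conformal_interval :: "real set \<Rightarrow> (real \<Rightarrow> real) \<Rightarrow> real \<Rightarrow> real \<Rightarrow> real set" where
  "conformal_interval I s t0 c = conformal_time s t0 c ` I"

definition conformal_scale :: "real set \<Rightarrow> (real \<Rightarrow> real) \<Rightarrow> real \<Rightarrow> real \<Rightarrow> real \<Rightarrow> real" where
  "conformal_scale I s t0 c = s \<circ> inv_into I (conformal_time s t0 c)"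

text \<open>
  Since 1 / 0 = 0 here, the finiteness of the integrals of 1 / s amounts to integrability
  together with the zeros of s forming a null set.  Where s vanishes the energy density
  is infinite, hence its nonnegativity is a condition only where s is positive.
\<close>

definition closed_RW_spacetime :: "real set \<Rightarrow> (real \<Rightarrow> real) \<Rightarrow> real \<Rightarrow> real \<Rightarrow> bool" where
  "closed_RW_spacetime I s \<Lambda> t0 \<longleftrightarrow>
     open I \<and> is_interval I \<and> t0 \<in> I \<and>
     (\<forall>t\<in>I. 0 \<le> s t) \<and>
     smooth_on {t\<in>I. 0 < s t} s \<and>
     negligible {t\<in>I. s t = 0} \<and>
     (\<forall>a\<in>I. \<forall>b\<in>I. a \<le> b \<longrightarrow> set_integrable lborel {a..b} (\<lambda>u. 1 / s u)) \<and>
     continuous_on I (conformal_time s t0 0) \<and>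
     strict_mono_on I (conformal_time s t0 0) \<and>
     inv_into I (conformal_time s t0 0) differentiable_on conformal_interval I s t0 0 \<and>
     conformal_scale I s t0 0 differentiable_on conformal_interval I s t0 0 \<and>
     (\<forall>t\<in>I. 0 < s t \<longrightarrow> 0 \<le> energy_density \<Lambda> s t)"

definition weak_energy_condition :: "real set \<Rightarrow> (real \<Rightarrow> real) \<Rightarrow> real \<Rightarrow> bool" where
  "weak_energy_condition I s \<Lambda> \<longleftrightarrow>
     (\<forall>t\<in>I. 0 < s t \<longrightarrow> - energy_density \<Lambda> s t \<le> pressure \<Lambda> s t)"

definition dominant_energy_condition :: "real set \<Rightarrow> (real \<Rightarrow> real) \<Rightarrow> real \<Rightarrow> bool" where
  "dominant_energy_condition I s \<Lambda> \<longleftrightarrow>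
     (\<forall>t\<in>I. 0 < s t \<longrightarrow>
        - energy_density \<Lambda> s t \<le> pressure \<Lambda> s t \<and> pressure \<Lambda> s t \<le> energy_density \<Lambda> s t)"

definition strong_energy_condition :: "real set \<Rightarrow> (real \<Rightarrow> real) \<Rightarrow> real \<Rightarrow> bool" where
  "strong_energy_condition I s \<Lambda> \<longleftrightarrow>
     (\<forall>t\<in>I. 0 < s t \<longrightarrow>
        - energy_density \<Lambda> s t / 3 \<le> pressure \<Lambda> s t \<and> pressure \<Lambda> s t \<le> energy_density \<Lambda> s t)"


section \<open>Critical spacetimes\<close>

text \<open>
  The volume element is s^3 dt times that of the unit 3-sphere, whose total volume is 2 pi^2.
\<close>

definition total_energy :: "real \<Rightarrow> real \<Rightarrow> real \<Rightarrow> (real \<Rightarrow> real) \<Rightarrow> real" where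
  "total_energy \<Lambda> t1 t2 s = 2 * pi\<^sup>2 * integral {t1..t2} (\<lambda>t. energy_density \<Lambda> s t * s t ^ 3)"

definition volume_preserving_variation ::
    "(real \<Rightarrow> real) \<Rightarrow> real \<Rightarrow> real \<Rightarrow> (real \<Rightarrow> real \<Rightarrow> real) \<Rightarrow> bool" where
  "volume_preserving_variation s t1 t2 F \<longleftrightarrow>
     (\<exists>\<delta>>0. \<exists>V. open V \<and> {t1..t2} \<subseteq> V \<and>
        smooth_on ({-\<delta><..<\<delta>} \<times> V) (\<lambda>(\<epsilon>, t). F \<epsilon> t) \<and>
        (\<forall>t\<in>V. F 0 t = s t) \<and>
        (\<forall>\<epsilon>\<in>{-\<delta><..<\<delta>}.
           F \<epsilon> t1 = s t1 \<and> F \<epsilon> t2 = s t2 \<and> (\<forall>t\<in>{t1..t2}. 0 < F \<epsilon> t) \<and>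
           integral {t1..t2} (\<lambda>t. F \<epsilon> t ^ 3) = integral {t1..t2} (\<lambda>t. s t ^ 3)))"

definition m_critical :: "real set \<Rightarrow> (real \<Rightarrow> real) \<Rightarrow> real \<Rightarrow> bool" where
  "m_critical I s \<Lambda> \<longleftrightarrow>
     (\<forall>t1 t2 F. t1 < t2 \<and> {t1..t2} \<subseteq> {t\<in>I. 0 < s t} \<and> volume_preserving_variation s t1 t2 F \<longrightarrow>
        ((\<lambda>\<epsilon>. total_energy \<Lambda> t1 t2 (F \<epsilon>)) has_real_derivative 0) (at 0))"

definition internal_parameters :: "real set \<Rightarrow> (real \<Rightarrow> real) \<Rightarrow> real \<Rightarrow> real \<Rightarrow> bool" where
  "internal_parameters I s \<aa> H \<longleftrightarrow>
     (\<forall>t\<in>I. 0 < s t \<longrightarrow> s t * ((deriv s t)\<^sup>2 + \<aa> / 3 * (s t)\<^sup>2 - 1) = H)"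

text \<open>
  The criticality equation in conformal time.  A conformal scale function cannot vanish on an
  interval (conformal time would not be finite there); without this requirement, any solution
  could be prolonged by zero past a zero.
\<close>

definition conformal_solution :: "real \<Rightarrow> real \<Rightarrow> real set \<Rightarrow> (real \<Rightarrow> real) \<Rightarrow> bool" where
  "conformal_solution \<aa> H J S \<longleftrightarrow>
     open J \<and> is_interval J \<and> (\<forall>\<tau>\<in>J. 0 \<le> S \<tau>) \<and> S differentiable_on J \<and>
     interior {\<tau>\<in>J. S \<tau> = 0} = {} \<and>
     (\<forall>\<tau>\<in>J. (deriv S \<tau>)\<^sup>2 + \<aa> / 3 * S \<tau> ^ 4 - (S \<tau>)\<^sup>2 - H * S \<tau> = 0)"

text \<open>
  Prolongations are not required to have nonnegative energy density: it is the scale function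
  alone that is maximal.
\<close>

definition maximal_domain :: "real \<Rightarrow> real \<Rightarrow> real set \<Rightarrow> (real \<Rightarrow> real) \<Rightarrow> bool" where
  "maximal_domain \<aa> H J S \<longleftrightarrow>
     (\<forall>J' S'. conformal_solution \<aa> H J' S' \<and> J \<subseteq> J' \<and> (\<forall>\<tau>\<in>J. S' \<tau> = S \<tau>) \<longrightarrow> J' = J)"


section \<open>Class II, type and angular parameter\<close>

definition param_g2 :: real where
  "param_g2 = 1 / 12"

definition param_g3 :: "real \<Rightarrow> real \<Rightarrow> real" where
  "param_g3 \<aa> H = 1 / 48 * (\<aa> * H\<^sup>2 - 2 / 9)"

definition class_II :: "real \<Rightarrow> real \<Rightarrow> bool" where
  "class_II \<aa> H \<longleftrightarrow> 16 * (param_g2 ^ 3 - 27 * (param_g3 \<aa> H)\<^sup>2) < 0"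

text \<open>The type is positive for \<open>\<epsilon> = 1\<close> and negative for \<open>\<epsilon> = -1\<close>.\<close>

definition type_and_angle :: "real \<Rightarrow> real \<Rightarrow> real \<Rightarrow> real \<Rightarrow> bool" where
  "type_and_angle \<aa> H \<epsilon> \<theta> \<longleftrightarrow>
     \<epsilon> \<in> {-1, 1} \<and> 0 < \<theta> \<and>
     (let e1 = \<epsilon> / 12 * cosh \<theta>; e2 = 1 / (4 * sqrt 3) * sinh \<theta> in
        {x :: complex. 4 * x ^ 3 - of_real param_g2 * x - of_real (param_g3 \<aa> H) = 0} =
        {Complex e1 e2, Complex e1 (- e2), of_real (- 2 * e1)})"


section \<open>The Weierstrass function of a lattice\<close>

definition is_complex_lattice :: "complex set \<Rightarrow> bool" where
  "is_complex_lattice L \<longleftrightarrow>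
     (\<exists>w1 w2. Im (w2 / w1) \<noteq> 0 \<and> L = {of_int m * w1 + of_int n * w2 | m n :: int. True})"

definition invariant_g2 :: "complex set \<Rightarrow> complex" where
  "invariant_g2 L = 60 * (\<Sum>\<^sub>\<infinity>w\<in>L - {0}. 1 / w ^ 4)"

definition invariant_g3 :: "complex set \<Rightarrow> complex" where
  "invariant_g3 L = 140 * (\<Sum>\<^sub>\<infinity>w\<in>L - {0}. 1 / w ^ 6)"

text \<open>At the poles, that is at the points of L, the value is an irrelevant default.\<close>

definition weierstrass_p :: "complex set \<Rightarrow> complex \<Rightarrow> complex" where
  "weierstrass_p L z = 1 / z\<^sup>2 + (\<Sum>\<^sub>\<infinity>w\<in>L - {0}. 1 / (z - w)\<^sup>2 - 1 / w\<^sup>2)"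

definition real_weierstrass_p :: "complex set \<Rightarrow> real \<Rightarrow> real" where
  "real_weierstrass_p L \<tau> = Re (weierstrass_p L (of_real \<tau>))"

definition real_half_period :: "complex set \<Rightarrow> real \<Rightarrow> bool" where
  "real_half_period L \<omega> \<longleftrightarrow>
     0 < \<omega> \<and> (\<forall>z. weierstrass_p L (z + of_real (2 * \<omega>)) = weierstrass_p L z) \<and>
     (\<forall>x. 0 < x \<and> x < 2 * \<omega> \<longrightarrow> \<not> (\<forall>z. weierstrass_p L (z + of_real x) = weierstrass_p L z))"


section \<open>The conformal model\<close>

text \<open>
  The model is realised inside \<open>\<real> \<times> \<real>\<^sup>4\<close>; the metric \<open>-d\<tau>\<^sup>2 + g\<close> is the restriction
  of the flat metric below to its tangent spaces.
\<close>

type_synonym cyl = "real \<times> (real ^ 4)"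

definition conformal_model :: "real set \<Rightarrow> cyl set" where
  "conformal_model J = J \<times> sphere 0 1"

definition background_metric :: "cyl \<Rightarrow> cyl \<Rightarrow> real" where
  "background_metric X Y = - (fst X * fst Y) + snd X \<bullet> snd Y"

definition conformal_form :: "(real \<Rightarrow> real) \<Rightarrow> cyl \<Rightarrow> cyl \<Rightarrow> cyl \<Rightarrow> real" where
  "conformal_form S q X Y = (S (fst q))\<^sup>2 * background_metric X Y"

definition cyclic_model :: "real set \<Rightarrow> (real \<Rightarrow> real) \<Rightarrow> bool" where
  "cyclic_model J S \<longleftrightarrow> J = UNIV \<and> (\<exists>P>0. \<forall>\<tau>. S (\<tau> + P) = S \<tau>)"

definition weierstrass_factor :: "complex set \<Rightarrow> real \<Rightarrow> real \<Rightarrow> real" where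
  "weierstrass_factor L H \<tau> =
     (if of_real \<tau> \<in> L then 0 else 9 * H\<^sup>2 / (12 * real_weierstrass_p L \<tau> - 1)\<^sup>2)"

definition spacelike_hypersurface :: "cyl set \<Rightarrow> cyl set \<Rightarrow> bool" where
  "spacelike_hypersurface M \<Sigma> \<longleftrightarrow> hypersurface M \<Sigma> \<and>
     (\<forall>q\<in>\<Sigma>. \<forall>X\<in>tangent_space \<Sigma> q. X \<noteq> 0 \<longrightarrow> 0 < background_metric X X)"

text \<open>
  With N a local unit normal field, the second fundamental form is up to sign the metric
  product of \<open>\<nabla>\<^sub>X N\<close> with Y.  The Levi-Civita connection of M is the tangential part of the
  flat derivative, so for Y tangent to M this equals the product of the flat derivative of N
  along X with Y.
\<close>

definition totally_umbilical :: "cyl set \<Rightarrow> cyl set \<Rightarrow> bool" where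
  "totally_umbilical M \<Sigma> \<longleftrightarrow>
     (\<forall>q\<in>\<Sigma>. \<exists>U N \<kappa>. open U \<and> q \<in> U \<and> smooth_on U N \<and>
        (\<forall>x\<in>\<Sigma> \<inter> U.
           N x \<in> tangent_space M x \<and> \<bar>background_metric (N x) (N x)\<bar> = 1 \<and>
           (\<forall>X\<in>tangent_space \<Sigma> x. background_metric (N x) X = 0) \<and>
           (\<forall>X\<in>tangent_space \<Sigma> x. \<forall>Y\<in>tangent_space \<Sigma> x.
              background_metric (frechet_derivative N (at x) X) Y = \<kappa> x * background_metric X Y)))"

end

theory Submission
  imports Defs "HOL-Complex_Analysis.Conformal_Mappings"
begin

text \<open>
  In conformal time criticality reads \<open>S'\<^sup>2 = S\<^sup>2 + H S - (\<aa>/3) S\<^sup>4\<close>, and \<open>3H / (12\<wp> - 1)\<close> solves it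
  because \<open>\<wp>'\<^sup>2 = 4\<wp>\<^sup>3 - g\<^sub>2 \<wp> - g\<^sub>3\<close> (Liouville).  The equation is autonomous and \<open>S'\<close> vanishes only
  where \<open>S\<close> does: composing a positive increasing solution with the inverse of the model solution on
  \<open>(0, \<tau>')\<close> gives slope 1, so every solution is a translate of the model, and a maximal one
  fills the whole interval.  Two points are needed to make \<open>\<wp>\<close> a strictly decreasing real function
  on \<open>(0, \<omega>)\<close>: it is real on the real axis because \<open>z \<mapsto> cnj (\<wp> (cnj z))\<close> satisfies the same equation
  with the same pole, and it has no critical point below \<open>\<omega>\<close> because all critical values are the
  unique real root of the cubic, which is the minimum.  Energy density and pressure are explicit
  in \<open>s\<close>, and since \<open>S\<close> takes every positive value, the energy conditions are decided by
  \<open>s \<rightarrow> \<infinity>\<close>.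
\<close>

section \<open>The Weierstrass function of a lattice\<close>

text \<open>The formula for the model is the classical inversion of \<open>S'^2 = F(S)\<close> at a
  root of the quartic \<open>F(S) = S^2 + H S - (\<aa>/3) S^4\<close>: at the root 0 it reads
  \<open>S = (F'(0)/4) / (\<wp> - F''(0)/24)\<close>, with \<open>F'(0) = H\<close> and
  \<open>F''(0) = 2\<close>. The shift by 1/12 also removes the linear term of the cubic. The
  obstacle is uniqueness at a zero of \<open>S\<close>: there \<open>F\<close> behaves like
  \<open>H S\<close>, its square root is not Lipschitz, and the zero function and the model start
  with the same data. So no Picard argument applies. The sign of \<open>S'\<close> is controlled
  through extrema instead, since \<open>\<aa> \<le> 0\<close> and \<open>0 < H\<close> make
  \<open>F\<close> positive for positive \<open>S\<close>, and the empty interior of the zero set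
  forbids waiting at 0. The lattice is given only through its invariants; its symmetry under
  conjugation is not assumed, so real values must be extracted from the differential equation. The
  base point \<open>t0\<close> of conformal time is arbitrary, so the zero of \<open>S\<close> lies
  at an unknown \<open>z\<close>; the constant \<open>c\<close> of the theorem moves it to
  0.\<close>

locale complex_lattice =
  fixes L :: "complex set" and w1 w2 :: complex
  assumes generators: "Im (w2 / w1) \<noteq> 0"
    and lattice: "L = {of_int m * w1 + of_int n * w2 | m n :: int. True}"
begin

lemma latticeI: "of_int m * w1 + of_int n * w2 \<in> L"
  unfolding lattice by blast

lemma latticeE:
  assumes "w \<in> L"
  obtains m n :: int where "w = of_int m * w1 + of_int n * w2"
  using assms unfolding lattice by blast

lemma zero_mem: "0 \<in> L"
  using latticeI[of 0 0] by simp

lemma diff_mem: "x - y \<in> L" if "x \<in> L" "y \<in> L"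
proof -
  from that obtain m n m' n' :: int where "x = of_int m * w1 + of_int n * w2"
    "y = of_int m' * w1 + of_int n' * w2" by (elim latticeE)
  then have "x - y = of_int (m - m') * w1 + of_int (n - n') * w2" by (simp add: algebra_simps)
  then show ?thesis by (simp only: latticeI)
qed

lemma minus_mem: "- x \<in> L" if "x \<in> L"
  using diff_mem[OF zero_mem that] by simp

lemma add_mem: "x + y \<in> L" if "x \<in> L" "y \<in> L"
  using diff_mem[OF that(1) minus_mem[OF that(2)]] by simp

lemma add_mem_iff: "x + y \<in> L \<longleftrightarrow> x \<in> L" if "y \<in> L"
  using add_mem[OF _ that, of x] diff_mem[OF _ that, of "x + y"] by auto

lemma minus_mem_iff: "- x \<in> L \<longleftrightarrow> x \<in> L"
  using minus_mem[of x] minus_mem[of "- x"] by auto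

lemma countable_lattice: "countable L"
proof -
  have "L = (\<lambda>(m, n). of_int m * w1 + of_int n * w2) ` (UNIV :: (int \<times> int) set)"
    unfolding lattice by auto
  then show ?thesis by (simp add: countable_image)
qed

text \<open>Quantitative linear independence of the generators over the reals. After division by
  \<open>w1\<close> the imaginary part is \<open>y * Im (w2 / w1)\<close>, which controls
  \<open>y\<close>; exchanging the generators controls \<open>x\<close>. Both discreteness of
  \<open>L\<close> and the convergence of lattice sums rest on it.\<close>

lemma coordinates_bound:
  "\<exists>c>0. \<forall>x y :: real. c * max \<bar>x\<bar> \<bar>y\<bar> \<le> norm (of_real x * w1 + of_real y * w2)"
proof -
  have nz: "w1 \<noteq> 0" "w2 \<noteq> 0" using generators by auto
  have im': "Im (w1 / w2) \<noteq> 0"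
    using generators nz by (simp add: Im_divide complex_eq_iff) (simp add: algebra_simps)
  have bound: "norm v * \<bar>Im (u / v)\<bar> * \<bar>y\<bar> \<le> norm (of_real x * v + of_real y * u)"
    if "v \<noteq> 0" for x y :: real and u v :: complex
  proof -
    have e: "of_real x * v + of_real y * u = v * (of_real x + of_real y * (u / v))"
      using that by (simp add: field_simps)
    have "Im (of_real x + of_real y * (u / v)) = y * Im (u / v)"
      by (simp del: times_divide_eq_left times_divide_eq_right)
    then have "\<bar>Im (u / v)\<bar> * \<bar>y\<bar> \<le> norm (of_real x + of_real y * (u / v))"
      using abs_Im_le_cmod[of "of_real x + of_real y * (u / v)"] by (simp only: abs_mult mult.commute)
    then show ?thesis unfolding e norm_mult by (simp add: mult.assoc mult_left_mono)
  qed
  define c where "c = min (norm w1 * \<bar>Im (w2 / w1)\<bar>) (norm w2 * \<bar>Im (w1 / w2)\<bar>)"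
  have c: "c > 0" unfolding c_def using generators im' nz by simp
  show ?thesis
  proof (intro exI[of _ c] conjI allI c)
    fix x y :: real
    have "c * \<bar>y\<bar> \<le> norm w1 * \<bar>Im (w2 / w1)\<bar> * \<bar>y\<bar>"
      unfolding c_def by (intro mult_right_mono) auto
    then have 1: "c * \<bar>y\<bar> \<le> norm (of_real x * w1 + of_real y * w2)"
      using bound[OF nz(1), of w2 y x] by linarith
    have "c * \<bar>x\<bar> \<le> norm w2 * \<bar>Im (w1 / w2)\<bar> * \<bar>x\<bar>"
      unfolding c_def by (intro mult_right_mono) auto
    then have 2: "c * \<bar>x\<bar> \<le> norm (of_real x * w1 + of_real y * w2)"
      using bound[OF nz(2), of w1 x y] by (simp add: add.commute)
    show "c * max \<bar>x\<bar> \<bar>y\<bar> \<le> norm (of_real x * w1 + of_real y * w2)"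
      using 1 2 by (auto simp: max_def)
  qed
qed

lemma gap: "\<exists>c>0. \<forall>w\<in>L - {0}. c \<le> norm w"
proof -
  obtain c where c: "0 < c"
    "\<And>x y :: real. c * max \<bar>x\<bar> \<bar>y\<bar> \<le> norm (of_real x * w1 + of_real y * w2)"
    using coordinates_bound by blast
  show ?thesis
  proof (intro exI[of _ c] conjI ballI c(1))
    fix w assume "w \<in> L - {0}"
    then obtain m n :: int where w: "w = of_int m * w1 + of_int n * w2" "w \<noteq> 0"
      by (auto elim: latticeE)
    then have "m \<noteq> 0 \<or> n \<noteq> 0" by auto
    then have "1 \<le> max \<bar>real_of_int m\<bar> \<bar>real_of_int n\<bar>" by auto
    then have "c * 1 \<le> c * max \<bar>real_of_int m\<bar> \<bar>real_of_int n\<bar>"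
      using c(1) by (intro mult_left_mono) auto
    also have "\<dots> \<le> norm w" using c(2)[of m n] w by simp
    finally show "c \<le> norm w" by simp
  qed
qed

text \<open>Differences of lattice points are lattice points, so \<open>gap\<close> separates any
  two of them uniformly. Arbitrary subsets are allowed because \<open>L - {0}\<close>,
  \<open>L - {a}\<close> and \<open>L - {0, z}\<close> are needed below.\<close>

lemma closed_subset: "closed A" if "A \<subseteq> L"
proof -
  obtain c where c: "0 < c" "\<forall>w\<in>L - {0}. c \<le> norm w" using gap by blast
  show ?thesis
  proof (rule discrete_imp_closed[OF c(1)], intro ballI impI)
    fix x y assume "x \<in> A" "y \<in> A" "dist y x < c"
    then have "y - x \<in> L" "norm (y - x) < c" using diff_mem that by (auto simp: dist_norm)
    then show "y = x" using c(2)[rule_format, of "y - x"] by fastforce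
  qed
qed

end

text \<open>The exponent is half of 3: the product of two such series dominates the cubic lattice
  sum.\<close>

lemma summable_on_int_powr:
  "(\<lambda>m::int. (1 + \<bar>real_of_int m\<bar>) powr (- 3 / 2)) summable_on UNIV"
proof -
  let ?g = "\<lambda>m::int. (1 + \<bar>real_of_int m\<bar>) powr (- 3 / 2)"
  have "summable (\<lambda>n::nat. real n powr (- 3 / 2))"
    using summable_real_powr_iff[of "- 3 / 2"] by simp
  then have "summable (\<lambda>n::nat. real (Suc n) powr (- 3 / 2))"
    using summable_Suc_iff[of "\<lambda>n::nat. real n powr (- 3 / 2)"] by simp
  then have *: "(\<lambda>n::nat. real (Suc n) powr (- 3 / 2)) summable_on UNIV"
    by (intro norm_summable_imp_summable_on) simp
  have "?g summable_on range int"
    using * by (subst summable_on_reindex) (auto simp: o_def inj_on_def)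
  moreover have "?g summable_on range (\<lambda>n. - int n)"
    using * by (subst summable_on_reindex) (auto simp: o_def inj_on_def)
  ultimately have "?g summable_on (range int \<union> range (\<lambda>n. - int n))"
    by (rule summable_on_union)
  moreover have "range int \<union> range (\<lambda>n. - int n) = UNIV"
  proof -
    have "m \<in> range int \<union> range (\<lambda>n. - int n)" for m :: int
      by (cases m rule: int_cases2) auto
    then show ?thesis by blast
  qed
  ultimately show ?thesis by simp
qed

context complex_lattice
begin

text \<open>With \<open>M = max \<bar>m\<bar> \<bar>n\<bar>\<close>, both
  \<open>1 + \<bar>m\<bar>\<close> and \<open>1 + \<bar>n\<bar>\<close> are at most
  \<open>2 * M\<close>, so \<open>1 / (2 * M) ^ 3\<close> is below the product of the two
  one-dimensional terms, while the norm of the lattice point is at least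
  \<open>c * M\<close>.\<close>

lemma summable_cube: "(\<lambda>w. 1 / norm w ^ 3) summable_on (L - {0})"
proof -
  obtain c where c: "0 < c"
    and bd: "\<And>x y :: real. c * max \<bar>x\<bar> \<bar>y\<bar> \<le> norm (of_real x * w1 + of_real y * w2)"
    using coordinates_bound by blast
  let ?g = "\<lambda>m::int. (1 + \<bar>real_of_int m\<bar>) powr (- 3 / 2)"
  let ?p = "\<lambda>(m::int, n::int). of_int m * w1 + of_int n * w2"
  let ?A = "UNIV - {(0::int, 0::int)}"
  have inj: "inj ?p"
  proof (rule injI, clarify)
    fix m n m' n' :: int
    assume "of_int m * w1 + of_int n * w2 = of_int m' * w1 + of_int n' * w2"
    then have "of_real (of_int (m - m')) * w1 + of_real (of_int (n - n')) * w2 = 0"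
      by (simp add: algebra_simps)
    then have "c * max \<bar>real_of_int (m - m')\<bar> \<bar>real_of_int (n - n')\<bar> \<le> 0"
      using bd[of "of_int (m - m')" "of_int (n - n')"] by simp
    then have "max \<bar>real_of_int (m - m')\<bar> \<bar>real_of_int (n - n')\<bar> \<le> 0"
      using c by (simp add: mult_le_0_iff)
    then show "m = m' \<and> n = n'" by (auto simp: max_def split: if_splits)
  qed
  have "(\<lambda>(m, n). ?g m * ?g n) summable_on (UNIV \<times> UNIV)"
    using summable_on_int_powr
    by (intro summable_on_SigmaI[where g = "\<lambda>m. ?g m * infsum ?g UNIV"])
       (auto intro!: has_sum_cmult_right summable_on_cmult_left has_sum_infsum)
  then have "(\<lambda>(m, n). ?g m * ?g n) summable_on ?A"
    by (rule summable_on_subset_banach) auto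
  then have "(\<lambda>x. 8 / c ^ 3 * (case x of (m, n) \<Rightarrow> ?g m * ?g n)) summable_on ?A"
    by (rule summable_on_cmult_right)
  then have "((\<lambda>w. 1 / norm w ^ 3) \<circ> ?p) summable_on ?A"
  proof (rule summable_on_comparison_test)
    fix x assume "x \<in> ?A"
    then obtain m n where x: "x = (m, n)" "m \<noteq> 0 \<or> n \<noteq> 0" by (cases x) auto
    define M where "M = max \<bar>real_of_int m\<bar> \<bar>real_of_int n\<bar>"
    have M1: "1 \<le> M" unfolding M_def using x(2) by auto
    have "1 + \<bar>real_of_int m\<bar> \<le> 2 * M" "1 + \<bar>real_of_int n\<bar> \<le> 2 * M"
      using M1 unfolding M_def by auto
    then have "(2 * M) powr (- 3 / 2) * (2 * M) powr (- 3 / 2) \<le> ?g m * ?g n"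
      using M1 by (intro mult_mono powr_mono2') auto
    also have "(2 * M) powr (- 3 / 2) * (2 * M) powr (- 3 / 2) = (2 * M) powr (- 3)"
      by (simp add: powr_add[symmetric])
    also have "\<dots> = 1 / (8 * M ^ 3)"
      using M1 by (simp add: powr_minus_divide powr_realpow[of "2 * M" 3, simplified] power_mult_distrib)
    finally have g: "1 / (8 * M ^ 3) \<le> ?g m * ?g n" .
    have "c * M \<le> norm (?p x)" using bd[of m n] unfolding x M_def by simp
    then have "(c * M) ^ 3 \<le> norm (?p x) ^ 3" using c M1 by (intro power_mono) auto
    then have "1 / norm (?p x) ^ 3 \<le> 1 / (c * M) ^ 3"
      using c M1 by (intro frac_le) auto
    also have "\<dots> = 8 / c ^ 3 * (1 / (8 * M ^ 3))" by (simp add: power_mult_distrib)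
    also have "\<dots> \<le> 8 / c ^ 3 * (?g m * ?g n)" using g c by (intro mult_left_mono) auto
    finally show "((\<lambda>w. 1 / norm w ^ 3) \<circ> ?p) x \<le> 8 / c ^ 3 * (case x of (m, n) \<Rightarrow> ?g m * ?g n)"
      unfolding x by simp
  qed auto
  then have "(\<lambda>w. 1 / norm w ^ 3) summable_on (?p ` ?A)"
    using inj by (subst summable_on_reindex) (auto intro: inj_on_subset)
  moreover have "?p ` ?A = L - {0}"
  proof -
    have "?p ` ?A = range ?p - {?p (0, 0)}" using inj by (subst image_set_diff) auto
    also have "range ?p = L" unfolding lattice by auto
    finally show ?thesis by simp
  qed
  ultimately show ?thesis by simp
qed

end

text \<open>The part of the function without its pole at 0. It is holomorphic near 0, so Taylor
  estimates and limits at 0 are carried out on it.\<close>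

definition weierstrass_tail :: "complex set \<Rightarrow> complex \<Rightarrow> complex" where
  "weierstrass_tail L z = (\<Sum>\<^sub>\<infinity>w\<in>L - {0}. 1 / (z - w)\<^sup>2 - 1 / w\<^sup>2)"

lemma weierstrass_p_tail: "weierstrass_p L z = 1 / z\<^sup>2 + weierstrass_tail L z"
  unfolding weierstrass_p_def weierstrass_tail_def ..

lemma weierstrass_tail_0 [simp]: "weierstrass_tail L 0 = 0"
  by (simp add: weierstrass_tail_def)

text \<open>Since \<open>w\<^sup>2 - (z - w)\<^sup>2 = z * (w - (z - w))\<close>, the difference
  decays one power faster than either fraction. The factor \<open>K\<close> trades
  \<open>z - w\<close> for \<open>w\<close>.\<close>

lemma weierstrass_term_bound:
  fixes z w :: complex
  assumes "norm w \<le> K * norm (z - w)" "norm z \<le> R" "w \<noteq> 0" "z \<noteq> w"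
  shows "norm (1 / (z - w)\<^sup>2 - 1 / w\<^sup>2) \<le> R * (K\<^sup>2 + K) * (1 / norm w ^ 3)"
proof -
  have R: "0 \<le> R" using assms(2) norm_ge_zero[of z] by linarith
  have pos: "0 < norm w" "0 < norm (z - w)" using assms by auto
  define u v where "u = 1 / norm (z - w)" and "v = 1 / norm w"
  have u: "0 < u" "u \<le> K * v" and v: "0 < v"
    using assms(1) pos unfolding u_def v_def by (auto simp: field_simps)
  have "1 / (z - w)\<^sup>2 - 1 / w\<^sup>2 = (w\<^sup>2 - (z - w)\<^sup>2) / ((z - w)\<^sup>2 * w\<^sup>2)"
    using assms(3,4) by (subst diff_frac_eq) auto
  also have "w\<^sup>2 - (z - w)\<^sup>2 = z * (w - (z - w))"
    by (simp add: power2_eq_square algebra_simps)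
  also have "norm (z * (w - (z - w)) / ((z - w)\<^sup>2 * w\<^sup>2)) = norm z * norm (w - (z - w)) * (u\<^sup>2 * v\<^sup>2)"
    by (simp add: u_def v_def norm_mult norm_divide norm_power power_divide)
  also have "\<dots> \<le> R * (norm w + norm (z - w)) * (u\<^sup>2 * v\<^sup>2)"
    using assms(2) R by (intro mult_right_mono mult_mono norm_triangle_ineq4) auto
  also have "\<dots> = R * (u\<^sup>2 * v + u * v\<^sup>2)"
    using pos unfolding u_def v_def by (simp add: divide_simps power2_eq_square)
  also have "\<dots> \<le> R * ((K * v)\<^sup>2 * v + (K * v) * v\<^sup>2)"
    using u v R by (intro mult_left_mono add_mono mult_right_mono power_mono) auto
  also have "\<dots> = R * (K\<^sup>2 + K) * v ^ 3"
    by (simp add: algebra_simps power2_eq_square power3_eq_cube)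
  finally show ?thesis by (simp add: v_def power_divide)
qed

section \<open>Holomorphy, evenness and periodicity\<close>

context complex_lattice
begin

text \<open>Away from the closed set \<open>A\<close>, the distance to a point of \<open>A\<close>
  is comparable to the norm of that point. This yields the constant \<open>K\<close> of
  \<open>weierstrass_term_bound\<close>, uniformly near \<open>z0\<close>.\<close>

lemma local_bound:
  assumes "A \<subseteq> L" "z0 \<notin> A"
  shows "\<exists>r>0. \<exists>K. \<forall>z\<in>cball z0 r. \<forall>w\<in>A. w \<noteq> z \<and> norm w \<le> K * norm (z - w)"
proof -
  obtain \<delta> where \<delta>: "0 < \<delta>" "\<forall>w\<in>A. \<delta> \<le> dist z0 w"
    using separate_point_closed[OF closed_subset[OF assms(1)] assms(2)] by blast
  have "w \<noteq> z \<and> norm w \<le> 2 * (norm z0 / \<delta> + 1) * norm (z - w)"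
    if z: "z \<in> cball z0 (\<delta> / 2)" and w: "w \<in> A" for z w
  proof
    have d: "\<delta> \<le> norm (z0 - w)" using \<delta> w by (auto simp: dist_norm)
    have "norm (z0 - w) \<le> norm (z0 - z) + norm (z - w)" using norm_triangle_ineq[of "z0 - z" "z - w"] by simp
    moreover have "norm (z0 - z) \<le> \<delta> / 2" using z by (simp add: dist_norm)
    ultimately have 1: "norm (z0 - w) \<le> 2 * norm (z - w)" using d by linarith
    then show "w \<noteq> z" using d \<delta>(1) by auto
    have "norm w \<le> norm z0 + norm (z0 - w)" using norm_triangle_ineq4[of z0 "z0 - w"] by simp
    also have "norm z0 \<le> norm z0 / \<delta> * norm (z0 - w)"
      using mult_left_mono[OF d, of "norm z0 / \<delta>"] \<delta>(1) by simp
    also have "norm z0 / \<delta> * norm (z0 - w) + norm (z0 - w) = (norm z0 / \<delta> + 1) * norm (z0 - w)"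
      by (simp add: algebra_simps)
    also have "\<dots> \<le> (norm z0 / \<delta> + 1) * (2 * norm (z - w))"
      using 1 \<delta>(1) by (intro mult_left_mono) (auto simp: add_nonneg_nonneg)
    finally show "norm w \<le> 2 * (norm z0 / \<delta> + 1) * norm (z - w)" by (simp only: mult.assoc mult.left_commute[of 2])
  qed
  then show ?thesis using half_gt_zero[OF \<delta>(1)] by blast
qed

lemma open_subset_Compl: "A \<subseteq> L \<Longrightarrow> open (- A)"
  using closed_subset by (simp add: open_Compl)

lemma holomorphic_tail: "weierstrass_tail L holomorphic_on - (L - {0})"
proof -
  have "weierstrass_tail L field_differentiable at z0" if "z0 \<in> - (L - {0})" for z0
  proof -
    have "\<exists>r>0. \<exists>K. \<forall>z\<in>cball z0 r. \<forall>w\<in>L - {0}. w \<noteq> z \<and> norm w \<le> K * norm (z - w)"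
      by (rule local_bound) (use that in auto)
    then obtain r K where r: "0 < r"
      and K: "\<forall>z\<in>cball z0 r. \<forall>w\<in>L - {0}. w \<noteq> z \<and> norm w \<le> K * norm (z - w)"
      by (elim exE conjE)
    let ?f = "\<lambda>w z. 1 / (z - w)\<^sup>2 - 1 / w\<^sup>2"
    let ?R = "norm z0 + r"
    have ul: "uniform_limit (cball z0 r) (\<lambda>X z. \<Sum>w\<in>X. ?f w z) (\<lambda>z. \<Sum>\<^sub>\<infinity>w\<in>L - {0}. ?f w z)
        (finite_subsets_at_top (L - {0}))"
    proof (rule Weierstrass_m_test_general)
      fix w z assume w: "w \<in> L - {0}" and z: "z \<in> cball z0 r"
      have "norm z \<le> ?R" using z norm_triangle_ineq4[of z0 "z0 - z"] by (simp add: dist_norm)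
      then show "norm (?f w z) \<le> ?R * (K\<^sup>2 + K) * (1 / norm w ^ 3)"
        using K w z by (intro weierstrass_term_bound) auto
    qed (intro summable_on_cmult_right summable_cube)
    have "(\<lambda>z. \<Sum>\<^sub>\<infinity>w\<in>L - {0}. ?f w z) holomorphic_on ball z0 r"
    proof (rule holomorphic_uniform_limit[OF _ ul])
      show "\<forall>\<^sub>F X in finite_subsets_at_top (L - {0}).
          continuous_on (cball z0 r) (\<lambda>z. \<Sum>w\<in>X. ?f w z) \<and> (\<lambda>z. \<Sum>w\<in>X. ?f w z) holomorphic_on ball z0 r"
      proof (rule eventually_finite_subsets_at_top_weakI)
        fix X assume "finite X" "X \<subseteq> L - {0}"
        then have "\<And>w z. w \<in> X \<Longrightarrow> z \<in> cball z0 r \<Longrightarrow> z - w \<noteq> 0" using K by force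
        then have "(\<lambda>z. \<Sum>w\<in>X. ?f w z) holomorphic_on cball z0 r"
          by (intro holomorphic_intros) auto
        then show "continuous_on (cball z0 r) (\<lambda>z. \<Sum>w\<in>X. ?f w z) \<and> (\<lambda>z. \<Sum>w\<in>X. ?f w z) holomorphic_on ball z0 r"
          by (auto intro: holomorphic_on_imp_continuous_on elim: holomorphic_on_subset)
      qed
    qed (auto simp: finite_subsets_at_top_neq_bot)
    then have "weierstrass_tail L holomorphic_on ball z0 r"
      by (simp add: weierstrass_tail_def[abs_def])
    then show ?thesis
      using r by (simp add: holomorphic_on_imp_differentiable_at)
  qed
  then show ?thesis
    unfolding holomorphic_on_def by (blast intro: field_differentiable_at_within)
qed

lemma holomorphic_weierstrass_p: "weierstrass_p L holomorphic_on - L"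
proof -
  have "weierstrass_p L = (\<lambda>z. 1 / z\<^sup>2 + weierstrass_tail L z)"
    by (rule ext) (rule weierstrass_p_tail)
  moreover have "(\<lambda>z. 1 / z\<^sup>2 + weierstrass_tail L z) holomorphic_on - L"
    using zero_mem by (intro holomorphic_intros holomorphic_on_subset[OF holomorphic_tail]) auto
  ultimately show ?thesis by simp
qed

lemma weierstrass_tail_has_sum:
  "((\<lambda>w. 1 / (z - w)\<^sup>2 - 1 / w\<^sup>2) has_sum weierstrass_tail L z) (L - {0})"
proof -
  let ?f = "\<lambda>w. 1 / (z - w)\<^sup>2 - 1 / w\<^sup>2"
  \<comment> \<open>The point \<open>z\<close> may itself lie in the lattice. Its single term is
    left out of the estimate and inserted again afterwards.\<close>
  let ?A = "L - {0, z}"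
  have "\<exists>r>0. \<exists>K. \<forall>z'\<in>cball z r. \<forall>w\<in>?A. w \<noteq> z' \<and> norm w \<le> K * norm (z' - w)"
    by (rule local_bound) auto
  then obtain r K where r: "0 < r"
    and K: "\<forall>z'\<in>cball z r. \<forall>w\<in>?A. w \<noteq> z' \<and> norm w \<le> K * norm (z' - w)"
    by (elim exE conjE)
  have bound: "norm (?f w) \<le> norm z * (K\<^sup>2 + K) * (1 / norm w ^ 3)" if "w \<in> ?A" for w
    using K r that by (intro weierstrass_term_bound) auto
  have "(\<lambda>w. norm z * (K\<^sup>2 + K) * (1 / norm w ^ 3)) summable_on ?A"
    by (intro summable_on_cmult_right summable_on_subset_banach[OF summable_cube]) auto
  then have "(\<lambda>w. norm (?f w)) summable_on ?A"
    by (rule summable_on_comparison_test) (use bound in auto)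
  then have "?f summable_on ?A" by (rule abs_summable_summable)
  then have "?f summable_on (insert z ?A)" "?f summable_on ?A"
    by (simp_all only: summable_on_insert_iff)
  then have "?f summable_on (L - {0})"
    by (rule_tac summable_on_subset_banach[of _ "insert z ?A"]) auto
  then show ?thesis
    unfolding weierstrass_tail_def by (rule has_sum_infsum)
qed

text \<open>Under \<open>1 / 0 = 0\<close> the term at \<open>w = 0\<close> is exactly the pole
  \<open>1 / z\<^sup>2\<close>. Summing over all of \<open>L\<close> gives an index set that
  translations and reflections preserve.\<close>

lemma weierstrass_p_has_sum:
  "((\<lambda>w. 1 / (z - w)\<^sup>2 - 1 / w\<^sup>2) has_sum weierstrass_p L z) L"
proof -
  let ?f = "\<lambda>w. 1 / (z - w)\<^sup>2 - 1 / w\<^sup>2"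
  have "(?f has_sum (?f 0 + weierstrass_tail L z)) (insert 0 (L - {0}))"
    using weierstrass_tail_has_sum by (intro has_sum_insert) auto
  moreover have "insert 0 (L - {0}) = L" using zero_mem by blast
  ultimately show ?thesis by (simp add: weierstrass_p_tail)
qed

lemma bij_betw_reflect: "bij_betw (\<lambda>w. a - w) L L" if "a \<in> L"
  by (rule bij_betw_byWitness[where f' = "\<lambda>w. a - w"]) (auto simp: that diff_mem)

lemma bij_betw_uminus_punctured: "bij_betw uminus (L - {0}) (L - {0})"
  by (rule bij_betw_byWitness[where f' = uminus]) (auto simp: minus_mem)

lemma weierstrass_p_even: "weierstrass_p L (- z) = weierstrass_p L z"
proof -
  have "((\<lambda>w. 1 / (- z - (0 - w))\<^sup>2 - 1 / (0 - w)\<^sup>2) has_sum weierstrass_p L (- z)) L"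
    using weierstrass_p_has_sum[of "- z"] has_sum_reindex_bij_betw[OF bij_betw_reflect[OF zero_mem],
      of "\<lambda>w. 1 / (- z - w)\<^sup>2 - 1 / w\<^sup>2"] by blast
  moreover have "(- z - (0 - w))\<^sup>2 = (z - w)\<^sup>2" for w by (simp add: power2_eq_square algebra_simps)
  ultimately have "((\<lambda>w. 1 / (z - w)\<^sup>2 - 1 / w\<^sup>2) has_sum weierstrass_p L (- z)) L" by simp
  then show ?thesis using weierstrass_p_has_sum has_sum_unique by blast
qed

text \<open>
  The difference \<open>d\<close> of the values at \<open>z + a\<close> and \<open>z\<close> is a sum over the lattice not involving \<open>z\<close>,
  and the reflection \<open>w \<mapsto> - a - w\<close> turns it into \<open>- d\<close>.  The argument is insensitive to the
  convention \<open>1 / 0 = 0\<close>, so it also applies at the lattice points.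
\<close>

lemma weierstrass_p_periodic:
  assumes "a \<in> L"
  shows "weierstrass_p L (z + a) = weierstrass_p L z"
proof -
  define d where "d = weierstrass_p L (z + a) - weierstrass_p L z"
  have "bij_betw (\<lambda>w. w + a) L L"
    by (rule bij_betw_byWitness[where f' = "\<lambda>w. w - a"]) (auto simp: add_mem diff_mem assms)
  then have "((\<lambda>w. 1 / (z + a - (w + a))\<^sup>2 - 1 / (w + a)\<^sup>2) has_sum weierstrass_p L (z + a)) L"
    using weierstrass_p_has_sum[of "z + a"] has_sum_reindex_bij_betw[of "\<lambda>w. w + a" L L
      "\<lambda>w. 1 / (z + a - w)\<^sup>2 - 1 / w\<^sup>2"] by blast
  then have "((\<lambda>w. (1 / (z - w)\<^sup>2 - 1 / (w + a)\<^sup>2) + - (1 / (z - w)\<^sup>2 - 1 / w\<^sup>2)) has_sum d) L"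
    unfolding d_def diff_conv_add_uminus[of "weierstrass_p L (z + a)"]
    using weierstrass_p_has_sum[of z] by (intro has_sum_add has_sum_uminusI) simp_all
  then have d: "((\<lambda>w. 1 / w\<^sup>2 - 1 / (w + a)\<^sup>2) has_sum d) L" by simp
  have "((\<lambda>w. 1 / (- a - w)\<^sup>2 - 1 / (- a - w + a)\<^sup>2) has_sum d) L"
    using d has_sum_reindex_bij_betw[OF bij_betw_reflect[OF minus_mem[OF assms]],
      of "\<lambda>w. 1 / w\<^sup>2 - 1 / (w + a)\<^sup>2"] by blast
  moreover have "(- a - w)\<^sup>2 = (w + a)\<^sup>2" for w by (simp add: power2_eq_square algebra_simps)
  ultimately have "((\<lambda>w. 1 / (w + a)\<^sup>2 - 1 / w\<^sup>2) has_sum d) L" by simp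
  moreover have "((\<lambda>w. 1 / (w + a)\<^sup>2 - 1 / w\<^sup>2) has_sum - d) L"
    using has_sum_uminusI[OF d] by simp
  ultimately have "d = - d" by (rule has_sum_unique)
  then show ?thesis by (simp add: d_def)
qed

section \<open>Eisenstein sums, Laurent expansion at 0 and the differential equation\<close>

lemma eisenstein_abs_summable:
  assumes "3 \<le> k"
  shows "(\<lambda>w. norm (1 / w ^ k)) summable_on (L - {0})"
proof -
  obtain c where c: "0 < c" "\<forall>w\<in>L - {0}. c \<le> norm w" using gap by blast
  show ?thesis
  proof (rule summable_on_comparison_test)
    show "(\<lambda>w. 1 / c ^ (k - 3) * (1 / norm w ^ 3)) summable_on (L - {0})"
      by (intro summable_on_cmult_right summable_cube)
    fix w assume w: "w \<in> L - {0}"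
    have "norm w ^ k = norm w ^ (k - 3) * norm w ^ 3"
      using assms by (simp flip: power_add)
    moreover have "c ^ (k - 3) * norm w ^ 3 \<le> norm w ^ (k - 3) * norm w ^ 3"
      using c w by (intro mult_right_mono power_mono) auto
    moreover have "0 < c ^ (k - 3) * norm w ^ 3" using c w by simp
    ultimately have "1 / norm w ^ k \<le> 1 / (c ^ (k - 3) * norm w ^ 3)"
      by (intro frac_le) auto
    then show "norm (1 / w ^ k) \<le> 1 / c ^ (k - 3) * (1 / norm w ^ 3)"
      by (simp add: norm_divide norm_power)
  qed auto
qed

lemma eisenstein_has_sum:
  assumes "3 \<le> k"
  shows "((\<lambda>w. 1 / w ^ k) has_sum (\<Sum>\<^sub>\<infinity>w\<in>L - {0}. 1 / w ^ k)) (L - {0})"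
  using abs_summable_summable[OF eisenstein_abs_summable[OF assms]] by (rule has_sum_infsum)

lemma eisenstein_odd_has_sum:
  assumes "3 \<le> k" "odd k"
  shows "((\<lambda>w. 1 / w ^ k) has_sum 0) (L - {0})"
proof -
  define G where "G = (\<Sum>\<^sub>\<infinity>w\<in>L - {0}. 1 / w ^ k)"
  have G: "((\<lambda>w. 1 / w ^ k) has_sum G) (L - {0})"
    unfolding G_def using assms(1) by (rule eisenstein_has_sum)
  then have "((\<lambda>w. 1 / (- w) ^ k) has_sum G) (L - {0})"
    using has_sum_reindex_bij_betw[OF bij_betw_uminus_punctured, of "\<lambda>w. 1 / w ^ k"] by blast
  then have "((\<lambda>w. - (1 / (- w) ^ k)) has_sum - G) (L - {0})"
    by (rule has_sum_uminusI)
  then have "((\<lambda>w. 1 / w ^ k) has_sum - G) (L - {0})"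
    using assms(2) by (simp add: power_minus_odd)
  with G have "G = - G" by (rule has_sum_unique)
  then show ?thesis using G by simp
qed

end

text \<open>With \<open>t = z / w\<close> this is the expansion of
  \<open>1 / (1 - t)\<^sup>2\<close>, whose coefficients are 1, 2, 3, ..., cut after order 4. The
  remainder is exactly \<open>t ^ 5 * (6 - 5 * t) / (1 - t)\<^sup>2\<close>, and
  \<open>norm t \<le> 1 / 2\<close> bounds the last two factors by 17/2 and 4, whence 34.\<close>

lemma weierstrass_term_expansion:
  fixes z w :: complex
  assumes "w \<noteq> 0" "2 * norm z \<le> norm w"
  shows "norm ((1 / (z - w)\<^sup>2 - 1 / w\<^sup>2) - (2 * z * (1 / w ^ 3) + 3 * z\<^sup>2 * (1 / w ^ 4)
      + 4 * z ^ 3 * (1 / w ^ 5) + 5 * z ^ 4 * (1 / w ^ 6))) \<le> 34 * norm z ^ 5 * norm (1 / w ^ 7)"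
proof -
  define t where "t = z / w"
  have z: "z = t * w" using assms(1) by (simp add: t_def)
  have t: "norm t \<le> 1 / 2" using assms by (simp add: t_def norm_divide field_simps)
  then have t1: "1 / 2 \<le> norm (1 - t)" using norm_triangle_ineq2[of 1 t] by simp
  then have "1 - t \<noteq> 0" by auto
  have "(1 / (z - w)\<^sup>2 - 1 / w\<^sup>2) - (2 * z * (1 / w ^ 3) + 3 * z\<^sup>2 * (1 / w ^ 4)
      + 4 * z ^ 3 * (1 / w ^ 5) + 5 * z ^ 4 * (1 / w ^ 6))
    = (1 / (1 - t)\<^sup>2 - (1 + 2 * t + 3 * t\<^sup>2 + 4 * t ^ 3 + 5 * t ^ 4)) / w\<^sup>2"
  proof -
    have "(z - w)\<^sup>2 = (1 - t)\<^sup>2 * w\<^sup>2" by (simp add: z power2_eq_square algebra_simps)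
    then show ?thesis using assms(1)
      by (simp add: z diff_divide_distrib add_divide_distrib power_mult_distrib)
         (simp add: divide_simps power2_eq_square eval_nat_numeral)
  qed
  also have "1 / (1 - t)\<^sup>2 - (1 + 2 * t + 3 * t\<^sup>2 + 4 * t ^ 3 + 5 * t ^ 4) = t ^ 5 * (6 - 5 * t) / (1 - t)\<^sup>2"
  proof -
    have "1 - (1 + 2 * t + 3 * t\<^sup>2 + 4 * t ^ 3 + 5 * t ^ 4) * (1 - t)\<^sup>2 = t ^ 5 * (6 - 5 * t)"
      by (simp add: algebra_simps eval_nat_numeral)
    then show ?thesis using \<open>1 - t \<noteq> 0\<close> by (simp add: eq_divide_eq left_diff_distrib)
  qed
  also have "norm (t ^ 5 * (6 - 5 * t) / (1 - t)\<^sup>2 / w\<^sup>2)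
      = norm t ^ 5 * norm (6 - 5 * t) * (1 / norm (1 - t))\<^sup>2 * (1 / norm w ^ 2)"
    by (simp add: norm_mult norm_divide norm_power power_divide)
  also have "\<dots> \<le> norm t ^ 5 * (17 / 2) * 2\<^sup>2 * (1 / norm w ^ 2)"
  proof -
    have "norm (6 - 5 * t) \<le> 6 + 5 * norm t" using norm_triangle_ineq4[of 6 "5 * t"] by (simp add: norm_mult)
    then have "norm (6 - 5 * t) \<le> 17 / 2" using t by simp
    moreover have "1 / norm (1 - t) \<le> 2" using le_imp_inverse_le[OF t1] by (simp add: inverse_eq_divide)
    ultimately show ?thesis by (intro mult_right_mono mult_mono power_mono) auto
  qed
  also have "\<dots> = 34 * norm z ^ 5 * norm (1 / w ^ 7)"
    by (simp add: t_def norm_divide norm_mult norm_power power_divide eval_nat_numeral)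
  finally show ?thesis .
qed

context complex_lattice
begin

text \<open>The tail without its Taylor terms of order 2 and 4. Their coefficients are 3 and 5 times
  the Eisenstein sums of weight 4 and 6, that is 3/60 and 5/140 of the invariants.\<close>

definition remainder :: "complex \<Rightarrow> complex" where
  "remainder z = weierstrass_tail L z - invariant_g2 L / 20 * z\<^sup>2 - invariant_g3 L / 28 * z ^ 4"

lemma remainder_bound:
  "\<exists>r>0. \<exists>C. \<forall>z. norm z < r \<longrightarrow> z \<notin> L - {0} \<and> norm (remainder z) \<le> C * norm z ^ 5"
proof -
  obtain c where c: "0 < c" "\<forall>w\<in>L - {0}. c \<le> norm w" using gap by blast
  define G where "G = (\<lambda>k. \<Sum>\<^sub>\<infinity>w\<in>L - {0}. 1 / w ^ k)"
  define C where "C = 34 * (\<Sum>\<^sub>\<infinity>w\<in>L - {0}. norm (1 / w ^ 7))"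
  have "z \<notin> L - {0} \<and> norm (remainder z) \<le> C * norm z ^ 5" if z: "norm z < c / 2" for z
  proof
    show nz: "z \<notin> L - {0}"
      using c z by (smt (verit) half_gt_zero_iff field_sum_of_halves)
    \<comment> \<open>The two zeros in the value of the sum are the odd Eisenstein sums.\<close>
    have "((\<lambda>w. (1 / (z - w)\<^sup>2 - 1 / w\<^sup>2) + - (2 * z * (1 / w ^ 3) + 3 * z\<^sup>2 * (1 / w ^ 4)
      + 4 * z ^ 3 * (1 / w ^ 5) + 5 * z ^ 4 * (1 / w ^ 6))) has_sum
      (weierstrass_tail L z + - (2 * z * 0 + 3 * z\<^sup>2 * G 4 + 4 * z ^ 3 * 0 + 5 * z ^ 4 * G 6))) (L - {0})"
      unfolding G_def
      by (intro has_sum_add has_sum_uminusI has_sum_cmult_right weierstrass_tail_has_sum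
          eisenstein_has_sum eisenstein_odd_has_sum) auto
    moreover have "weierstrass_tail L z + - (2 * z * 0 + 3 * z\<^sup>2 * G 4 + 4 * z ^ 3 * 0 + 5 * z ^ 4 * G 6)
        = remainder z"
      by (simp add: remainder_def G_def invariant_g2_def invariant_g3_def)
    ultimately have "((\<lambda>w. (1 / (z - w)\<^sup>2 - 1 / w\<^sup>2) - (2 * z * (1 / w ^ 3) + 3 * z\<^sup>2 * (1 / w ^ 4)
      + 4 * z ^ 3 * (1 / w ^ 5) + 5 * z ^ 4 * (1 / w ^ 6))) has_sum remainder z) (L - {0})"
      by (simp only: diff_conv_add_uminus)
    moreover have "((\<lambda>w. 34 * norm z ^ 5 * norm (1 / w ^ 7)) has_sum
        (34 * norm z ^ 5 * (\<Sum>\<^sub>\<infinity>w\<in>L - {0}. norm (1 / w ^ 7)))) (L - {0})"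
      by (intro has_sum_cmult_right has_sum_infsum eisenstein_abs_summable) simp
    ultimately have "norm (remainder z) \<le> 34 * norm z ^ 5 * (\<Sum>\<^sub>\<infinity>w\<in>L - {0}. norm (1 / w ^ 7))"
      by (rule norm_infsum_le) (rule weierstrass_term_expansion, use c z in force, use c z in force)
    then show "norm (remainder z) \<le> C * norm z ^ 5" by (simp add: C_def algebra_simps)
  qed
  then show ?thesis using half_gt_zero[OF c(1)] by blast
qed

lemma holomorphic_remainder: "remainder holomorphic_on - (L - {0})"
  unfolding remainder_def[abs_def] by (intro holomorphic_intros holomorphic_tail)

lemma tail_differentiable: "z \<notin> L - {0} \<Longrightarrow> weierstrass_tail L field_differentiable at z"
  using holomorphic_on_imp_differentiable_at[OF holomorphic_tail open_subset_Compl[of "L - {0}"]] by auto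

lemma deriv_weierstrass_p:
  assumes "z \<notin> L"
  shows "(weierstrass_p L has_field_derivative (- 2 / z ^ 3 + deriv (weierstrass_tail L) z)) (at z)"
    and "deriv (weierstrass_p L) z = - 2 / z ^ 3 + deriv (weierstrass_tail L) z"
proof -
  have "z \<noteq> 0" using assms zero_mem by auto
  have "weierstrass_p L = (\<lambda>z. 1 / z\<^sup>2 + weierstrass_tail L z)"
    by (rule ext) (rule weierstrass_p_tail)
  moreover have "(weierstrass_tail L has_field_derivative deriv (weierstrass_tail L) z) (at z)"
    using tail_differentiable assms by (simp add: field_differentiable_derivI)
  moreover have "((\<lambda>z. 1 / z\<^sup>2) has_field_derivative - 2 / z ^ 3) (at z)"
    using \<open>z \<noteq> 0\<close> by (auto intro!: derivative_eq_intros simp: divide_simps eval_nat_numeral)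
  ultimately show "(weierstrass_p L has_field_derivative (- 2 / z ^ 3 + deriv (weierstrass_tail L) z)) (at z)"
    using DERIV_add by fastforce
  then show "deriv (weierstrass_p L) z = - 2 / z ^ 3 + deriv (weierstrass_tail L) z"
    by (rule DERIV_imp_deriv)
qed

lemma deriv_remainder:
  assumes "z \<notin> L - {0}"
  shows "deriv remainder z = deriv (weierstrass_tail L) z - invariant_g2 L / 10 * z - invariant_g3 L / 7 * z ^ 3"
proof (rule DERIV_imp_deriv)
  have "(weierstrass_tail L has_field_derivative deriv (weierstrass_tail L) z) (at z)"
    using tail_differentiable assms by (simp add: field_differentiable_derivI)
  then show "(remainder has_field_derivative (deriv (weierstrass_tail L) z - invariant_g2 L / 10 * z - invariant_g3 L / 7 * z ^ 3)) (at z)"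
    unfolding remainder_def[abs_def]
    by (auto intro!: derivative_eq_intros simp: field_simps eval_nat_numeral)
qed

text \<open>Cauchy's inequality on the circle of radius \<open>norm z\<close> about
  \<open>z\<close>: it stays within \<open>2 * norm z\<close> of 0, and \<open>remainder\<close> is
  holomorphic on its disc even though 0 lies on the boundary. One power of \<open>norm z\<close> is
  lost.\<close>

lemma deriv_remainder_bound:
  "\<exists>r>0. \<exists>C. \<forall>z. z \<noteq> 0 \<and> norm z < r \<longrightarrow> norm (deriv remainder z) \<le> C * norm z ^ 4"
proof -
  obtain r C where r: "0 < r"
    and C: "\<forall>z. norm z < r \<longrightarrow> z \<notin> L - {0} \<and> norm (remainder z) \<le> C * norm z ^ 5"
    using remainder_bound by blast
  have "norm (deriv remainder z) \<le> \<bar>C\<bar> * 64 * norm z ^ 4" if z: "norm z < r / 2" and nz: "z \<noteq> 0" for z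
  proof -
    have sub: "norm x < r" if "x \<in> cball z (norm z)" for x
      using that z norm_triangle_ineq2[of x z] by (auto simp: dist_norm norm_minus_commute)
    then have hol: "remainder holomorphic_on cball z (norm z)"
      using C by (intro holomorphic_on_subset[OF holomorphic_remainder]) auto
    have "norm ((deriv ^^ 1) remainder z) \<le> fact 1 * (\<bar>C\<bar> * (2 * norm z) ^ 5) / norm z ^ 1"
    proof (rule Cauchy_inequality)
      fix x assume x: "norm (z - x) = norm z"
      have "norm x \<le> 2 * norm z" using x norm_triangle_ineq4[of z "z - x"] by simp
      have "norm (remainder x) \<le> C * norm x ^ 5" using C sub[of x] x by (simp add: dist_norm)
      also have "\<dots> \<le> \<bar>C\<bar> * norm x ^ 5" by (intro mult_right_mono) auto
      also have "\<dots> \<le> \<bar>C\<bar> * (2 * norm z) ^ 5" using \<open>norm x \<le> 2 * norm z\<close> by (intro mult_left_mono power_mono) auto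
      finally show "norm (remainder x) \<le> \<bar>C\<bar> * (2 * norm z) ^ 5" .
    qed (use nz hol in \<open>auto intro: holomorphic_on_imp_continuous_on elim: holomorphic_on_subset\<close>)
    also have "\<dots> \<le> \<bar>C\<bar> * 64 * norm z ^ 4"
      using nz by (simp add: field_simps eval_nat_numeral)
    finally show ?thesis by simp
  qed
  then show ?thesis using half_gt_zero[OF r] by blast
qed

text \<open>The poles of order six cancel between the square and the cube. The invariants are
  precisely the coefficients that cancel the remaining pole of order two and the constant
  term.\<close>

theorem weierstrass_ode_limit:
  "((\<lambda>z. (deriv (weierstrass_p L) z)\<^sup>2 - 4 * weierstrass_p L z ^ 3 + invariant_g2 L * weierstrass_p L z
      + invariant_g3 L) \<longlongrightarrow> 0) (at 0)"
proof -
  obtain r C where r: "0 < r"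
    and C: "\<forall>z. norm z < r \<longrightarrow> z \<notin> L - {0} \<and> norm (remainder z) \<le> C * norm z ^ 5"
    using remainder_bound by blast
  obtain r' C' where r': "0 < r'"
    and C': "\<forall>z. z \<noteq> 0 \<and> norm z < r' \<longrightarrow> norm (deriv remainder z) \<le> C' * norm z ^ 4"
    using deriv_remainder_bound by blast
  define \<alpha> \<beta> where "\<alpha> = invariant_g2 L / 20" and "\<beta> = invariant_g3 L / 28"
  define k k' where "k = (\<lambda>z. remainder z / z ^ 4)" and "k' = (\<lambda>z. deriv remainder z / z ^ 3)"
  have near: "\<forall>\<^sub>F z in at 0. z \<noteq> 0 \<and> norm z < r \<and> norm z < r'"
    unfolding eventually_at using r r' by (intro exI[of _ "min r r'"]) (auto simp: dist_norm)
  have k: "(k \<longlongrightarrow> 0) (at 0)"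
  proof (rule Lim_null_comparison)
    show "\<forall>\<^sub>F z in at 0. norm (k z) \<le> C * norm z"
      using near
    proof (rule eventually_mono, elim conjE)
      fix z :: complex assume "z \<noteq> 0" "norm z < r"
      then show "norm (k z) \<le> C * norm z"
        using C[rule_format, of z] by (simp add: k_def norm_divide norm_mult norm_power divide_simps eval_nat_numeral)
    qed
    show "((\<lambda>z::complex. C * norm z) \<longlongrightarrow> 0) (at 0)" by (auto intro!: tendsto_eq_intros)
  qed
  have k': "(k' \<longlongrightarrow> 0) (at 0)"
  proof (rule Lim_null_comparison)
    show "\<forall>\<^sub>F z in at 0. norm (k' z) \<le> C' * norm z"
      using near
    proof (rule eventually_mono, elim conjE)
      fix z :: complex assume "z \<noteq> 0" "norm z < r'"
      then show "norm (k' z) \<le> C' * norm z"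
        using C'[rule_format, of z] by (simp add: k'_def norm_divide norm_mult norm_power divide_simps eval_nat_numeral)
    qed
    show "((\<lambda>z::complex. C' * norm z) \<longlongrightarrow> 0) (at 0)" by (auto intro!: tendsto_eq_intros)
  qed
  \<comment> \<open>Off 0 the tail is \<open>z\<^sup>2 * ?q z\<close> and its derivative is
    \<open>z * ?q' z\<close>; \<open>?E\<close> is the expression once all negative powers have
    cancelled.\<close>
  let ?q = "\<lambda>z. \<alpha> + \<beta> * z\<^sup>2 + k z * z\<^sup>2" and ?q' = "\<lambda>z. 2 * \<alpha> + 4 * \<beta> * z\<^sup>2 + k' z * z\<^sup>2"
  let ?E = "\<lambda>z. z\<^sup>2 * (?q' z)\<^sup>2 - 12 * z\<^sup>2 * (?q z)\<^sup>2 - 4 * z ^ 6 * ?q z ^ 3 + 20 * \<alpha> * z\<^sup>2 * ?q z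
      - 4 * k' z - 12 * k z"
  have "(?E \<longlongrightarrow> 0) (at 0)"
    by (rule tendsto_eq_intros k k' refl | simp)+
  moreover have "\<forall>\<^sub>F z in at 0. ?E z = (deriv (weierstrass_p L) z)\<^sup>2 - 4 * weierstrass_p L z ^ 3
      + invariant_g2 L * weierstrass_p L z + invariant_g3 L"
    using near
  proof (rule eventually_mono, elim conjE)
    fix z :: complex assume z: "z \<noteq> 0" "norm z < r"
    then have nL: "z \<notin> L - {0}" "z \<notin> L" using C by auto
    define u where "u = 1 / z"
    have uz: "u * z = 1" using z by (simp add: u_def)
    have p: "weierstrass_p L z = u\<^sup>2 + z\<^sup>2 * ?q z"
      using z by (simp add: weierstrass_p_tail u_def k_def \<alpha>_def \<beta>_def remainder_def field_simps eval_nat_numeral)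
    have "deriv (weierstrass_tail L) z = z * ?q' z"
      using z deriv_remainder[OF nL(1)]
      by (simp add: k'_def \<alpha>_def \<beta>_def field_simps eval_nat_numeral)
    then have p': "deriv (weierstrass_p L) z = - 2 * u ^ 3 + z * ?q' z"
      using deriv_weierstrass_p(2)[OF nL(2)] by (simp add: u_def power_divide)
    have g: "invariant_g2 L = 20 * \<alpha>" "invariant_g3 L = 28 * \<beta>" by (simp_all add: \<alpha>_def \<beta>_def)
    define q q' where "q = ?q z" and "q' = ?q' z"
    \<comment> \<open>The coefficient of \<open>- u\<^sup>2\<close> in the expression. Its constant
      part is \<open>8 * \<alpha> + 12 * \<alpha> - 20 * \<alpha> = 0\<close>, so it absorbs the
      pole and leaves \<open>28 * \<beta>\<close>, which the second invariant cancels.\<close>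
    have e: "4 * q' + 12 * q - 20 * \<alpha> = z\<^sup>2 * (28 * \<beta> + 4 * k' z + 12 * k z)"
      by (simp add: q_def q'_def algebra_simps)
    have "(- 2 * u ^ 3 + z * q')\<^sup>2 - 4 * (u\<^sup>2 + z\<^sup>2 * q) ^ 3 + 20 * \<alpha> * (u\<^sup>2 + z\<^sup>2 * q) + 28 * \<beta>
      = z\<^sup>2 * q'\<^sup>2 - 12 * z\<^sup>2 * q\<^sup>2 - 4 * z ^ 6 * q ^ 3 + 20 * \<alpha> * z\<^sup>2 * q - 4 * k' z - 12 * k z"
      using uz e by algebra
    then show "?E z = (deriv (weierstrass_p L) z)\<^sup>2 - 4 * weierstrass_p L z ^ 3
      + invariant_g2 L * weierstrass_p L z + invariant_g3 L"
      unfolding p p' g q_def q'_def by simp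
  qed
  ultimately show ?thesis by (rule Lim_transform_eventually)
qed

lemma deriv_weierstrass_p_periodic:
  assumes "z \<notin> L" "a \<in> L"
  shows "deriv (weierstrass_p L) (z + a) = deriv (weierstrass_p L) z"
proof -
  have "z + a \<notin> L" using assms by (simp add: add_mem_iff)
  then have "(weierstrass_p L has_field_derivative deriv (weierstrass_p L) (z + a)) (at (z + a))"
    using deriv_weierstrass_p by metis
  then have "((\<lambda>x. weierstrass_p L (x + a)) has_field_derivative deriv (weierstrass_p L) (z + a)) (at z)"
    by (simp only: DERIV_shift)
  then have "(weierstrass_p L has_field_derivative deriv (weierstrass_p L) (z + a)) (at z)"
    by (simp only: weierstrass_p_periodic[OF assms(2)])
  then show ?thesis by (simp add: DERIV_imp_deriv)
qed

lemma real_coordinates: "\<exists>x y :: real. z = of_real x * w1 + of_real y * w2"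
proof -
  have nz: "w1 \<noteq> 0" using generators by auto
  define y where "y = Im (z / w1) / Im (w2 / w1)"
  define x where "x = Re (z / w1) - y * Re (w2 / w1)"
  have "z / w1 = of_real x + of_real y * (w2 / w1)"
    using generators by (intro complex_eqI) (simp_all add: x_def y_def del: times_divide_eq_right)
  then have "z = of_real x * w1 + of_real y * w2" using nz by (simp add: field_simps)
  then show ?thesis by blast
qed

text \<open>The defect of the equation is doubly periodic and tends to 0 at 0, hence at every
  lattice point. Its singularities are thus removable, and its range is already attained on a
  compact period parallelogram, so it is a bounded entire function.\<close>

theorem weierstrass_ode:
  assumes "z \<notin> L"
  shows "(deriv (weierstrass_p L) z)\<^sup>2 =
    4 * weierstrass_p L z ^ 3 - invariant_g2 L * weierstrass_p L z - invariant_g3 L"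
proof -
  define E where "E = (\<lambda>z. (deriv (weierstrass_p L) z)\<^sup>2 - 4 * weierstrass_p L z ^ 3
      + invariant_g2 L * weierstrass_p L z + invariant_g3 L)"
  \<comment> \<open>The value 0 on \<open>L\<close> is the limit there, so this is the holomorphic
    extension.\<close>
  define F where "F = (\<lambda>z. if z \<in> L then 0 else E z)"
  have opL: "open (- L)" by (rule open_subset_Compl) simp
  have "E holomorphic_on - L"
    unfolding E_def by (intro holomorphic_intros holomorphic_weierstrass_p holomorphic_deriv opL)
  then have holF: "F holomorphic_on - L"
    by (rule holomorphic_transform) (simp add: F_def)
  have per: "F (z + a) = F z" if "a \<in> L" for z a
    using that by (simp add: F_def E_def add_mem_iff weierstrass_p_periodic deriv_weierstrass_p_periodic)
  have lim: "(F \<longlongrightarrow> 0) (at 0)"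
  proof (rule Lim_transform_eventually[OF weierstrass_ode_limit])
    obtain c where "0 < c" "\<forall>w\<in>L - {0}. c \<le> norm w" using gap by blast
    then show "\<forall>\<^sub>F z in at 0. (deriv (weierstrass_p L) z)\<^sup>2 - 4 * weierstrass_p L z ^ 3
      + invariant_g2 L * weierstrass_p L z + invariant_g3 L = F z"
      unfolding eventually_at F_def E_def by (intro exI[of _ c]) (force simp: dist_norm)
  qed
  have lim_a: "(F \<longlongrightarrow> 0) (at a)" if "a \<in> L" for a
    by (rule LIM_offset_zero_cancel) (use lim per[OF that] in \<open>simp add: add.commute\<close>)
  have "F field_differentiable at a" for a
  proof (cases "a \<in> L")
    case True
    have op: "open (- (L - {a}))" by (rule open_subset_Compl) auto
    have "F holomorphic_on - (L - {a})"
    proof (rule no_isolated_singularity'[OF _ _ op])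
      fix z assume "z \<in> {a}"
      then show "(F \<longlongrightarrow> F z) (at z within - (L - {a}))"
        using lim_a[OF True] True by (auto simp: F_def intro: Lim_at_imp_Lim_at_within)
    qed (auto intro!: holomorphic_on_subset[OF holF])
    then show ?thesis using op by (auto intro: holomorphic_on_imp_differentiable_at)
  next
    case False
    then show ?thesis using holF opL by (auto intro: holomorphic_on_imp_differentiable_at)
  qed
  then have hol: "F holomorphic_on UNIV" by (simp add: holomorphic_on_def)
  let ?P = "(\<lambda>(x, y). of_real x * w1 + of_real y * w2) ` ({0..1::real} \<times> {0..1::real})"
  have "compact ?P"
    by (intro compact_continuous_image compact_Times) (auto simp: case_prod_unfold intro!: continuous_intros)
  then have "compact (F ` ?P)"
    using continuous_on_subset[OF holomorphic_on_imp_continuous_on[OF hol] subset_UNIV]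
    by (rule compact_continuous_image[rotated])
  moreover have "range F \<subseteq> F ` ?P"
  proof clarify
    fix z
    obtain x y :: real where z: "z = of_real x * w1 + of_real y * w2" using real_coordinates by blast
    \<comment> \<open>Subtracting the integer parts of the coordinates moves \<open>z\<close> into
      \<open>?P\<close> by a lattice vector.\<close>
    have "z = (of_real (frac x) * w1 + of_real (frac y) * w2) + (of_int \<lfloor>x\<rfloor> * w1 + of_int \<lfloor>y\<rfloor> * w2)"
      by (simp add: z frac_def algebra_simps)
    then have "F z = F (of_real (frac x) * w1 + of_real (frac y) * w2)"
      using per[OF latticeI] by metis
    moreover have "frac x \<in> {0..1}" "frac y \<in> {0..1}" by (auto simp: frac_ge_0 less_imp_le frac_lt_1)
    ultimately show "F z \<in> F ` ?P" by force
  qed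
  ultimately have "bounded (range F)" using compact_imp_bounded bounded_subset by blast
  then obtain c where "F = (\<lambda>_. c)" using Liouville_theorem[OF hol] by (auto simp: constant_on_def)
  then have "F z = F 0" by simp
  then show ?thesis using assms zero_mem by (simp add: F_def E_def algebra_simps)
qed

end

section \<open>The Weierstrass function on the real axis\<close>

text \<open>
  Two solutions with a double pole at 0: the difference \<open>D\<close> is holomorphic at 0, and subtracting
  the equations gives \<open>z * D' / D \<longlonglongrightarrow> - 3\<close>, which is impossible for a zero of \<open>D\<close> of finite order.
\<close>

lemma double_pole_solution_unique:
  fixes a b :: complex
  assumes r: "0 < r" and h: "h holomorphic_on ball 0 r" and k: "k holomorphic_on ball 0 r"
    and hk0: "h 0 = k 0"
    and oh: "\<And>z. z \<in> ball 0 r - {0} \<Longrightarrow>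
      (- 2 / z ^ 3 + deriv h z)\<^sup>2 = 4 * (1 / z\<^sup>2 + h z) ^ 3 - a * (1 / z\<^sup>2 + h z) - b"
    and ok: "\<And>z. z \<in> ball 0 r - {0} \<Longrightarrow>
      (- 2 / z ^ 3 + deriv k z)\<^sup>2 = 4 * (1 / z\<^sup>2 + k z) ^ 3 - a * (1 / z\<^sup>2 + k z) - b"
    and z: "z \<in> ball 0 r"
  shows "h z = k z"
proof (rule ccontr)
  assume ne: "h z \<noteq> k z"
  let ?D = "\<lambda>z. h z - k z"
  have holD: "?D holomorphic_on ball 0 r" using h k by (intro holomorphic_intros)
  have nonconst: "\<not> ?D constant_on ball 0 r"
  proof
    assume "?D constant_on ball 0 r"
    then have "?D z = ?D 0" using z r unfolding constant_on_def by fastforce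
    then show False using ne hk0 by simp
  qed
  have "0 \<in> ball 0 r" "?D 0 = 0" using r hk0 by simp_all
  then obtain g s n where n: "0 < n" and s: "0 < s" "ball (0 :: complex) s \<subseteq> ball 0 r"
    and g: "g holomorphic_on ball 0 s"
    and D: "\<And>w. w \<in> ball 0 s \<Longrightarrow> ?D w = (w - 0) ^ n * g w" and gnz: "\<And>w. w \<in> ball 0 s \<Longrightarrow> g w \<noteq> 0"
    by (rule holomorphic_factor_zero_nonconstant[OF holD open_ball connected_ball _ _ nonconst]) (rule that)
  have hs: "h holomorphic_on ball 0 s" and ks: "k holomorphic_on ball 0 s"
    using h k s(2) by (auto elim: holomorphic_on_subset)
  \<comment> \<open>The difference of the two equations, multiplied by \<open>w ^ 4\<close> and
    divided by \<open>w ^ n\<close>. Both sides are now regular at 0, where they read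
    \<open>- 4 * n * g 0\<close> and \<open>12 * g 0\<close>.\<close>
  let ?l = "\<lambda>w. (of_nat n * g w + w * deriv g w) * (- 4 + w ^ 3 * (deriv h w + deriv k w))"
  let ?r = "\<lambda>w. g w * (4 * ((1 + w\<^sup>2 * h w)\<^sup>2 + (1 + w\<^sup>2 * h w) * (1 + w\<^sup>2 * k w) + (1 + w\<^sup>2 * k w)\<^sup>2) - a * w ^ 4)"
  have eq: "?l w = ?r w" if w: "w \<in> ball 0 s" "w \<noteq> 0" for w
  proof -
    have wr: "w \<in> ball 0 r - {0}" using w s(2) by auto
    have dif: "h field_differentiable at w" "k field_differentiable at w" "g field_differentiable at w"
      using hs ks g w by (auto intro: holomorphic_on_imp_differentiable_at)
    have "(?D has_field_derivative (deriv h w - deriv k w)) (at w)"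
      using dif by (intro DERIV_diff) (auto simp: field_differentiable_derivI)
    moreover have "((\<lambda>w. w ^ n * g w) has_field_derivative (of_nat n * w ^ (n - 1) * g w + w ^ n * deriv g w)) (at w)"
      using field_differentiable_derivI[OF dif(3)] by (auto intro!: derivative_eq_intros)
    then have "(?D has_field_derivative (of_nat n * w ^ (n - 1) * g w + w ^ n * deriv g w)) (at w)"
      by (rule DERIV_cong_ev[THEN iffD1, rotated 3])
         (use D w in \<open>auto intro!: eventually_nhds_in_open[THEN eventually_mono, of "ball 0 s"]\<close>)
    ultimately have "deriv h w - deriv k w = of_nat n * w ^ (n - 1) * g w + w ^ n * deriv g w"
      by (rule DERIV_unique)
    moreover have "w ^ n = w * w ^ (n - 1)" using n by (simp flip: power_Suc)
    ultimately have d': "w * (deriv h w - deriv k w) = w ^ n * (of_nat n * g w + w * deriv g w)"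
      by (simp add: algebra_simps)
    have d: "h w - k w = w ^ n * g w" using D w by simp
    define u where "u = 1 / w"
    have u: "u * w = 1" using w by (simp add: u_def)
    have e1: "(- 2 * u ^ 3 + deriv h w)\<^sup>2 = 4 * (u\<^sup>2 + h w) ^ 3 - a * (u\<^sup>2 + h w) - b"
      using oh[OF wr] by (simp add: u_def power_divide)
    have e2: "(- 2 * u ^ 3 + deriv k w)\<^sup>2 = 4 * (u\<^sup>2 + k w) ^ 3 - a * (u\<^sup>2 + k w) - b"
      using ok[OF wr] by (simp add: u_def power_divide)
    have "(deriv h w - deriv k w) * (- 4 * u ^ 3 + (deriv h w + deriv k w))
        = (- 2 * u ^ 3 + deriv h w)\<^sup>2 - (- 2 * u ^ 3 + deriv k w)\<^sup>2"
      by (simp add: power2_eq_square algebra_simps)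
    also have "\<dots> = (h w - k w) * (4 * ((u\<^sup>2 + h w)\<^sup>2 + (u\<^sup>2 + h w) * (u\<^sup>2 + k w) + (u\<^sup>2 + k w)\<^sup>2) - a)"
      unfolding e1 e2 by (simp add: power2_eq_square power3_eq_cube algebra_simps)
    finally have "(w * (deriv h w - deriv k w)) * (w ^ 3 * (- 4 * u ^ 3 + (deriv h w + deriv k w)))
        = (h w - k w) * (w ^ 4 * (4 * ((u\<^sup>2 + h w)\<^sup>2 + (u\<^sup>2 + h w) * (u\<^sup>2 + k w) + (u\<^sup>2 + k w)\<^sup>2) - a))"
      by (simp add: eval_nat_numeral mult_ac)
    moreover have "w ^ 3 * (- 4 * u ^ 3 + (deriv h w + deriv k w)) = - 4 + w ^ 3 * (deriv h w + deriv k w)"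
      using u by algebra
    moreover have "w ^ 4 * (4 * ((u\<^sup>2 + h w)\<^sup>2 + (u\<^sup>2 + h w) * (u\<^sup>2 + k w) + (u\<^sup>2 + k w)\<^sup>2) - a)
        = 4 * ((1 + w\<^sup>2 * h w)\<^sup>2 + (1 + w\<^sup>2 * h w) * (1 + w\<^sup>2 * k w) + (1 + w\<^sup>2 * k w)\<^sup>2) - a * w ^ 4"
      using u by algebra
    ultimately have "w ^ n * ?l w = w ^ n * ?r w"
      unfolding d d' by (simp only: mult.assoc)
    then show ?thesis using w by simp
  qed
  have c: "continuous (at 0) f" if "f holomorphic_on ball 0 s" for f
    using holomorphic_on_imp_differentiable_at[OF that open_ball] s(1)
    by (intro field_differentiable_imp_continuous_at) simp
  have cc: "(h \<longlongrightarrow> h 0) (at 0)" "(k \<longlongrightarrow> k 0) (at 0)" "(g \<longlongrightarrow> g 0) (at 0)"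
    "(deriv h \<longlongrightarrow> deriv h 0) (at 0)" "(deriv k \<longlongrightarrow> deriv k 0) (at 0)" "(deriv g \<longlongrightarrow> deriv g 0) (at 0)"
    using hs ks g by (auto intro!: c[unfolded isCont_def] holomorphic_deriv)
  have 1: "(?l \<longlongrightarrow> of_nat n * g 0 * (- 4)) (at 0)" by (rule tendsto_eq_intros cc refl | simp)+
  have 2: "(?r \<longlongrightarrow> g 0 * 12) (at 0)" by (rule tendsto_eq_intros cc refl | simp)+
  have "\<forall>\<^sub>F w in at 0. ?l w = ?r w"
    unfolding eventually_at using eq s by (intro exI[of _ s]) (auto simp: dist_norm)
  then have "of_nat n * g 0 * (- 4) = g 0 * 12"
    by (rule tendsto_unique[OF at_neq_bot Lim_transform_eventually[OF 1] 2])
  then have "g 0 * (of_nat n + 3) = 0" by algebra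
  moreover have "(of_nat n + 3 :: complex) \<noteq> 0"
    using of_nat_neq_0[of "n + 2", where ?'a = complex] by (simp add: add.commute)
  ultimately show False using gnz[of 0] s by simp
qed

section \<open>Real values, minimal period and non-constancy\<close>

context complex_lattice
begin

lemma weierstrass_p_cnj:
  assumes g2: "invariant_g2 L \<in> \<real>" and g3: "invariant_g3 L \<in> \<real>"
    and z: "z \<notin> L" "cnj z \<notin> L"
  shows "cnj (weierstrass_p L (cnj z)) = weierstrass_p L z"
proof -
  obtain c where c: "0 < c" "\<forall>w\<in>L - {0}. c \<le> norm w" using gap by blast
  let ?h = "weierstrass_tail L" and ?k = "cnj \<circ> weierstrass_tail L \<circ> cnj"
  have nL: "x \<notin> L - {0}" if "x \<in> ball 0 c" for x
  proof -
    have "\<not> c \<le> norm x" using that by simp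
    then show ?thesis using c(2) by blast
  qed
  have cb: "cnj ` ball 0 c = ball 0 c" by (auto simp: image_iff intro!: bexI[of _ "cnj _"])
  have "ball 0 c \<subseteq> - (L - {0})" using nL by auto
  then have hol: "?h holomorphic_on ball 0 c" by (rule holomorphic_on_subset[OF holomorphic_tail])
  have ode: "(- 2 / x ^ 3 + deriv ?h x)\<^sup>2
      = 4 * (1 / x\<^sup>2 + ?h x) ^ 3 - invariant_g2 L * (1 / x\<^sup>2 + ?h x) - invariant_g3 L"
    if "x \<in> ball 0 c - {0}" for x
  proof -
    have "x \<notin> L" using nL that by auto
    then show ?thesis using weierstrass_ode[of x] deriv_weierstrass_p(2)[of x] by (simp add: weierstrass_p_tail)
  qed
  have near: "?h x = ?k x" if "x \<in> ball 0 c" for x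
  proof (rule double_pole_solution_unique[OF c(1) hol _ _ ode _ that])
    show "?k holomorphic_on ball 0 c" by (intro holomorphic_on_compose_cnj_cnj) (simp_all add: cb hol)
  next
    fix x :: complex assume x: "x \<in> ball 0 c - {0}"
    then have cx: "cnj x \<in> ball 0 c - {0}" by auto
    have "?h field_differentiable at (cnj x)" using nL[of "cnj x"] x by (intro tail_differentiable) auto
    then have dk: "deriv ?k x = cnj (deriv ?h (cnj x))"
      by (intro DERIV_imp_deriv has_field_derivative_cnj_cnj) (simp add: field_differentiable_derivI)
    have "cnj ((- 2 / cnj x ^ 3 + deriv ?h (cnj x))\<^sup>2) = cnj (4 * (1 / (cnj x)\<^sup>2 + ?h (cnj x)) ^ 3
        - invariant_g2 L * (1 / (cnj x)\<^sup>2 + ?h (cnj x)) - invariant_g3 L)"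
      using ode[OF cx] by simp
    then show "(- 2 / x ^ 3 + deriv ?k x)\<^sup>2
      = 4 * (1 / x\<^sup>2 + ?k x) ^ 3 - invariant_g2 L * (1 / x\<^sup>2 + ?k x) - invariant_g3 L"
      using g2 g3 unfolding dk by (simp add: Reals_cnj_iff)
  qed simp_all
  let ?S = "- (L \<union> cnj ` L)"
  have cL: "closed L" by (rule closed_subset) simp
  have "closed (cnj ` L)"
  proof -
    have "cnj ` L = cnj -` L" by (auto simp: image_iff intro!: bexI[of _ "cnj _"])
    then show ?thesis using cL by (simp add: closed_vimage continuous_intros)
  qed
  then have opS: "open ?S" using cL by auto
  have coS: "connected ?S"
    using connected_open_diff_countable[of "UNIV :: complex set" "L \<union> cnj ` L"] countable_lattice
    by (simp add: Compl_eq_Diff_UNIV connected_UNIV)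
  have zS: "z \<in> ?S" using z by force
  let ?U = "ball 0 c - {0} :: complex set"
  have US: "?U \<subseteq> ?S"
  proof
    fix x :: complex assume x: "x \<in> ?U"
    then show "x \<in> ?S" using nL[of x] nL[of "cnj x"] by auto
  qed
  have "weierstrass_p L z = (cnj \<circ> weierstrass_p L \<circ> cnj) z"
  proof (rule analytic_continuation_open[OF _ opS _ coS US _ _ _ zS])
    show "?U \<noteq> {}" using c(1)
      by (metis ball_eq_empty centre_in_ball insert_Diff not_open_singleton open_ball linorder_not_le)
    show "weierstrass_p L holomorphic_on ?S" by (rule holomorphic_on_subset[OF holomorphic_weierstrass_p]) auto
    have "cnj ` ?S \<subseteq> - L" by force
    then show "cnj \<circ> weierstrass_p L \<circ> cnj holomorphic_on ?S"
      by (intro holomorphic_on_compose_cnj_cnj opS holomorphic_on_subset[OF holomorphic_weierstrass_p])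
    show "weierstrass_p L x = (cnj \<circ> weierstrass_p L \<circ> cnj) x" if "x \<in> ?U" for x
      using near[of x] that by (simp add: weierstrass_p_tail)
  qed (auto intro: open_delete)
  then show ?thesis by simp
qed

lemma real_weierstrass_p_tail:
  "real_weierstrass_p L x = 1 / x\<^sup>2 + Re (weierstrass_tail L (of_real x))"
  by (simp add: real_weierstrass_p_def weierstrass_p_tail Re_divide_of_real flip: of_real_power)

lemma isCont_tail_0: "isCont (weierstrass_tail L) 0"
  using tail_differentiable[of 0] by (simp add: field_differentiable_imp_continuous_at)

lemma isCont_real_tail_0: "isCont (\<lambda>x. Re (weierstrass_tail L (of_real x))) (0 :: real)"
proof -
  have "isCont (weierstrass_tail L) (of_real 0)" using isCont_tail_0 by simp
  then have "isCont (\<lambda>x. weierstrass_tail L (of_real x)) (0 :: real)"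
    by (rule isCont_o2[rotated]) (rule isCont_of_real[OF continuous_ident])
  then show ?thesis by (rule isCont_Re)
qed

lemma real_weierstrass_p_at_right_0: "filterlim (real_weierstrass_p L) at_top (at_right 0)"
proof -
  have "((\<lambda>x. Re (weierstrass_tail L (of_real x))) \<longlongrightarrow> 0) (at_right 0)"
    using isCont_real_tail_0 unfolding isCont_def
    by (auto intro: filterlim_mono[OF _ order_refl at_le])
  moreover have "filterlim (\<lambda>x::real. inverse (x\<^sup>2)) at_top (at_right 0)"
    by (rule filterlim_inverse_at_top) (auto intro!: tendsto_eq_intros simp: eventually_at_filter)
  ultimately have "filterlim (\<lambda>x. Re (weierstrass_tail L (of_real x)) + inverse (x\<^sup>2)) at_top (at_right 0)"
    by (rule filterlim_tendsto_add_at_top)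
  then show ?thesis
    by (simp add: real_weierstrass_p_tail[abs_def] inverse_eq_divide add.commute)
qed

lemma real_weierstrass_p_even: "real_weierstrass_p L (- x) = real_weierstrass_p L x"
  by (simp add: real_weierstrass_p_def weierstrass_p_even)

text \<open>By the identity theorem the function would be constant off \<open>L\<close>, but
  \<open>z\<^sup>2\<close> times it tends to 1 at 0.\<close>

lemma not_constant_on_interval:
  assumes "a < b" "\<And>x. a < x \<Longrightarrow> x < b \<Longrightarrow> of_real x \<notin> L"
    and e: "\<And>x. a < x \<Longrightarrow> x < b \<Longrightarrow> weierstrass_p L (of_real x) = e"
  shows False
proof -
  let ?U = "of_real ` {a<..<b} :: complex set"
  have const: "weierstrass_p L z - e = 0" if "z \<in> - L" for z
  proof (rule analytic_continuation[of "\<lambda>z. weierstrass_p L z - e" "- L" ?U "of_real ((a + b) / 2)"])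
    show "(\<lambda>z. weierstrass_p L z - e) holomorphic_on - L"
      by (intro holomorphic_intros holomorphic_weierstrass_p)
    show "connected (- L)"
      using connected_open_diff_countable[of "UNIV :: complex set" L] countable_lattice
      by (simp add: Compl_eq_Diff_UNIV connected_UNIV)
    have "\<exists>y\<in>{a<..<b}. y \<noteq> (a + b) / 2 \<and> dist y ((a + b) / 2) < \<epsilon>" if "0 < \<epsilon>" for \<epsilon>
      by (rule bexI[of _ "(a + b) / 2 + min (\<epsilon> / 2) ((b - a) / 4)"])
         (use assms(1) that in \<open>auto simp: dist_real_def min_def field_simps\<close>)
    then show "complex_of_real ((a + b) / 2) islimpt ?U"
      unfolding islimpt_approachable by (metis dist_of_real imageI of_real_eq_iff)
    show "of_real ((a + b) / 2) \<in> - L" using assms(1) assms(2)[of "(a + b) / 2"] by simp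
  qed (use assms that in \<open>auto simp: open_subset_Compl\<close>)
  obtain c where c: "0 < c" "\<forall>w\<in>L - {0}. c \<le> norm w" using gap by blast
  have "eventually (\<lambda>z. 1 + z\<^sup>2 * weierstrass_tail L z = z\<^sup>2 * e) (at 0)"
    unfolding eventually_at
  proof (intro exI[of _ c] conjI ballI impI c(1), elim conjE)
    fix z :: complex assume z: "z \<noteq> 0" "dist z 0 < c"
    then have "z \<notin> L" using c by force
    then have "e = 1 / z\<^sup>2 + weierstrass_tail L z" using const[of z] by (simp add: weierstrass_p_tail)
    then show "1 + z\<^sup>2 * weierstrass_tail L z = z\<^sup>2 * e" using z by (simp add: field_simps)
  qed
  moreover have "((\<lambda>z. 1 + z\<^sup>2 * weierstrass_tail L z) \<longlongrightarrow> 1) (at 0)"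
    using isCont_tail_0 unfolding isCont_def by (auto intro!: tendsto_eq_intros)
  ultimately have "((\<lambda>z. z\<^sup>2 * e) \<longlongrightarrow> 1) (at 0)"
    by (rule Lim_transform_eventually[rotated])
  moreover have "((\<lambda>z::complex. z\<^sup>2 * e) \<longlongrightarrow> 0) (at 0)" by (auto intro!: tendsto_eq_intros)
  ultimately have "(1::complex) = 0" by (rule tendsto_unique[OF at_neq_bot])
  then show False by simp
qed

text \<open>\<open>real_half_period\<close> speaks of periods of the function, not of
  \<open>L\<close>. A lattice point is a period at every argument, poles included, so minimality
  applies.\<close>

lemma not_mem_below_period:
  assumes "real_half_period L \<omega>" "0 < x" "x < 2 * \<omega>"
  shows "of_real x \<notin> L"
proof
  assume "of_real x \<in> L"
  then have "\<forall>z. weierstrass_p L (z + of_real x) = weierstrass_p L z"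
    by (simp add: weierstrass_p_periodic)
  then show False using assms unfolding real_half_period_def by (elim conjE allE[of _ x]) simp
qed

lemma real_weierstrass_p_reflect:
  assumes "real_half_period L \<omega>"
  shows "real_weierstrass_p L (2 * \<omega> - x) = real_weierstrass_p L x"
proof -
  have "weierstrass_p L (of_real (2 * \<omega> - x)) = weierstrass_p L (- of_real x + of_real (2 * \<omega>))"
    by (simp add: algebra_simps)
  also have "\<dots> = weierstrass_p L (- of_real x)"
    using assms unfolding real_half_period_def by blast
  also have "\<dots> = weierstrass_p L (of_real x)" by (rule weierstrass_p_even)
  finally show ?thesis by (simp add: real_weierstrass_p_def)
qed

end

locale real_lattice = complex_lattice +
  fixes a b :: real
  assumes g2: "invariant_g2 L = of_real a" and g3: "invariant_g3 L = of_real b"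
begin

lemma weierstrass_p_of_real:
  assumes "of_real x \<notin> L"
  shows "weierstrass_p L (of_real x) = of_real (real_weierstrass_p L x)"
proof -
  have "cnj (weierstrass_p L (of_real x)) = weierstrass_p L (of_real x)"
    using weierstrass_p_cnj[of "of_real x"] assms g2 g3 by simp
  then show ?thesis by (simp add: real_weierstrass_p_def complex_eq_iff)
qed

text \<open>The imaginary part vanishes on the real axis near \<open>x\<close>, so the complex
  derivative is real there and the complex equation descends to the real function.\<close>

lemma real_weierstrass_p_DERIV:
  assumes "of_real x \<notin> L"
  shows "(real_weierstrass_p L has_real_derivative deriv (real_weierstrass_p L) x) (at x)"
    and "(deriv (real_weierstrass_p L) x)\<^sup>2 = 4 * real_weierstrass_p L x ^ 3 - a * real_weierstrass_p L x - b"
proof -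
  let ?d = "deriv (weierstrass_p L) (of_real x)"
  have "(weierstrass_p L has_field_derivative ?d) (at (of_real x))"
    using deriv_weierstrass_p[OF assms] by simp
  then have vd: "((\<lambda>x. weierstrass_p L (of_real x)) has_vector_derivative ?d) (at x)"
    by (rule has_vector_derivative_real_field)
  then have re: "(real_weierstrass_p L has_real_derivative Re ?d) (at x)"
    unfolding real_weierstrass_p_def[abs_def] by (rule has_field_derivative_Re)
  have op: "open (of_real -` (- L) :: real set)"
    by (intro open_vimage open_subset_Compl) (auto intro!: continuous_intros)
  have "((\<lambda>x. Im (weierstrass_p L (of_real x))) has_real_derivative Im ?d) (at x)"
    using vd by (rule has_field_derivative_Im)
  moreover have "\<forall>\<^sub>F x in nhds x. Im (weierstrass_p L (of_real x)) = 0"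
    using op assms by (auto simp: eventually_nhds weierstrass_p_of_real intro!: exI[of _ "of_real -` (- L)"])
  then have "((\<lambda>x. Im (weierstrass_p L (of_real x))) has_real_derivative 0) (at x)"
    by (rule DERIV_cong_ev[OF refl _ refl, THEN iffD2, OF _ DERIV_const])
  ultimately have "Im ?d = 0" by (rule DERIV_unique)
  then have d: "?d = of_real (deriv (real_weierstrass_p L) x)"
    using DERIV_imp_deriv[OF re] by (simp add: complex_eq_iff)
  show "(real_weierstrass_p L has_real_derivative deriv (real_weierstrass_p L) x) (at x)"
    using re DERIV_imp_deriv[OF re] by simp
  have "complex_of_real ((deriv (real_weierstrass_p L) x)\<^sup>2)
      = of_real (4 * real_weierstrass_p L x ^ 3 - a * real_weierstrass_p L x - b)"
    using weierstrass_ode[OF assms] unfolding d weierstrass_p_of_real[OF assms] g2 g3 by simp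
  then show "(deriv (real_weierstrass_p L) x)\<^sup>2 = 4 * real_weierstrass_p L x ^ 3 - a * real_weierstrass_p L x - b"
    by (simp only: of_real_eq_iff)
qed

text \<open>
  Every critical value equals \<open>e\<close>, the minimum; a maximum between a critical point below \<open>\<omega>\<close>
  and the critical point \<open>\<omega>\<close> would be one, so the function would be constant in between.
\<close>

lemma real_weierstrass_p_deriv_neg:
  assumes hp: "real_half_period L \<omega>"
    and min: "\<And>v. 0 \<le> 4 * v ^ 3 - a * v - b \<Longrightarrow> e \<le> v"
    and root: "\<And>v. 4 * v ^ 3 - a * v - b = 0 \<Longrightarrow> v = e"
    and x: "0 < x" "x < \<omega>"
  shows "deriv (real_weierstrass_p L) x < 0"
proof -
  let ?y = "real_weierstrass_p L"
  have nL: "of_real u \<notin> L" if "0 < u" "u < 2 * \<omega>" for u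
    using not_mem_below_period[OF hp that] .
  have D: "(?y has_real_derivative deriv ?y u) (at u)" if "0 < u" "u < 2 * \<omega>" for u
    using nL[OF that] by (rule real_weierstrass_p_DERIV)
  have sq: "(deriv ?y u)\<^sup>2 = 4 * ?y u ^ 3 - a * ?y u - b" if "0 < u" "u < 2 * \<omega>" for u
    using nL[OF that] by (rule real_weierstrass_p_DERIV)
  have ge: "e \<le> ?y u" if "0 < u" "u < 2 * \<omega>" for u
    by (rule min) (use sq[OF that] zero_le_power2[of "deriv ?y u"] in linarith)
  have crit: "?y u = e" if "0 < u" "u < 2 * \<omega>" "deriv ?y u = 0" for u
    by (rule root) (use sq[OF that(1,2)] that(3) in simp)
  have cont: "continuous_on {p..q} ?y" if "0 < p" "q < 2 * \<omega>" for p q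
    using that by (intro continuous_at_imp_continuous_on) (auto intro!: DERIV_isCont[OF D])
  have \<omega>: "0 < \<omega>" using x by simp
  \<comment> \<open>The function is symmetric about \<open>\<omega>\<close>, so its derivative there
    is its own negative.\<close>
  have d\<omega>: "deriv ?y \<omega> = 0"
  proof -
    have "(?y has_real_derivative deriv ?y \<omega>) (at (2 * \<omega> - \<omega>))" using D[of \<omega>] \<omega> by simp
    moreover have "((\<lambda>u. 2 * \<omega> - u) has_real_derivative - 1) (at \<omega>)"
      by (auto intro!: derivative_eq_intros)
    ultimately have "((\<lambda>u. ?y (2 * \<omega> - u)) has_real_derivative deriv ?y \<omega> * (- 1)) (at \<omega>)"
      by (rule DERIV_chain2)
    then have "(?y has_real_derivative - deriv ?y \<omega>) (at \<omega>)"
      by (simp add: real_weierstrass_p_reflect[OF hp])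
    moreover have "(?y has_real_derivative deriv ?y \<omega>) (at \<omega>)" using D[of \<omega>] \<omega> by simp
    ultimately have "- deriv ?y \<omega> = deriv ?y \<omega>" by (rule DERIV_unique)
    then show ?thesis by simp
  qed
  have nz: "deriv ?y u \<noteq> 0" if u: "0 < u" "u < \<omega>" for u
  proof
    assume "deriv ?y u = 0"
    then have eq: "?y u = e" "?y \<omega> = e" using crit u d\<omega> by auto
    obtain m where m: "m \<in> {u..\<omega>}" "\<forall>v\<in>{u..\<omega>}. ?y v \<le> ?y m"
      using continuous_attains_sup[OF compact_Icc _ cont[of u \<omega>]] u by auto
    have "?y m = e"
    proof (cases "m = u \<or> m = \<omega>")
      case False
      then have um: "u < m" "m < \<omega>" using m(1) by auto
      have "deriv ?y m = 0"
      proof (rule DERIV_local_max[OF D])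
        show "0 < min (m - u) (\<omega> - m)" using um by simp
        show "\<forall>v. \<bar>m - v\<bar> < min (m - u) (\<omega> - m) \<longrightarrow> ?y v \<le> ?y m"
          using m(2) by (simp add: abs_less_iff)
      qed (use um u in auto)
      then show ?thesis using crit m(1) u by auto
    qed (use eq in auto)
    then have "weierstrass_p L (of_real v) = of_real e" if "u < v" "v < \<omega>" for v
    proof -
      have "?y v = e" using m(2) ge[of v] that u \<open>?y m = e\<close> by (intro antisym) auto
      then show ?thesis using weierstrass_p_of_real[OF nL[of v]] that u by simp
    qed
    then show False using not_constant_on_interval[OF u(2), of "of_real e"] nL u by auto
  qed
  show ?thesis
  proof (rule ccontr)
    assume "\<not> deriv ?y x < 0"
    \<comment> \<open>The function is infinite at 0 and rising at \<open>x\<close>, so it has a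
      minimum strictly in between, which would be a critical point below
      \<open>\<omega>\<close>.\<close>
    then have pos: "0 < deriv ?y x" using nz[OF x] by simp
    have "\<forall>\<^sub>F u in at_right 0. ?y x < ?y u"
      using real_weierstrass_p_at_right_0 by (simp add: filterlim_at_top_dense)
    then obtain p where p: "0 < p" "\<forall>u>0. u < p \<longrightarrow> ?y x < ?y u"
      unfolding eventually_at_right_field by auto
    define l where "l = min p x / 2"
    have l: "0 < l" "l < x" "l < p" using p(1) x by (auto simp: l_def)
    then have yl: "?y x < ?y l" using p by simp
    obtain m where m: "m \<in> {l..x}" "\<forall>v\<in>{l..x}. ?y m \<le> ?y v"
      using continuous_attains_inf[OF compact_Icc _ cont[of l x]] l x by auto
    have "m \<noteq> l" using bspec[OF m(2), of x] l yl by auto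
    moreover have "m \<noteq> x"
    proof
      assume "m = x"
      have "(?y has_real_derivative deriv ?y x) (at x)" using D[of x] x by simp
      then obtain \<delta> where \<delta>: "0 < \<delta>" "\<forall>h>0. h < \<delta> \<longrightarrow> ?y (x - h) < ?y x"
        using DERIV_pos_inc_left pos by blast
      define h where "h = min (\<delta> / 2) (x - l)"
      have h: "0 < h" "h < \<delta>" "h \<le> x - l" using \<delta>(1) l by (auto simp: h_def)
      then have "?y (x - h) < ?y x" using \<delta>(2) by blast
      moreover have "?y x \<le> ?y (x - h)" using m(2) \<open>m = x\<close> h by simp
      ultimately show False by simp
    qed
    ultimately have lm: "l < m" "m < x" using m(1) by auto
    have "deriv ?y m = 0"
    proof (rule DERIV_local_min[OF D])
      show "0 < min (m - l) (x - m)" using lm by simp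
      show "\<forall>v. \<bar>m - v\<bar> < min (m - l) (x - m) \<longrightarrow> ?y m \<le> ?y v"
        using m(2) by (simp add: abs_less_iff)
    qed (use lm l x in auto)
    then show False using nz[of m] lm l x by simp
  qed
qed

end

section \<open>Solutions of the conformal equation\<close>

lemma conformal_solution_DERIV:
  assumes "conformal_solution \<aa> H J S" "\<tau> \<in> J"
  shows "(S has_real_derivative deriv S \<tau>) (at \<tau>)"
    and "(deriv S \<tau>)\<^sup>2 = (S \<tau>)\<^sup>2 + H * S \<tau> - \<aa> / 3 * S \<tau> ^ 4"
proof -
  have "S differentiable (at \<tau>)"
    using assms unfolding conformal_solution_def by (auto simp: differentiable_on_eq_differentiable_at)
  then show "(S has_real_derivative deriv S \<tau>) (at \<tau>)"
    by (simp add: DERIV_deriv_iff_real_differentiable)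
  show "(deriv S \<tau>)\<^sup>2 = (S \<tau>)\<^sup>2 + H * S \<tau> - \<aa> / 3 * S \<tau> ^ 4"
    using assms unfolding conformal_solution_def by (auto simp: algebra_simps)
qed

text \<open>Time reversal: decreasing branches and the part left of a zero reduce to increasing
  branches and the part right of a zero.\<close>

lemma conformal_solution_reflect:
  assumes "conformal_solution \<aa> H J S"
  shows "conformal_solution \<aa> H (uminus ` J) (\<lambda>\<tau>. S (- \<tau>))"
proof -
  have D: "((\<lambda>\<tau>. S (- \<tau>)) has_real_derivative - deriv S (- \<tau>)) (at \<tau>)" if "- \<tau> \<in> J" for \<tau>
    using conformal_solution_DERIV(1)[OF assms that] by (simp only: DERIV_mirror)
  have mem: "\<tau> \<in> uminus ` J \<longleftrightarrow> - \<tau> \<in> J" for \<tau> by (auto simp: image_iff intro!: bexI[of _ "- \<tau>"])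
  have "{\<tau> \<in> uminus ` J. S (- \<tau>) = 0} = uminus ` {\<tau> \<in> J. S \<tau> = 0}"
    by (auto simp: image_iff intro!: bexI[of _ "- _"])
  then have "interior {\<tau> \<in> uminus ` J. S (- \<tau>) = 0} = {}"
    using assms unfolding conformal_solution_def by (simp add: interior_negations)
  moreover have "open (uminus ` J)" "is_interval (uminus ` J)"
    using assms unfolding conformal_solution_def by (auto simp: open_negations)
  moreover have "(\<lambda>\<tau>. S (- \<tau>)) differentiable_on (uminus ` J)"
    unfolding differentiable_on_def real_differentiable_def
    using has_field_derivative_at_within[OF D] mem by blast
  moreover have "(deriv (\<lambda>\<tau>. S (- \<tau>)) \<tau>)\<^sup>2 + \<aa> / 3 * S (- \<tau>) ^ 4 - (S (- \<tau>))\<^sup>2 - H * S (- \<tau>) = 0"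
    if "\<tau> \<in> uminus ` J" for \<tau>
    using DERIV_imp_deriv[OF D] conformal_solution_DERIV(2)[OF assms] that by (simp add: mem)
  ultimately show ?thesis
    using assms mem unfolding conformal_solution_def by auto
qed

text \<open>The signs of the parameters make every term of the right-hand side nonnegative, and
  \<open>H * S \<tau>\<close> positive.\<close>

lemma conformal_solution_deriv_nonzero:
  assumes "conformal_solution \<aa> H J S" "\<tau> \<in> J" "0 < S \<tau>" "\<aa> \<le> 0" "0 < H"
  shows "deriv S \<tau> \<noteq> 0"
proof -
  have "\<aa> / 3 * S \<tau> ^ 4 \<le> 0" using assms by (simp add: mult_nonpos_nonneg)
  moreover have "0 < (S \<tau>)\<^sup>2 + H * S \<tau>" using assms by (simp add: add_pos_pos)
  ultimately have "0 < (deriv S \<tau>)\<^sup>2" using conformal_solution_DERIV(2)[OF assms(1,2)] by linarith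
  then show ?thesis by auto
qed

text \<open>Continuity of \<open>deriv S\<close> is not part of \<open>conformal_solution\<close>,
  so its sign is followed through extrema: the maximum on \<open>{a..b}\<close> is not at
  \<open>a\<close>, and in the interior it would be a critical point with positive value; hence it
  is at \<open>b\<close>.\<close>

lemma conformal_solution_increasing_persists:
  assumes cs: "conformal_solution \<aa> H J S" and par: "\<aa> \<le> 0" "0 < H"
    and a: "a \<in> J" "0 < S a" "0 < deriv S a" and b: "b \<in> J" "a < b"
  shows "0 < S b \<and> 0 < deriv S b"
proof -
  have ab: "{a..b} \<subseteq> J"
    using cs a b unfolding conformal_solution_def by (meson atLeastAtMost_iff mem_is_interval_1_I subsetI)
  note D = conformal_solution_DERIV(1)[OF cs]
  have "continuous_on {a..b} S"
    using ab by (intro continuous_at_imp_continuous_on) (auto intro!: DERIV_isCont[OF D])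
  then obtain m where m: "m \<in> {a..b}" "\<forall>v\<in>{a..b}. S v \<le> S m"
    using continuous_attains_sup[OF compact_Icc, of a b S] b by auto
  have Sm: "0 < S m" using m(2) a b by force
  have "m \<noteq> a"
  proof
    assume "m = a"
    obtain d where d: "0 < d" "\<forall>h>0. h < d \<longrightarrow> S a < S (a + h)"
      using DERIV_pos_inc_right[OF D[OF a(1)] a(3)] by blast
    define h where "h = min (d / 2) (b - a)"
    have h: "0 < h" "h < d" "h \<le> b - a" using d(1) b by (auto simp: h_def)
    then show False using d(2) bspec[OF m(2), of "a + h"] \<open>m = a\<close> by force
  qed
  moreover have "m = b" if "m \<noteq> a"
  proof (rule ccontr)
    assume "m \<noteq> b"
    then have am: "a < m" "m < b" using m(1) that by auto
    have "deriv S m = 0"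
    proof (rule DERIV_local_max[OF D])
      show "0 < min (m - a) (b - m)" using am by simp
      show "\<forall>v. \<bar>m - v\<bar> < min (m - a) (b - m) \<longrightarrow> S v \<le> S m"
        using m(2) by (simp add: abs_less_iff)
    qed (use ab m in auto)
    then show False using conformal_solution_deriv_nonzero[OF cs _ Sm par] ab m by auto
  qed
  ultimately have mb: "m = b" by simp
  have "\<not> deriv S b < 0"
  proof
    assume "deriv S b < 0"
    then obtain d where d: "0 < d" "\<forall>h>0. h < d \<longrightarrow> S b < S (b - h)"
      using DERIV_neg_dec_left[OF D[OF b(1)]] by blast
    define h where "h = min (d / 2) (b - a)"
    have h: "0 < h" "h < d" "h \<le> b - a" using d(1) b by (auto simp: h_def)
    then show False using d(2) bspec[OF m(2), of "b - h"] mb by force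
  qed
  then show ?thesis using conformal_solution_deriv_nonzero[OF cs b(1) _ par] Sm mb by force
qed

lemma conformal_solution_decreasing_persists:
  assumes cs: "conformal_solution \<aa> H J S" and par: "\<aa> \<le> 0" "0 < H"
    and a: "a \<in> J" "0 < S a" "deriv S a < 0" and b: "b \<in> J" "b < a"
  shows "0 < S b \<and> deriv S b < 0"
proof -
  have d: "deriv (\<lambda>\<tau>. S (- \<tau>)) \<tau> = - deriv S (- \<tau>)" if "- \<tau> \<in> J" for \<tau>
    using conformal_solution_DERIV(1)[OF cs that] by (intro DERIV_imp_deriv) (simp only: DERIV_mirror)
  show ?thesis
    using conformal_solution_increasing_persists[OF conformal_solution_reflect[OF cs] par, of "- a" "- b"] a b d
    by simp
qed

text \<open>All that the uniqueness argument needs to know of the model solution, so that it runs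
  without the Weierstrass function. \<open>T\<close> is the first blow-up point.\<close>

locale conformal_profile =
  fixes f f' :: "real \<Rightarrow> real" and T \<aa> H :: real
  assumes T: "0 < T" and H: "0 < H" and \<aa>: "\<aa> \<le> 0"
    and even: "\<And>x. f (- x) = f x" and zero: "f 0 = 0"
    and DERIV: "\<And>x. \<bar>x\<bar> < T \<Longrightarrow> (f has_real_derivative f' x) (at x)"
    and ode: "\<And>x. \<bar>x\<bar> < T \<Longrightarrow> (f' x)\<^sup>2 = (f x)\<^sup>2 + H * f x - \<aa> / 3 * f x ^ 4"
    and increasing: "\<And>x. 0 < x \<Longrightarrow> x < T \<Longrightarrow> 0 < f' x"
    and blowup: "filterlim f at_top (at_left T)"
begin

lemma strict_increasing: "f x < f y" if "0 \<le> x" "x < y" "y < T"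
proof (rule DERIV_pos_imp_increasing_open[OF that(2)])
  show "\<exists>d. (f has_real_derivative d) (at u) \<and> 0 < d" if "x < u" "u < y" for u
    using DERIV[of u] increasing[of u] \<open>0 \<le> x\<close> \<open>y < T\<close> that by auto
  show "continuous_on {x..y} f"
    using that by (intro continuous_at_imp_continuous_on ballI DERIV_isCont[OF DERIV]) auto
qed

lemma positive: "0 < f x" if "x \<noteq> 0" "\<bar>x\<bar> < T"
  using strict_increasing[of 0 x] strict_increasing[of 0 "- x"] that even[of x] zero by (cases "0 < x") auto

lemma surjective:
  assumes "0 < v"
  shows "\<exists>x. 0 < x \<and> x < T \<and> f x = v"
proof -
  have "\<forall>\<^sub>F x in at_left T. v < f x" using blowup by (simp add: filterlim_at_top_dense)
  then obtain b where b: "b < T" "\<forall>y>b. y < T \<longrightarrow> v < f y"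
    unfolding eventually_at_left_field by auto
  define u where "u = (max b 0 + T) / 2"
  have u: "0 < u" "u < T" "v < f u" using b T by (auto simp: u_def max_def)
  have "\<exists>x\<ge>0. x \<le> u \<and> f x = v"
    using u assms zero by (intro IVT') (auto intro!: continuous_at_imp_continuous_on DERIV_isCont[OF DERIV])
  then show ?thesis using u assms zero by (metis order_le_less order_le_less_trans)
qed

lemma inj: "inj_on f {0<..<T}"
proof (rule inj_onI)
  fix x y assume "x \<in> {0<..<T}" "y \<in> {0<..<T}" "f x = f y"
  then show "x = y"
    using strict_increasing[of x y] strict_increasing[of y x] by (cases x y rule: linorder_cases) auto
qed

text \<open>
  The inverse of \<open>f\<close> on the right half of the interval turns a positive increasing solution of the
  autonomous equation into a function of slope 1.
\<close>

lemma increasing_branch: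
  assumes K: "is_interval K"
    and D: "\<And>\<tau>. \<tau> \<in> K \<Longrightarrow> (S has_real_derivative S' \<tau>) (at \<tau>)"
    and pos: "\<And>\<tau>. \<tau> \<in> K \<Longrightarrow> 0 < S \<tau>" "\<And>\<tau>. \<tau> \<in> K \<Longrightarrow> 0 < S' \<tau>"
    and sq: "\<And>\<tau>. \<tau> \<in> K \<Longrightarrow> (S' \<tau>)\<^sup>2 = (S \<tau>)\<^sup>2 + H * S \<tau> - \<aa> / 3 * S \<tau> ^ 4"
  shows "\<exists>c. \<forall>\<tau>\<in>K. 0 < \<tau> - c \<and> \<tau> - c < T \<and> S \<tau> = f (\<tau> - c)"
proof -
  define g where "g = inv_into {0<..<T} f"
  have g: "0 < g v" "g v < T" "f (g v) = v" if "0 < v" for v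
    using surjective[OF that] inv_into_into[of v f "{0<..<T}"] f_inv_into_f[of v f "{0<..<T}"]
    unfolding g_def by force+
  have gf: "g (f x) = x" if "x \<in> {0<..<T}" for x
    using that by (simp add: g_def inj)
  have Dg: "(g has_real_derivative inverse (f' (g v))) (at v)" if v: "0 < v" for v
  proof -
    have "(g has_real_derivative inverse (f' (g v))) (at (f (g v)))"
    proof (rule has_field_derivative_inverse_strong[of f, OF _ _ open_greaterThanLessThan _ _ gf])
      show "(f has_real_derivative f' (g v)) (at (g v))" using g[OF v] by (intro DERIV) auto
      show "f' (g v) \<noteq> 0" using increasing g[OF v] by force
      show "continuous_on {0<..<T} f"
        by (intro continuous_at_imp_continuous_on ballI DERIV_isCont[OF DERIV]) auto
    qed (use g[OF v] in auto)
    then show ?thesis using g[OF v] by simp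
  qed
  have slope: "((\<lambda>\<tau>. g (S \<tau>) - \<tau>) has_real_derivative 0) (at \<tau> within K)" if \<tau>: "\<tau> \<in> K" for \<tau>
  proof -
    note gS = g[OF pos(1)[OF \<tau>]]
    have "(f' (g (S \<tau>)))\<^sup>2 = (S' \<tau>)\<^sup>2" using ode[of "g (S \<tau>)"] gS sq[OF \<tau>] by simp
    \<comment> \<open>Equal values give equal squares of the slopes, and both slopes are
      positive.\<close>
    then have eq: "f' (g (S \<tau>)) = S' \<tau>"
      using increasing[of "g (S \<tau>)"] gS pos(2)[OF \<tau>] by (simp add: power2_eq_iff)
    have "((\<lambda>\<tau>. g (S \<tau>)) has_real_derivative inverse (f' (g (S \<tau>))) * S' \<tau>) (at \<tau>)"
      by (rule DERIV_chain2[OF Dg[OF pos(1)[OF \<tau>]] D[OF \<tau>]])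
    then have "((\<lambda>\<tau>. g (S \<tau>)) has_real_derivative 1) (at \<tau>)"
      using eq pos(2)[OF \<tau>] by simp
    then have "((\<lambda>\<tau>. g (S \<tau>) - \<tau>) has_real_derivative 1 - 1) (at \<tau>)"
      by (rule DERIV_diff) (rule DERIV_ident)
    then show ?thesis by (simp add: has_field_derivative_at_within)
  qed
  obtain c where c: "\<forall>\<tau>\<in>K. g (S \<tau>) - \<tau> = c"
    using has_field_derivative_zero_constant[OF is_interval_convex[OF K] slope] by blast
  show ?thesis
  proof (intro exI[of _ "- c"] ballI)
    fix \<tau> assume \<tau>: "\<tau> \<in> K"
    have "\<tau> - - c = g (S \<tau>)" using c \<tau> by force
    then show "0 < \<tau> - - c \<and> \<tau> - - c < T \<and> S \<tau> = f (\<tau> - - c)"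
      using g[OF pos(1)[OF \<tau>]] by simp
  qed
qed

text \<open>Right of a zero a solution can neither decrease while positive, since it would have been
  positive at the zero, nor stay 0 on an interval, by the empty interior of the zero set. It is
  therefore an increasing branch, and continuity at \<open>z\<close> fixes the translation.\<close>

lemma branch_right_of_zero:
  assumes cs: "conformal_solution \<aa> H J S" and z: "z \<in> J" "S z = 0" and \<tau>: "\<tau> \<in> J" "z < \<tau>"
  shows "\<tau> - z < T \<and> S \<tau> = f (\<tau> - z)"
proof -
  note D = conformal_solution_DERIV(1)[OF cs]
  have J: "open J" "is_interval J" "\<forall>x\<in>J. 0 \<le> S x" "interior {\<tau> \<in> J. S \<tau> = 0} = {}"
    using cs unfolding conformal_solution_def by auto
  have between: "x \<in> J" if "y \<in> J" "z \<le> x" "x \<le> y" for x y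
    using J(2) z(1) that by (meson mem_is_interval_1_I)
  have no_dec: "\<not> (0 < S x \<and> deriv S x < 0)" if "x \<in> J" "z < x" for x
    using conformal_solution_decreasing_persists[OF cs \<aa> H that(1) _ _ z(1) that(2)] z(2) by auto
  \<comment> \<open>If this failed at \<open>x\<close>, no earlier point could carry a positive
    increasing value, so \<open>S\<close> would vanish on all of \<open>(z, x)\<close>.\<close>
  have pos: "0 < S x \<and> 0 < deriv S x" if x: "x \<in> J" "z < x" for x
  proof (rule ccontr)
    assume n: "\<not> (0 < S x \<and> 0 < deriv S x)"
    have "S y = 0" if y: "z < y" "y < x" for y
    proof (rule ccontr)
      assume "S y \<noteq> 0"
      moreover have yJ: "y \<in> J" using between[OF x(1)] y by simp
      ultimately have "0 < S y" using J(3) by force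
      then have "0 < deriv S y"
        using no_dec[OF yJ y(1)] conformal_solution_deriv_nonzero[OF cs yJ _ \<aa> H] by force
      then show False
        using conformal_solution_increasing_persists[OF cs \<aa> H yJ \<open>0 < S y\<close> _ x(1) y(2)] n by blast
    qed
    then have "{z<..<x} \<subseteq> {\<tau> \<in> J. S \<tau> = 0}" using between[OF x(1)] by auto
    then have "{z<..<x} \<subseteq> interior {\<tau> \<in> J. S \<tau> = 0}" by (simp add: interior_maximal)
    then show False using J(4) x(2) by simp
  qed
  let ?K = "J \<inter> {z<..}"
  have "is_interval ?K" by (rule is_interval_Int[OF J(2)]) (auto simp: is_interval_1)
  then obtain c where c: "\<forall>x\<in>?K. 0 < x - c \<and> x - c < T \<and> S x = f (x - c)"
    using increasing_branch[of ?K S "deriv S"] D pos conformal_solution_DERIV(2)[OF cs] by auto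
  \<comment> \<open>A branch starting after \<open>z\<close> does not cover the points just right of
    \<open>z\<close>; one starting before \<open>z\<close> stays above \<open>f (z - c) > 0\<close>,
    against \<open>S z = 0\<close>.\<close>
  have "c = z"
  proof (rule linorder_cases[of c z])
    assume "z < c"
    define x where "x = min c \<tau>"
    have "x \<in> ?K" using between[OF \<tau>(1), of x] \<tau>(2) \<open>z < c\<close> by (auto simp: x_def)
    then have "0 < x - c" using c by blast
    then show ?thesis by (simp add: x_def)
  next
    assume "c < z"
    have "\<tau> - c < T" using c \<tau> by blast
    then have "z - c < T" using \<tau>(2) by simp
    then have p: "0 < f (z - c)" using positive[of "z - c"] \<open>c < z\<close> by simp
    have "f (z - c) \<le> S z"
    proof (rule tendsto_lowerbound)
      show "(S \<longlongrightarrow> S z) (at_right z)"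
        using DERIV_isCont[OF D[OF z(1)]] by (auto simp: isCont_def intro: filterlim_mono[OF _ order_refl at_le])
      show "\<forall>\<^sub>F x in at_right z. f (z - c) \<le> S x"
        unfolding eventually_at_right_field
      proof (intro exI[of _ \<tau>] conjI allI impI \<tau>(2))
        fix x assume x: "z < x" "x < \<tau>"
        then have "x \<in> ?K" using between[OF \<tau>(1), of x] by auto
        then have "x - c < T" "S x = f (x - c)" using c by auto
        then show "f (z - c) \<le> S x" using strict_increasing[of "z - c" "x - c"] x \<open>c < z\<close> by simp
      qed
    qed simp
    then show ?thesis using p z(2) by simp
  qed simp
  then show ?thesis using c \<tau> by simp
qed

text \<open>At a zero the two sides are copies of the branch, glued by evenness of \<open>f\<close>.
  Without a zero \<open>deriv S\<close> keeps its sign: it cannot go from positive to negative by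
  persistence, and going from negative to positive would need an interior minimum, a critical point
  with positive value.\<close>

lemma solution_is_translate:
  assumes cs: "conformal_solution \<aa> H J S"
  shows "\<exists>z. J \<subseteq> {z - T<..<z + T} \<and> (\<forall>\<tau>\<in>J. S \<tau> = f (\<tau> - z))"
proof (cases "\<exists>z\<in>J. S z = 0")
  case True
  then obtain z where z: "z \<in> J" "S z = 0" by blast
  have "\<bar>\<tau> - z\<bar> < T \<and> S \<tau> = f (\<tau> - z)" if \<tau>: "\<tau> \<in> J" for \<tau>
  proof (rule linorder_cases[of \<tau> z])
    assume "\<tau> < z"
    then show ?thesis
      using branch_right_of_zero[OF conformal_solution_reflect[OF cs], of "- z" "- \<tau>"] z \<tau> even[of "z - \<tau>"]
      by (simp add: add.commute)
  next
    assume "\<tau> = z" then show ?thesis using z T zero by simp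
  next
    assume "z < \<tau>" then show ?thesis using branch_right_of_zero[OF cs z \<tau>] by simp
  qed
  then show ?thesis by (intro exI[of _ z]) (force simp: abs_less_iff)
next
  case False
  note D = conformal_solution_DERIV(1)[OF cs]
  have pos: "0 < S \<tau>" if "\<tau> \<in> J" for \<tau>
    using cs False that unfolding conformal_solution_def by (metis order_le_less)
  have nz: "deriv S \<tau> \<noteq> 0" if "\<tau> \<in> J" for \<tau>
    using conformal_solution_deriv_nonzero[OF cs that pos[OF that] \<aa> H] .
  have J: "is_interval J" using cs unfolding conformal_solution_def by auto
  have branch: "\<exists>c. \<forall>\<tau>\<in>J. 0 < \<tau> - c \<and> \<tau> - c < T \<and> S \<tau> = f (\<tau> - c)"
    if cs: "conformal_solution \<aa> H J S" and pos: "\<forall>\<tau>\<in>J. 0 < S \<tau> \<and> 0 < deriv S \<tau>" for J S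
    using increasing_branch[of J S "deriv S"] conformal_solution_DERIV[OF cs] pos cs
    unfolding conformal_solution_def by blast
  show ?thesis
  proof (cases "\<forall>\<tau>\<in>J. 0 < deriv S \<tau>")
    case True
    then obtain c where c: "\<forall>\<tau>\<in>J. 0 < \<tau> - c \<and> \<tau> - c < T \<and> S \<tau> = f (\<tau> - c)"
      using branch[OF cs] pos by blast
    then show ?thesis by (intro exI[of _ c]) force
  next
    case not_all: False
    have neg: "deriv S \<tau> < 0" if \<tau>: "\<tau> \<in> J" for \<tau>
    proof (rule ccontr)
      assume "\<not> deriv S \<tau> < 0"
      then have a: "0 < deriv S \<tau>" using nz[OF \<tau>] by simp
      obtain b where b: "b \<in> J" "deriv S b < 0" using not_all nz by force
      have "b < \<tau>"
        using conformal_solution_increasing_persists[OF cs \<aa> H \<tau> pos[OF \<tau>] a b(1)] a b(2)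
        by (metis less_asym linorder_neqE)
      have bJ: "{b..\<tau>} \<subseteq> J" using J b \<tau> by (meson atLeastAtMost_iff mem_is_interval_1_I subsetI)
      have "continuous_on {b..\<tau>} S"
        using bJ by (intro continuous_at_imp_continuous_on) (auto intro!: DERIV_isCont[OF D])
      then obtain m where m: "m \<in> {b..\<tau>}" "\<forall>v\<in>{b..\<tau>}. S m \<le> S v"
        using continuous_attains_inf[OF compact_Icc, of b \<tau> S] \<open>b < \<tau>\<close> by auto
      have "m \<noteq> b"
      proof
        assume "m = b"
        obtain d where d: "0 < d" "\<forall>h>0. h < d \<longrightarrow> S b > S (b + h)"
          using DERIV_neg_dec_right[OF D[OF b(1)] b(2)] by blast
        define h where "h = min (d / 2) (\<tau> - b)"
        have h: "0 < h" "h < d" "h \<le> \<tau> - b" using d(1) \<open>b < \<tau>\<close> by (auto simp: h_def)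
        then show False using d(2) bspec[OF m(2), of "b + h"] \<open>m = b\<close> by force
      qed
      moreover have "m \<noteq> \<tau>"
      proof
        assume "m = \<tau>"
        obtain d where d: "0 < d" "\<forall>h>0. h < d \<longrightarrow> S (\<tau> - h) < S \<tau>"
          using DERIV_pos_inc_left[OF D[OF \<tau>] a] by blast
        define h where "h = min (d / 2) (\<tau> - b)"
        have h: "0 < h" "h < d" "h \<le> \<tau> - b" using d(1) \<open>b < \<tau>\<close> by (auto simp: h_def)
        then show False using d(2) bspec[OF m(2), of "\<tau> - h"] \<open>m = \<tau>\<close> by force
      qed
      ultimately have bm: "b < m" "m < \<tau>" using m(1) by auto
      have mJ: "m \<in> J" using bJ m(1) by auto
      have "deriv S m = 0"
      proof (rule DERIV_local_min[OF D[OF mJ]])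
        show "0 < min (m - b) (\<tau> - m)" using bm by simp
        show "\<forall>v. \<bar>m - v\<bar> < min (m - b) (\<tau> - m) \<longrightarrow> S m \<le> S v"
          using m(2) by (simp add: abs_less_iff)
      qed
      then show False using nz[OF mJ] by simp
    qed
    have d: "deriv (\<lambda>\<tau>. S (- \<tau>)) (- \<tau>) = - deriv S \<tau>" if "\<tau> \<in> J" for \<tau>
      using D[OF that] DERIV_mirror[of S _ "- \<tau>"] by (intro DERIV_imp_deriv) simp
    have "\<forall>\<tau>\<in>uminus ` J. 0 < S (- \<tau>) \<and> 0 < deriv (\<lambda>\<tau>. S (- \<tau>)) \<tau>"
      using pos neg d by auto
    then obtain c where c: "\<forall>\<tau>\<in>uminus ` J. 0 < \<tau> - c \<and> \<tau> - c < T \<and> S (- \<tau>) = f (\<tau> - c)"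
      using branch[OF conformal_solution_reflect[OF cs]] by blast
    have "- \<tau> - c > 0 \<and> - \<tau> - c < T \<and> S \<tau> = f (\<tau> - - c)" if "\<tau> \<in> J" for \<tau>
      using bspec[OF c, of "- \<tau>"] that even[of "\<tau> - - c"] by simp
    then show ?thesis by (intro exI[of _ "- c"]) force
  qed
qed

text \<open>Supplies the prolongation against which \<open>maximal_domain\<close> is tested.\<close>

lemma translate_is_solution: "conformal_solution \<aa> H {z - T<..<z + T} (\<lambda>\<tau>. f (\<tau> - z))"
proof -
  have D: "((\<lambda>\<tau>. f (\<tau> - z)) has_real_derivative f' (\<tau> - z)) (at \<tau>)" if "\<tau> \<in> {z - T<..<z + T}" for \<tau>
  proof -
    have "(f has_real_derivative f' (\<tau> - z)) (at (\<tau> + - z))"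
      using DERIV[of "\<tau> - z"] that by (simp add: abs_less_iff)
    then show ?thesis by (simp only: DERIV_shift) simp
  qed
  have ge: "0 \<le> f (\<tau> - z)" if "\<tau> \<in> {z - T<..<z + T}" for \<tau>
    using positive[of "\<tau> - z"] zero that by (cases "\<tau> = z") (auto simp: abs_less_iff)
  have "{\<tau> \<in> {z - T<..<z + T}. f (\<tau> - z) = 0} \<subseteq> {z}"
    using positive[of "_ - z"] by (force simp: abs_less_iff)
  then have "interior {\<tau> \<in> {z - T<..<z + T}. f (\<tau> - z) = 0} = {}"
    using interior_mono[of _ "{z}"] by (metis interior_singleton subset_empty)
  moreover have "(\<lambda>\<tau>. f (\<tau> - z)) differentiable_on {z - T<..<z + T}"
    unfolding differentiable_on_def real_differentiable_def
    using has_field_derivative_at_within[OF D] by blast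
  moreover have "(deriv (\<lambda>\<tau>. f (\<tau> - z)) \<tau>)\<^sup>2 + \<aa> / 3 * f (\<tau> - z) ^ 4 - (f (\<tau> - z))\<^sup>2 - H * f (\<tau> - z) = 0"
    if "\<tau> \<in> {z - T<..<z + T}" for \<tau>
    using DERIV_imp_deriv[OF D[OF that]] ode[of "\<tau> - z"] that by (simp add: abs_less_iff)
  ultimately show ?thesis
    using ge unfolding conformal_solution_def by (auto simp: is_interval_oo)
qed

theorem maximal_solution_is_translate:
  assumes "conformal_solution \<aa> H J S" "maximal_domain \<aa> H J S"
  shows "\<exists>z. J = {z - T<..<z + T} \<and> (\<forall>\<tau>\<in>J. S \<tau> = f (\<tau> - z))"
proof -
  obtain z where z: "J \<subseteq> {z - T<..<z + T}" "\<forall>\<tau>\<in>J. S \<tau> = f (\<tau> - z)"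
    using solution_is_translate[OF assms(1)] by blast
  have "{z - T<..<z + T} = J"
    using assms(2)[unfolded maximal_domain_def, rule_format, of "{z - T<..<z + T}" "\<lambda>\<tau>. f (\<tau> - z)"]
      translate_is_solution z by auto
  then show ?thesis using z by blast
qed

end

section \<open>The model solution\<close>

lemma cosh_triple: "cosh (3 * x) = 4 * cosh x ^ 3 - 3 * cosh x" for x :: real
proof -
  have "cosh (3 * x) = cosh (2 * x + x)" by simp
  also have "\<dots> = 4 * cosh x ^ 3 - 3 * cosh x"
    unfolding cosh_add cosh_double sinh_double using cosh_square_eq[of x] by algebra
  finally show ?thesis .
qed

text \<open>The real root of the cubic determines its constant term; the triple-angle formula turns
  this into \<open>cosh (3 * \<theta>)\<close>.\<close>

lemma type_and_angle_parameter:
  assumes "type_and_angle \<aa> H 1 \<theta>"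
  shows "0 < \<theta>" and "\<aa> * H\<^sup>2 = 2 / 9 * (1 - cosh (3 * \<theta>))"
proof -
  show "0 < \<theta>" using assms by (simp add: type_and_angle_def)
  define x where "x = - 2 * (1 / 12 * cosh \<theta>)"
  have "complex_of_real x \<in> {x. 4 * x ^ 3 - of_real param_g2 * x - of_real (param_g3 \<aa> H) = 0}"
    using assms unfolding type_and_angle_def Let_def x_def by simp
  then have "complex_of_real (4 * x ^ 3 - param_g2 * x - param_g3 \<aa> H) = 0" by simp
  then have "4 * x ^ 3 - param_g2 * x - param_g3 \<aa> H = 0" by (simp only: of_real_eq_0_iff)
  then have "4 * x ^ 3 - 1 / 12 * x = 1 / 48 * (\<aa> * H\<^sup>2 - 2 / 9)"
    by (simp add: param_g2_def param_g3_def)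
  moreover have "4 * x ^ 3 - 1 / 12 * x = - cosh (3 * \<theta>) / 216"
    unfolding x_def cosh_triple by (simp add: field_simps power3_eq_cube)
  ultimately show "\<aa> * H\<^sup>2 = 2 / 9 * (1 - cosh (3 * \<theta>))" by (simp add: field_simps)
qed

text \<open>The cubic splits into the factor of the real root \<open>- cosh \<theta> / 6\<close> and
  the quadratic \<open>q = (v - e1)^2 + e2^2\<close> of the conjugate pair, which is
  positive.\<close>

lemma cubic_root_bound:
  fixes v \<theta> :: real
  assumes "0 < \<theta>"
  defines "p \<equiv> 4 * v ^ 3 - 1 / 12 * v - - cosh (3 * \<theta>) / 216"
  shows "0 \<le> p \<Longrightarrow> - cosh \<theta> / 6 \<le> v" and "p = 0 \<Longrightarrow> v = - cosh \<theta> / 6"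
proof -
  define c where "c = cosh \<theta>"
  define q where "q = (v - c / 12)\<^sup>2 + (c\<^sup>2 - 1) / 48"
  have "1 < c" using assms(1) cosh_real_strict_mono[of 0 \<theta>] by (simp add: c_def)
  then have "1 < c\<^sup>2" by (simp add: power_gt1)
  then have q: "0 < q" unfolding q_def by (intro add_nonneg_pos) auto
  have p: "p = 4 * (v + c / 6) * q"
    unfolding p_def q_def cosh_triple c_def[symmetric]
    by (simp add: field_simps power2_eq_square power3_eq_cube)
  show "- cosh \<theta> / 6 \<le> v" if "0 \<le> p"
    using that q unfolding p c_def[symmetric] by (simp add: zero_le_mult_iff)
  show "v = - cosh \<theta> / 6" if "p = 0"
    using that q unfolding p c_def[symmetric] by auto
qed

locale class_II_lattice = complex_lattice L w1 w2 for L w1 w2 +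
  fixes \<theta> \<omega> T H \<aa> :: real
  assumes g2: "invariant_g2 L = of_real (1 / 12)" and g3: "invariant_g3 L = of_real (- cosh (3 * \<theta>) / 216)"
    and \<theta>: "0 < \<theta>" and H: "0 < H" and \<aa>_eq: "\<aa> * H\<^sup>2 = 2 / 9 * (1 - cosh (3 * \<theta>))"
    and half_period: "real_half_period L \<omega>"
    and T: "0 < T" "T < \<omega>" "real_weierstrass_p L T = 1 / 12"
begin

sublocale real_lattice L w1 w2 "1 / 12" "- cosh (3 * \<theta>) / 216"
  by unfold_locales (fact g2 g3)+

text \<open>The pole has to be treated separately: the default value of
  \<open>real_weierstrass_p L 0\<close> is 0, and the quotient would then be \<open>- 3 * H\<close>
  instead of the limit 0.\<close>

definition profile :: "real \<Rightarrow> real" where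
  "profile x = (if x = 0 then 0 else 3 * H / (12 * real_weierstrass_p L x - 1))"

definition profile' :: "real \<Rightarrow> real" where
  "profile' x = (if x = 0 then 0 else - 36 * H * deriv (real_weierstrass_p L) x / (12 * real_weierstrass_p L x - 1)\<^sup>2)"

lemma not_mem: "of_real x \<notin> L" if "x \<noteq> 0" "\<bar>x\<bar> < \<omega>"
proof (cases "0 < x")
  case True
  then show ?thesis using not_mem_below_period[OF half_period, of x] that by simp
next
  case False
  then show ?thesis
    using not_mem_below_period[OF half_period, of "- x"] that minus_mem_iff[of "of_real x"] by simp
qed

lemma deriv_neg: "deriv (real_weierstrass_p L) x < 0" if "0 < x" "x < \<omega>"
  using real_weierstrass_p_deriv_neg[OF half_period cubic_root_bound[OF \<theta>] that] .

lemma greater_twelfth: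
  assumes "x \<noteq> 0" "\<bar>x\<bar> < T"
  shows "1 / 12 < real_weierstrass_p L x"
proof -
  let ?x = "\<bar>x\<bar>"
  have "real_weierstrass_p L T < real_weierstrass_p L ?x"
  proof (rule DERIV_neg_imp_decreasing_open[OF assms(2)])
    fix u assume "?x < u" "u < T"
    then have u: "0 < u" "u < \<omega>" "u \<noteq> 0" "\<bar>u\<bar> < \<omega>" using T by auto
    then show "\<exists>d. (real_weierstrass_p L has_real_derivative d) (at u) \<and> d < 0"
      using real_weierstrass_p_DERIV(1)[OF not_mem, of u] deriv_neg[of u] by blast
  next
    show "continuous_on {?x..T} (real_weierstrass_p L)"
      using assms T
      by (intro continuous_at_imp_continuous_on ballI DERIV_isCont[OF real_weierstrass_p_DERIV(1)[OF not_mem]]) auto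
  qed
  then show ?thesis using T(3) real_weierstrass_p_even[of x] by (simp add: abs_if split: if_splits)
qed

lemma \<aa>_neg: "\<aa> < 0"
proof -
  have "1 < cosh (3 * \<theta>)" using \<theta> cosh_real_strict_mono[of 0 "3 * \<theta>"] by simp
  then have "\<aa> * H\<^sup>2 < 0" unfolding \<aa>_eq by simp
  then show ?thesis using H by (simp add: mult_less_0_iff)
qed

lemma profile_DERIV:
  assumes "\<bar>x\<bar> < T"
  shows "(profile has_real_derivative profile' x) (at x)"
proof (cases "x = 0")
  case True
  let ?h = "\<lambda>x. Re (weierstrass_tail L (of_real x))"
  have h: "(?h \<longlongrightarrow> 0) (at 0)" using isCont_real_tail_0 by (simp add: isCont_def)
  \<comment> \<open>Multiplying numerator and denominator by \<open>x\<^sup>2\<close> removes the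
    pole; the difference quotient behaves like \<open>H * x / 4\<close>.\<close>
  have "((\<lambda>x. 3 * H * x / (12 + (12 * ?h x - 1) * x\<^sup>2)) \<longlongrightarrow> 0) (at 0)"
    by (rule tendsto_eq_intros h refl | simp)+
  moreover have "\<forall>\<^sub>F x in at 0. 3 * H * x / (12 + (12 * ?h x - 1) * x\<^sup>2) = (profile (0 + x) - profile 0) / x"
  proof (rule eventually_at_filter[THEN iffD2, OF always_eventually], intro allI impI)
    fix x :: real assume x: "x \<noteq> 0"
    have "12 * real_weierstrass_p L x - 1 = (12 + (12 * ?h x - 1) * x\<^sup>2) / x\<^sup>2"
      using x by (simp add: real_weierstrass_p_tail field_simps)
    then show "3 * H * x / (12 + (12 * ?h x - 1) * x\<^sup>2) = (profile (0 + x) - profile 0) / x"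
      using x by (simp add: profile_def power2_eq_square)
  qed
  ultimately have "((\<lambda>x. (profile (0 + x) - profile 0) / x) \<longlongrightarrow> 0) (at 0)"
    by (rule Lim_transform_eventually)
  then show ?thesis using True by (simp add: DERIV_def profile'_def)
next
  case False
  let ?y = "real_weierstrass_p L"
  have "\<bar>x\<bar> < \<omega>" using assms T by simp
  then have "(?y has_real_derivative deriv ?y x) (at x)"
    using real_weierstrass_p_DERIV(1)[OF not_mem] False by blast
  moreover have "12 * ?y x - 1 \<noteq> 0" using greater_twelfth[OF False assms] by simp
  ultimately have "((\<lambda>x. 3 * H / (12 * ?y x - 1)) has_real_derivative profile' x) (at x)"
    unfolding profile'_def using False
    by (auto intro!: derivative_eq_intros simp: power2_eq_square field_simps)
  moreover have "\<forall>\<^sub>F x in nhds x. profile x = 3 * H / (12 * ?y x - 1)"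
    using t1_space_nhds[OF False] by (rule eventually_mono) (simp add: profile_def)
  ultimately show ?thesis by (subst DERIV_cong_ev[OF refl _ refl])
qed

lemma profile_ode:
  assumes "\<bar>x\<bar> < T"
  shows "(profile' x)\<^sup>2 = (profile x)\<^sup>2 + H * profile x - \<aa> / 3 * profile x ^ 4"
proof (cases "x = 0")
  case True
  then show ?thesis by (simp add: profile_def profile'_def)
next
  case False
  \<comment> \<open>In \<open>u\<close> the cubic is a multiple of
    \<open>u ^ 3 + 3 * u\<^sup>2 - 9 * (\<aa> * H\<^sup>2)\<close>. Its three terms become, in this
    order, the linear, quadratic and quartic terms in \<open>profile x = 3 * H / u\<close>.\<close>
  define u where "u = 12 * real_weierstrass_p L x - 1"
  have u: "0 < u" using greater_twelfth[OF False assms] by (simp add: u_def)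
  have y: "real_weierstrass_p L x = (u + 1) / 12" by (simp add: u_def)
  define d where "d = deriv (real_weierstrass_p L) x"
  have "\<bar>x\<bar> < \<omega>" using assms T by simp
  then have "d\<^sup>2 = 4 * ((u + 1) / 12) ^ 3 - 1 / 12 * ((u + 1) / 12) - - cosh (3 * \<theta>) / 216"
    using real_weierstrass_p_DERIV(2)[OF not_mem, of x] False y by (simp add: d_def)
  also have "\<dots> = (u ^ 3 + 3 * u\<^sup>2 - 2 * (1 - cosh (3 * \<theta>))) / 432"
    by (simp add: field_simps power2_eq_square power3_eq_cube)
  finally have d2: "432 * d\<^sup>2 = u ^ 3 + 3 * u\<^sup>2 - 9 * (\<aa> * H\<^sup>2)"
    unfolding \<aa>_eq by (simp add: field_simps)
  define r where "r = 1 / u"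
  have ru: "r * u = 1" using u by (simp add: r_def)
  have "profile' x = - 36 * H * d * r\<^sup>2" and p: "profile x = 3 * H * r"
    using False by (simp_all add: profile_def profile'_def d_def u_def r_def power_divide)
  then have "(profile' x)\<^sup>2 = 3 * H\<^sup>2 * (432 * d\<^sup>2) * r ^ 4"
    by (simp add: power_mult_distrib flip: power_mult)
  also have "\<dots> = (3 * H * r)\<^sup>2 + H * (3 * H * r) - 27 * \<aa> * H ^ 4 * r ^ 4"
    unfolding d2 using ru by algebra
  finally show ?thesis unfolding p by (simp add: power_mult_distrib)
qed

lemma profile_blowup: "filterlim profile at_top (at_left T)"
proof -
  let ?y = "real_weierstrass_p L"
  have "(?y has_real_derivative deriv ?y T) (at T)"
    using real_weierstrass_p_DERIV(1)[OF not_mem] T by simp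
  then have "isCont ?y T" by (rule DERIV_isCont)
  then have "(?y \<longlongrightarrow> 1 / 12) (at_left T)"
    using T(3) by (auto simp: isCont_def intro: filterlim_mono[OF _ order_refl at_le])
  then have "((\<lambda>x. 12 * ?y x - 1) \<longlongrightarrow> 12 * (1 / 12) - 1) (at_left T)"
    by (intro tendsto_intros)
  moreover have near: "\<forall>\<^sub>F x in at_left T. 0 < x \<and> x < T"
    unfolding eventually_at_left_field using T(1) by (intro exI[of _ 0]) auto
  then have "\<forall>\<^sub>F x in at_left T. 0 < 12 * ?y x - 1"
  proof (rule eventually_mono)
    fix x assume "0 < x \<and> x < T"
    then show "0 < 12 * ?y x - 1" using greater_twelfth[of x] by simp
  qed
  ultimately have "filterlim (\<lambda>x. inverse (12 * ?y x - 1)) at_top (at_left T)"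
    by (intro filterlim_inverse_at_top) simp_all
  then have "filterlim (\<lambda>x. 3 * H * inverse (12 * ?y x - 1)) at_top (at_left T)"
    using H by (intro filterlim_tendsto_pos_mult_at_top[OF tendsto_const]) simp_all
  then show ?thesis
  proof (rule filterlim_mono_eventually[OF _ order_refl order_refl])
    show "\<forall>\<^sub>F x in at_left T. 3 * H * inverse (12 * ?y x - 1) = profile x"
      using near by (rule eventually_mono) (simp add: profile_def inverse_eq_divide)
  qed
qed

lemma weierstrass_factor_profile:
  assumes "\<bar>x\<bar> < T"
  shows "weierstrass_factor L H x = (profile x)\<^sup>2"
proof (cases "x = 0")
  case True
  then show ?thesis using zero_mem by (simp add: weierstrass_factor_def profile_def)
next
  case False
  moreover have "\<bar>x\<bar> < \<omega>" using assms T by simp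
  ultimately show ?thesis
    using not_mem[of x] by (simp add: weierstrass_factor_def profile_def power_divide power_mult_distrib)
qed

sublocale conformal_profile profile profile' T \<aa> H
proof
  show "0 < profile' x" if "0 < x" "x < T" for x
  proof -
    have "deriv (real_weierstrass_p L) x < 0" "0 < 12 * real_weierstrass_p L x - 1"
      using deriv_neg[of x] greater_twelfth[of x] that T by simp_all
    then show ?thesis
      using that H unfolding profile'_def by (simp add: divide_neg_pos mult_pos_neg)
  qed
qed (use T H \<aa>_neg profile_DERIV profile_ode profile_blowup
     in \<open>auto simp: profile_def real_weierstrass_p_even\<close>)

end

section \<open>From proper time to conformal time\<close>

lemma frechet_derivative_real:
  fixes f :: "real \<Rightarrow> real"
  assumes "f differentiable (at x)"
  shows "frechet_derivative f (at x) = (\<lambda>v. deriv f x * v)"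
proof -
  have "(f has_real_derivative deriv f x) (at x)"
    using assms by (simp add: DERIV_deriv_iff_real_differentiable)
  then have "(f has_derivative (\<lambda>v. deriv f x * v)) (at x)"
    by (simp add: has_field_derivative_def)
  then show ?thesis by (rule frechet_derivative_at[symmetric])
qed

lemma DERIV_transform_nhds:
  assumes "(f has_field_derivative D) (at x)" "\<forall>\<^sub>F y in nhds x. g y = f y"
  shows "(g has_field_derivative D) (at x)"
  using DERIV_cong_ev[OF refl assms(2) refl] assms(1) by (rule iffD2)

lemma conformal_interval_shift:
  "conformal_interval I s t0 c = (+) c ` conformal_interval I s t0 0"
  unfolding conformal_interval_def image_image conformal_time_def by simp

lemma conformal_scale_shift:
  assumes "inj_on (conformal_time s t0 0) I" "\<tau> \<in> conformal_interval I s t0 0"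
  shows "conformal_scale I s t0 c (c + \<tau>) = conformal_scale I s t0 0 \<tau>"
proof -
  obtain t where t: "t \<in> I" "\<tau> = conformal_time s t0 0 t"
    using assms(2) unfolding conformal_interval_def by blast
  have c: "conformal_time s t0 c = (\<lambda>t. c + conformal_time s t0 0 t)"
    by (rule ext) (simp add: conformal_time_def)
  then have "inj_on (conformal_time s t0 c) I" using assms(1) by (simp add: inj_on_def)
  then have "inv_into I (conformal_time s t0 c) (conformal_time s t0 c t) = t"
    using t(1) by (rule inv_into_f_f)
  moreover have "conformal_time s t0 c t = c + \<tau>" by (simp add: c t)
  ultimately show ?thesis
    using inv_into_f_f[OF assms(1) t(1)] by (simp add: conformal_scale_def t(2))
qed

locale RW_spacetime =
  fixes I :: "real set" and s :: "real \<Rightarrow> real" and \<Lambda> t0 \<aa> H :: real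
  assumes closed_RW: "closed_RW_spacetime I s \<Lambda> t0"
    and parameters: "internal_parameters I s \<aa> H"
begin

abbreviation "P \<equiv> {t \<in> I. 0 < s t}"
abbreviation "ct \<equiv> conformal_time s t0 0"
abbreviation "J \<equiv> conformal_interval I s t0 0"
abbreviation "S \<equiv> conformal_scale I s t0 0"
abbreviation "g \<equiv> inv_into I ct"

lemma smooth: "Ck_on k P s"
  using closed_RW unfolding closed_RW_spacetime_def smooth_on_def by blast

lemma differentiable_s: "s differentiable (at t)" if "t \<in> P"
  using smooth[of "Suc 0"] that by simp

lemma open_I: "open I" and interval_I: "is_interval I" and t0: "t0 \<in> I"
  and nonneg_s: "t \<in> I \<Longrightarrow> 0 \<le> s t"
  using closed_RW unfolding closed_RW_spacetime_def by auto

text \<open>\<open>smooth_on\<close> demands differentiability in a full neighbourhood sense, so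
  \<open>s\<close> is continuous at each point of \<open>P\<close> and stays positive
  nearby.\<close>

lemma open_P: "open P"
  unfolding open_subopen[of P]
proof
  fix t assume t: "t \<in> P"
  then have "isCont s t" using differentiable_s differentiable_imp_continuous_within by blast
  then have "\<forall>\<^sub>F x in at t. 0 < s x"
    unfolding isCont_def by (rule order_tendstoD(1)) (use t in simp)
  then have "\<forall>\<^sub>F x in nhds t. 0 < s x" using t by (simp add: eventually_nhds_conv_at)
  moreover have "\<forall>\<^sub>F x in nhds t. x \<in> I" using t open_I by (intro eventually_nhds_in_open) auto
  ultimately have "\<forall>\<^sub>F x in nhds t. x \<in> P" by eventually_elim simp
  then show "\<exists>T. open T \<and> t \<in> T \<and> T \<subseteq> P" unfolding eventually_nhds by blast
qed

lemma DERIV_s: "(s has_real_derivative deriv s t) (at t)" if "t \<in> P"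
  using differentiable_s[OF that] by (simp add: DERIV_deriv_iff_real_differentiable)

lemma DERIV_deriv_s: "(deriv s has_real_derivative deriv (deriv s) t) (at t)" if t: "t \<in> P"
proof -
  have "(\<lambda>x. frechet_derivative s (at x) 1) differentiable (at t)"
    using smooth[of "Suc (Suc 0)"] t by simp
  then obtain D where "((\<lambda>x. frechet_derivative s (at x) 1) has_real_derivative D) (at t)"
    unfolding real_differentiable_def by blast
  moreover have "\<forall>\<^sub>F x in nhds t. deriv s x = frechet_derivative s (at x) 1"
    using eventually_nhds_in_open[OF open_P t]
    by (rule eventually_mono) (simp add: frechet_derivative_real[OF differentiable_s])
  ultimately have "(deriv s has_real_derivative D) (at t)" by (rule DERIV_transform_nhds)
  then show ?thesis using DERIV_imp_deriv by blast
qed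

section \<open>Energy density and pressure in terms of the scale function\<close>

lemma criticality:
  assumes t: "t \<in> P"
  shows "(deriv s t)\<^sup>2 = 1 + H / s t - \<aa> / 3 * (s t)\<^sup>2"
proof -
  have "s t * ((deriv s t)\<^sup>2 + \<aa> / 3 * (s t)\<^sup>2 - 1) = H"
    using parameters t unfolding internal_parameters_def by blast
  then have "(deriv s t)\<^sup>2 + \<aa> / 3 * (s t)\<^sup>2 - 1 = H / s t" using t by (simp add: eq_divide_eq mult.commute)
  then show ?thesis by simp
qed

text \<open>Differentiating \<open>criticality\<close> produces a common factor
  \<open>deriv s t\<close>, which may be cancelled because the signs of the parameters make the
  right-hand side of \<open>criticality\<close> positive.\<close>

lemma second_derivative:
  assumes t: "t \<in> P" and par: "0 < H" "\<aa> \<le> 0"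
  shows "deriv (deriv s) t = - H / (2 * (s t)\<^sup>2) - \<aa> / 3 * s t"
proof -
  have st: "0 < s t" using t by simp
  have 1: "((\<lambda>x. (deriv s x)\<^sup>2) has_real_derivative 2 * deriv s t * deriv (deriv s) t) (at t)"
    using DERIV_deriv_s[OF t] by (auto intro!: derivative_eq_intros)
  have 2: "((\<lambda>x. 1 + H / s x - \<aa> / 3 * (s x)\<^sup>2) has_real_derivative
      - H / (s t)\<^sup>2 * deriv s t - 2 * \<aa> / 3 * s t * deriv s t) (at t)"
    using DERIV_s[OF t] st by (auto intro!: derivative_eq_intros simp: power2_eq_square)
  have "\<forall>\<^sub>F x in nhds t. (deriv s x)\<^sup>2 = 1 + H / s x - \<aa> / 3 * (s x)\<^sup>2"
    using eventually_nhds_in_open[OF open_P t] by (rule eventually_mono) (rule criticality)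
  then have "2 * deriv s t * deriv (deriv s) t = - H / (s t)\<^sup>2 * deriv s t - 2 * \<aa> / 3 * s t * deriv s t"
    by (rule DERIV_unique[OF 1 DERIV_transform_nhds[OF 2]])
  then have "deriv s t * (2 * deriv (deriv s) t) = deriv s t * (- H / (s t)\<^sup>2 - 2 * \<aa> / 3 * s t)"
    by (simp add: algebra_simps)
  moreover have "deriv s t \<noteq> 0"
  proof -
    have "0 < H / s t" using st par by simp
    moreover have "\<aa> / 3 * (s t)\<^sup>2 \<le> 0" using par by (simp add: mult_nonpos_nonneg)
    ultimately have "0 < (deriv s t)\<^sup>2" using criticality[OF t] by linarith
    then show ?thesis by auto
  qed
  ultimately have "2 * deriv (deriv s) t = - H / (s t)\<^sup>2 - 2 * \<aa> / 3 * s t" by simp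
  then show ?thesis using st by (simp add: field_simps)
qed

lemma energy_density_eq:
  assumes t: "t \<in> P"
  shows "energy_density \<Lambda> s t = 1 / (4 * pi) * (3 / (s t)\<^sup>2 + 3 * H / (2 * s t ^ 3) - (\<aa> + \<Lambda>) / 2)"
proof -
  have "(1 + H / s t - \<aa> / 3 * (s t)\<^sup>2) / (s t)\<^sup>2 = 1 / (s t)\<^sup>2 + H / s t ^ 3 - \<aa> / 3"
    using t by (simp add: add_divide_distrib diff_divide_distrib eval_nat_numeral)
  then have "energy_density \<Lambda> s t
      = 1 / (4 * pi) * (3 / 2 * (1 / (s t)\<^sup>2 + H / s t ^ 3 - \<aa> / 3 + 1 / (s t)\<^sup>2 - \<Lambda> / 3))"
    unfolding energy_density_def criticality[OF t] by simp
  also have "3 / 2 * (1 / (s t)\<^sup>2 + H / s t ^ 3 - \<aa> / 3 + 1 / (s t)\<^sup>2 - \<Lambda> / 3)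
      = 3 / (s t)\<^sup>2 + 3 * H / (2 * s t ^ 3) - (\<aa> + \<Lambda>) / 2"
    by (simp add: algebra_simps)
  finally show ?thesis .
qed

text \<open>The contributions of \<open>H\<close> from the second derivative and from the square of
  the first cancel.\<close>

lemma pressure_eq:
  assumes t: "t \<in> P" and par: "0 < H" "\<aa> \<le> 0"
  shows "pressure \<Lambda> s t = 1 / (4 * pi) * ((\<aa> + \<Lambda>) / 2 - 1 / (s t)\<^sup>2)"
proof -
  define r where "r = 1 / s t"
  have r: "r * s t = 1" using t by (simp add: r_def)
  have "pressure \<Lambda> s t = - 1 / (4 * pi) * (r * ((- H / 2 * r\<^sup>2 - \<aa> / 3 * s t)
      + r / 2 * ((1 + H * r - \<aa> / 3 * (s t)\<^sup>2) + 1) - \<Lambda> / 2 * s t))"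
    unfolding pressure_def criticality[OF t] second_derivative[OF assms]
    by (simp add: r_def power_divide mult.assoc)
  also have "r * ((- H / 2 * r\<^sup>2 - \<aa> / 3 * s t) + r / 2 * ((1 + H * r - \<aa> / 3 * (s t)\<^sup>2) + 1) - \<Lambda> / 2 * s t)
      = r\<^sup>2 - (\<aa> + \<Lambda>) / 2"
  proof -
    have "r * (r * (s t)\<^sup>2) = (r * s t) * (r * s t)" by (simp add: power2_eq_square)
    moreover have "r * ((- H / 2 * r\<^sup>2 - \<aa> / 3 * s t) + r / 2 * ((1 + H * r - \<aa> / 3 * (s t)\<^sup>2) + 1) - \<Lambda> / 2 * s t)
        = r\<^sup>2 - \<aa> / 3 * (r * s t) - \<aa> / 6 * (r * (r * (s t)\<^sup>2)) - \<Lambda> / 2 * (r * s t)"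
      by (simp add: algebra_simps power2_eq_square)
    ultimately show ?thesis unfolding r by (simp add: field_simps)
  qed
  finally show ?thesis by (simp add: r_def power_divide algebra_simps)
qed

section \<open>Conformal time as a change of variable\<close>

lemma inj_ct: "inj_on ct I"
  using closed_RW unfolding closed_RW_spacetime_def by (auto intro: strict_mono_on_imp_inj_on)

lemma g_ct: "g (ct t) = t" if "t \<in> I"
  using inv_into_f_f[OF inj_ct that] .

lemma g_mem: "g \<tau> \<in> I" and ct_g: "ct (g \<tau>) = \<tau>" if "\<tau> \<in> J"
  using that unfolding conformal_interval_def by (auto intro: inv_into_into f_inv_into_f)

lemma S_eq: "S \<tau> = s (g \<tau>)"
  by (simp add: conformal_scale_def)

lemma continuous_ct: "continuous_on I ct"
  using closed_RW unfolding closed_RW_spacetime_def by blast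

lemma open_J: "open J"
  unfolding conformal_interval_def by (rule invariance_of_domain[OF continuous_ct open_I inj_ct])

lemma interval_J: "is_interval J"
  using connected_continuous_image[OF continuous_ct] interval_I
  unfolding conformal_interval_def by (simp add: is_interval_connected_1)

text \<open>The integral from \<open>t0\<close> may pass through zeros of \<open>s\<close>, where
  \<open>1 / s\<close> is not continuous. It is split at a point \<open>a\<close> close to
  \<open>t\<close>, so that the fundamental theorem is applied inside \<open>P\<close> only.\<close>

lemma DERIV_ct:
  assumes t: "t \<in> P"
  shows "(ct has_real_derivative 1 / s t) (at t)"
proof -
  obtain e where e: "0 < e" "cball t e \<subseteq> P" using open_P t open_contains_cball_eq by blast
  define a b where "a = t - e" and "b = t + e"
  have ab: "{a..b} \<subseteq> P" "a < t" "t < b" using e by (auto simp: a_def b_def cball_eq_atLeastAtMost)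
  then have "a \<in> {a..b}" by simp
  then have aI: "a \<in> I" using ab(1) by blast
  have int: "interval_lebesgue_integrable lborel (ereal p) (ereal q) (\<lambda>u. 1 / s u)"
    if "p \<in> I" "q \<in> I" "p \<le> q" for p q
  proof -
    have "set_integrable lborel {p..q} (\<lambda>u. 1 / s u)"
      using closed_RW that unfolding closed_RW_spacetime_def by blast
    then have "set_integrable lborel {p<..<q} (\<lambda>u. 1 / s u)"
      by (rule set_integrable_subset) auto
    then show ?thesis using that by (simp add: interval_lebesgue_integrable_def)
  qed
  have split: "ct x = ct a + (LBINT u=ereal a..ereal x. 1 / s u)" if x: "x \<in> {a<..<b}" for x
  proof -
    have "x \<in> {a..b}" using x by simp
    then have "x \<in> I" using ab(1) by blast
    \<comment> \<open>The order of \<open>t0\<close>, \<open>a\<close> and \<open>x\<close> is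
      unknown; integrability is taken on their hull.\<close>
    then have "min t0 (min a x) \<in> I" "max t0 (max a x) \<in> I" using aI t0 by (auto simp: min_def max_def)
    then have "interval_lebesgue_integrable lborel (min (ereal t0) (min (ereal a) (ereal x)))
        (max (ereal t0) (max (ereal a) (ereal x))) (\<lambda>u. 1 / s u)"
      using int[of "min t0 (min a x)" "max t0 (max a x)"] by (simp add: ereal_min ereal_max del: min_less_iff_conj)
    then show ?thesis
      using interval_integral_sum[of "ereal t0" "ereal a" "ereal x" "\<lambda>u. 1 / s u"]
      by (simp add: conformal_time_def)
  qed
  have "continuous_on {a..b} s"
    by (intro continuous_at_imp_continuous_on ballI DERIV_isCont[OF DERIV_s]) (use ab(1) in blast)
  moreover have "\<forall>u\<in>{a..b}. s u \<noteq> 0" using ab(1) by fastforce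
  ultimately have "continuous_on {a..b} (\<lambda>u. 1 / s u)"
    by (intro continuous_on_divide continuous_on_const)
  then have "((\<lambda>x. LBINT u=ereal a..ereal x. 1 / s u) has_vector_derivative 1 / s t) (at t within {a..b})"
    using ab by (intro interval_integral_FTC2) auto
  then have "((\<lambda>x. LBINT u=ereal a..ereal x. 1 / s u) has_real_derivative 1 / s t) (at t)"
    using ab(2,3) by (simp add: has_real_derivative_iff_has_vector_derivative at_within_Icc_at)
  then have "((\<lambda>x. ct a + (LBINT u=ereal a..ereal x. 1 / s u)) has_real_derivative 0 + 1 / s t) (at t)"
    by (intro DERIV_add DERIV_const)
  moreover have "\<forall>\<^sub>F x in nhds t. ct x = ct a + (LBINT u=ereal a..ereal x. 1 / s u)"
    using eventually_nhds_in_open[of "{a<..<b}" t] ab(2,3) by (auto elim!: eventually_mono intro: split)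
  ultimately show ?thesis using DERIV_transform_nhds by fastforce
qed

text \<open>Differentiability of the inverse \<open>g\<close> is part of the spacetime; its slope
  \<open>S \<tau>\<close> comes from differentiating \<open>ct (g x) = x\<close>.\<close>

lemma DERIV_S:
  assumes \<tau>: "\<tau> \<in> J" "0 < S \<tau>"
  shows "(S has_real_derivative deriv s (g \<tau>) * S \<tau>) (at \<tau>)"
proof -
  have t: "g \<tau> \<in> P" using \<tau> g_mem S_eq by auto
  have "g differentiable (at \<tau>)"
    using closed_RW \<tau>(1) open_J unfolding closed_RW_spacetime_def
    by (auto simp: differentiable_on_eq_differentiable_at)
  then obtain d where d: "(g has_real_derivative d) (at \<tau>)" unfolding real_differentiable_def by blast
  have "((\<lambda>x. ct (g x)) has_real_derivative 1 / s (g \<tau>) * d) (at \<tau>)"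
    by (rule DERIV_chain2[OF DERIV_ct[OF t] d])
  moreover have "\<forall>\<^sub>F x in nhds \<tau>. x = ct (g x)"
    using eventually_nhds_in_open[OF open_J \<tau>(1)] by (rule eventually_mono) (rule ct_g[symmetric])
  ultimately have "((\<lambda>x. x) has_real_derivative 1 / s (g \<tau>) * d) (at \<tau>)"
    by (rule DERIV_transform_nhds)
  then have "1 / s (g \<tau>) * d = 1" using DERIV_ident DERIV_unique by blast
  then have "d = S \<tau>" using \<tau>(2) by (simp add: S_eq field_simps)
  then have "((\<lambda>x. s (g x)) has_real_derivative deriv s (g \<tau>) * S \<tau>) (at \<tau>)"
    using DERIV_chain2[OF DERIV_s[OF t] d] by simp
  then show ?thesis by (simp add: S_eq[abs_def])
qed

text \<open>Where \<open>S\<close> is positive this is the chain rule. At a zero \<open>S\<close>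
  has a minimum, so its derivative vanishes. An interval of zeros would pull back under
  \<open>ct\<close> to a nonempty open set of zeros of \<open>s\<close>, which are
  negligible.\<close>

theorem conformal_solution_S: "conformal_solution \<aa> H J S"
proof -
  have nonneg: "0 \<le> S \<tau>" if "\<tau> \<in> J" for \<tau>
    using nonneg_s[OF g_mem[OF that]] by (simp add: S_eq)
  have diff: "S differentiable_on J"
    using closed_RW unfolding closed_RW_spacetime_def by blast
  have "(deriv S \<tau>)\<^sup>2 + \<aa> / 3 * S \<tau> ^ 4 - (S \<tau>)\<^sup>2 - H * S \<tau> = 0" if \<tau>: "\<tau> \<in> J" for \<tau>
  proof (cases "S \<tau> = 0")
    case True
    have "(S has_real_derivative deriv S \<tau>) (at \<tau>)"
      using diff \<tau> open_J by (simp add: differentiable_on_eq_differentiable_at DERIV_deriv_iff_real_differentiable)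
    moreover obtain e where "0 < e" "ball \<tau> e \<subseteq> J" using open_J \<tau> open_contains_ball by blast
    moreover have "\<forall>y. \<bar>\<tau> - y\<bar> < e \<longrightarrow> S \<tau> \<le> S y"
      using True nonneg \<open>ball \<tau> e \<subseteq> J\<close> by (auto simp: subset_iff dist_real_def)
    ultimately have "deriv S \<tau> = 0" using DERIV_local_min by blast
    then show ?thesis using True by simp
  next
    case False
    then have pos: "0 < S \<tau>" using nonneg[OF \<tau>] by simp
    then have t: "g \<tau> \<in> P" using \<tau> g_mem S_eq by auto
    have "deriv S \<tau> = deriv s (g \<tau>) * S \<tau>" using DERIV_imp_deriv[OF DERIV_S[OF \<tau> pos]] .
    then have "(deriv S \<tau>)\<^sup>2 = (1 + H / S \<tau> - \<aa> / 3 * (S \<tau>)\<^sup>2) * (S \<tau>)\<^sup>2"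
      using criticality[OF t] by (simp add: power_mult_distrib S_eq)
    moreover have "H / S \<tau> * (S \<tau>)\<^sup>2 = H * S \<tau>" using pos by (simp add: power2_eq_square)
    ultimately show ?thesis by (simp add: algebra_simps power2_eq_square power4_eq_xxxx)
  qed
  moreover have "interior {\<tau> \<in> J. S \<tau> = 0} = {}"
  proof (rule ccontr)
    let ?U = "interior {\<tau> \<in> J. S \<tau> = 0}"
    assume "?U \<noteq> {}"
    then obtain \<tau> where \<tau>: "\<tau> \<in> ?U" by blast
    then have "\<tau> \<in> J" using interior_subset by blast
    have op: "open (I \<inter> ct -` ?U)"
      by (rule continuous_open_preimage[OF continuous_ct open_I open_interior])
    have "g \<tau> \<in> I \<inter> ct -` ?U" using \<tau> g_mem ct_g \<open>\<tau> \<in> J\<close> by simp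
    moreover have "I \<inter> ct -` ?U \<subseteq> {t \<in> I. s t = 0}"
    proof
      fix t assume t: "t \<in> I \<inter> ct -` ?U"
      then have "S (ct t) = 0" using interior_subset[of "{\<tau> \<in> J. S \<tau> = 0}"] by blast
      then show "t \<in> {t \<in> I. s t = 0}" using t g_ct by (simp add: S_eq)
    qed
    then have "negligible (I \<inter> ct -` ?U)"
      using closed_RW negligible_subset unfolding closed_RW_spacetime_def by blast
    ultimately show False using open_not_negligible[OF op] by blast
  qed
  ultimately show ?thesis
    using nonneg diff open_J interval_J unfolding conformal_solution_def by blast
qed

end

section \<open>Geometry of the conformal model\<close>

lemma Ck_on_const: "Ck_on k U (\<lambda>x. c)"
  by (induction k arbitrary: c) (simp_all add: continuous_on_const)

lemma smooth_on_const: "smooth_on U (\<lambda>x. c)"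
  by (simp add: smooth_on_def Ck_on_const)

lemma smooth_on_bounded_linear:
  assumes "bounded_linear f"
  shows "smooth_on U f"
proof -
  have D: "(f has_derivative f) (at x)" for x using assms by (rule bounded_linear_imp_has_derivative)
  have "Ck_on k U f" for k
  proof (cases k)
    case 0
    then show ?thesis using assms by (simp add: linear_continuous_on)
  next
    case (Suc n)
    have "frechet_derivative f (at x) = f" for x using frechet_derivative_at[OF D] by simp
    then show ?thesis using D unfolding Suc by (auto simp: differentiable_def Ck_on_const)
  qed
  then show ?thesis by (simp add: smooth_on_def)
qed

text \<open>One inclusion differentiates
  \<open>snd (\<gamma> t) \<bullet> snd (\<gamma> t) = 1\<close>. For the other, the line through
  \<open>p\<close> with direction \<open>b\<close> is normalised; its squared norm
  \<open>r t\<close> has no linear term because \<open>p\<close> and \<open>b\<close> are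
  orthogonal, so the velocity at 0 remains \<open>b\<close>.\<close>

lemma tangent_space_conformal_model:
  assumes "open J" "q \<in> conformal_model J"
  shows "tangent_space (conformal_model J) q = {X. snd q \<bullet> snd X = 0}"
proof (intro set_eqI iffI)
  fix X assume "X \<in> tangent_space (conformal_model J) q"
  then obtain \<gamma> where \<gamma>: "\<gamma> 0 = q" "\<forall>\<^sub>F t in nhds (0::real). \<gamma> t \<in> conformal_model J"
    and d: "(\<gamma> has_vector_derivative X) (at 0)"
    unfolding tangent_space_def by blast
  have ds: "((\<lambda>t. snd (\<gamma> t)) has_vector_derivative snd X) (at 0)"
    using d by (rule bounded_linear.has_vector_derivative[OF bounded_linear_snd])
  have "((\<lambda>t. snd (\<gamma> t) \<bullet> snd (\<gamma> t)) has_real_derivative 2 * (snd q \<bullet> snd X)) (at 0)"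
    unfolding has_field_derivative_def
    by (rule has_derivative_eq_rhs[OF has_derivative_inner[OF ds[unfolded has_vector_derivative_def] ds[unfolded has_vector_derivative_def]]])
       (simp add: \<gamma>(1) fun_eq_iff inner_commute)
  moreover have "\<forall>\<^sub>F t in nhds 0. 1 = snd (\<gamma> t) \<bullet> snd (\<gamma> t)"
    using \<gamma>(2) by (rule eventually_mono) (auto simp: conformal_model_def dot_square_norm)
  ultimately have "((\<lambda>t. 1) has_real_derivative 2 * (snd q \<bullet> snd X)) (at 0)"
    by (rule DERIV_transform_nhds)
  then have "2 * (snd q \<bullet> snd X) = 0" using DERIV_const by (rule DERIV_unique)
  then show "X \<in> {X. snd q \<bullet> snd X = 0}" by simp
next
  fix X :: cyl assume X: "X \<in> {X. snd q \<bullet> snd X = 0}"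
  obtain \<tau> p a b where q: "q = (\<tau>, p)" and ab: "X = (a, b)" by (metis surj_pair)
  have pb: "p \<bullet> b = 0" using X by (simp add: q ab)
  have p: "norm p = 1" "\<tau> \<in> J" using assms(2) by (auto simp: q conformal_model_def)
  define r where "r = (\<lambda>t::real. 1 + t\<^sup>2 * (b \<bullet> b))"
  have r: "0 < r t" for t unfolding r_def by (intro add_pos_nonneg) auto
  define \<gamma> where "\<gamma> = (\<lambda>t. (\<tau> + t * a, (1 / sqrt (r t)) *\<^sub>R (p + t *\<^sub>R b)))"
  have "(r has_real_derivative 0) (at 0)"
    unfolding r_def by (auto intro!: derivative_eq_intros)
  then have "((\<lambda>t. 1 / sqrt (r t)) has_real_derivative 0) (at 0)"
    using r[of 0] by (auto intro!: derivative_eq_intros simp: r_def)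
  moreover have "((\<lambda>t. p + t *\<^sub>R b) has_vector_derivative b) (at 0)"
    by (auto intro!: derivative_eq_intros)
  ultimately have "((\<lambda>t. (1 / sqrt (r t)) *\<^sub>R (p + t *\<^sub>R b)) has_vector_derivative
      (1 / sqrt (r 0)) *\<^sub>R b + 0 *\<^sub>R (p + 0 *\<^sub>R b)) (at 0)"
    by (rule has_vector_derivative_scaleR)
  moreover have "((\<lambda>t. \<tau> + t * a) has_vector_derivative a) (at 0)"
    by (auto intro!: derivative_eq_intros simp flip: has_real_derivative_iff_has_vector_derivative)
  ultimately have "(\<gamma> has_vector_derivative X) (at 0)"
    unfolding \<gamma>_def ab using has_vector_derivative_Pair by (fastforce simp: r_def)
  moreover have "\<forall>\<^sub>F t in nhds 0. \<gamma> t \<in> conformal_model J"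
  proof -
    have unit: "norm ((1 / sqrt (r t)) *\<^sub>R (p + t *\<^sub>R b)) = 1" for t
    proof -
      have "(norm (p + t *\<^sub>R b))\<^sup>2 = r t"
      proof -
        have "p \<bullet> p = 1" using p(1) by (simp add: dot_square_norm)
        then have "(p + t *\<^sub>R b) \<bullet> (p + t *\<^sub>R b) = r t"
          using pb by (simp add: inner_add_left inner_add_right inner_commute r_def power2_eq_square)
        then show ?thesis by (simp only: power2_norm_eq_inner)
      qed
      then have "norm (p + t *\<^sub>R b) = sqrt (r t)" by (metis norm_ge_zero real_sqrt_unique)
      then show ?thesis using r[of t] by simp
    qed
    have "\<forall>\<^sub>F t in nhds 0. \<tau> + t * a \<in> J"
    proof -
      have "open ((\<lambda>t. \<tau> + t * a) -` J)" by (rule open_vimage[OF assms(1)]) (intro continuous_intros)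
      then show ?thesis using p(2) eventually_nhds_in_open[of _ "0::real"] by fastforce
    qed
    then show ?thesis
      by (rule eventually_mono)
        (simp only: unit \<gamma>_def conformal_model_def mem_Times_iff mem_sphere_0 fst_conv snd_conv simp_thms)
  qed
  moreover have "\<gamma> 0 = q" by (simp add: \<gamma>_def q r_def)
  ultimately show "X \<in> tangent_space (conformal_model J) q"
    unfolding tangent_space_def by blast
qed

lemma tangent_space_slice:
  assumes "X \<in> tangent_space {q \<in> M. fst q = (0::real)} q"
  shows "fst X = 0"
proof -
  obtain \<gamma> where \<gamma>: "\<forall>\<^sub>F t in nhds (0::real). \<gamma> t \<in> {q \<in> M. fst q = 0}"
    and d: "(\<gamma> has_vector_derivative X) (at 0)"
    using assms unfolding tangent_space_def by blast
  have "((\<lambda>t. fst (\<gamma> t)) has_real_derivative fst X) (at 0)"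
    using bounded_linear.has_vector_derivative[OF bounded_linear_fst d]
    by (simp add: has_real_derivative_iff_has_vector_derivative)
  moreover have "\<forall>\<^sub>F t in nhds 0. 0 = fst (\<gamma> t)" using \<gamma> by (rule eventually_mono) simp
  ultimately have "((\<lambda>t. 0) has_real_derivative fst X) (at 0)" by (rule DERIV_transform_nhds)
  then show ?thesis using DERIV_const by (rule DERIV_unique)
qed

lemma slice_spacelike:
  assumes "open J"
  shows "spacelike_hypersurface (conformal_model J) {q \<in> conformal_model J. fst q = 0}"
    (is "spacelike_hypersurface ?M ?S")
proof -
  have "hypersurface ?M ?S"
    unfolding hypersurface_def
  proof (intro conjI ballI)
    fix q assume q: "q \<in> ?S"
    have "frechet_derivative fst (at q) = (fst :: cyl \<Rightarrow> real)"
      using frechet_derivative_at[OF bounded_linear_imp_has_derivative[OF bounded_linear_fst]] by metis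
    moreover have "(1, 0) \<in> tangent_space ?M q"
      using tangent_space_conformal_model[OF assms] q by simp
    ultimately have "\<exists>X\<in>tangent_space ?M q. frechet_derivative (fst :: cyl \<Rightarrow> real) (at q) X \<noteq> 0"
      by (intro bexI[of _ "(1, 0)"]) simp_all
    then show "\<exists>U (f :: cyl \<Rightarrow> real). open U \<and> q \<in> U \<and> smooth_on U f \<and>
        ?S \<inter> U = {x \<in> ?M \<inter> U. f x = 0} \<and> (\<exists>X\<in>tangent_space ?M q. frechet_derivative f (at q) X \<noteq> 0)"
      by (intro exI[of _ UNIV] exI[of _ fst]) (simp add: smooth_on_bounded_linear bounded_linear_fst)
  qed auto
  moreover have "0 < background_metric X X" if "q \<in> ?S" "X \<in> tangent_space ?S q" "X \<noteq> 0" for q X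
    using tangent_space_slice[OF that(2)] that(3) by (cases X) (simp add: background_metric_def zero_prod_def)
  ultimately show ?thesis unfolding spacelike_hypersurface_def by blast
qed

text \<open>The background is a product, so the time direction is a constant unit normal field: the
  slice is even totally geodesic, with \<open>\<kappa> = 0\<close>.\<close>

lemma slice_totally_umbilical:
  assumes "open J"
  shows "totally_umbilical (conformal_model J) {q \<in> conformal_model J. fst q = 0}"
    (is "totally_umbilical ?M ?S")
  unfolding totally_umbilical_def
proof
  fix q assume "q \<in> ?S"
  show "\<exists>U N \<kappa>. open U \<and> q \<in> U \<and> smooth_on U N \<and>
        (\<forall>x\<in>?S \<inter> U. N x \<in> tangent_space ?M x \<and> \<bar>background_metric (N x) (N x)\<bar> = 1 \<and>
           (\<forall>X\<in>tangent_space ?S x. background_metric (N x) X = 0) \<and>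
           (\<forall>X\<in>tangent_space ?S x. \<forall>Y\<in>tangent_space ?S x.
              background_metric (frechet_derivative N (at x) X) Y = \<kappa> x * background_metric X Y))"
  proof (intro exI[of _ UNIV] exI[of _ "\<lambda>_. (1, 0)"] exI[of _ "\<lambda>_. 0"] conjI ballI)
    fix x assume "x \<in> ?S \<inter> UNIV"
    then show "(1, 0) \<in> tangent_space ?M x" using tangent_space_conformal_model[OF assms] by simp
  qed (auto simp: smooth_on_const background_metric_def dest: tangent_space_slice)
qed

lemma conformal_form_nondegenerate:
  assumes "open J" "q \<in> conformal_model J" "S (fst q) \<noteq> 0"
  shows "nondegenerate_on (tangent_space (conformal_model J) q) (conformal_form S q)"
  unfolding nondegenerate_on_def tangent_space_conformal_model[OF assms(1,2)]
proof (intro ballI impI)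
  fix X :: cyl assume X: "X \<in> {X. snd q \<bullet> snd X = 0}"
    and null: "\<forall>Y\<in>{X. snd q \<bullet> snd X = 0}. conformal_form S q X Y = 0"
  \<comment> \<open>Reversing the time component of \<open>X\<close> keeps it tangent and turns the
    Lorentzian product into the Euclidean square of \<open>X\<close>.\<close>
  have "conformal_form S q X (- fst X, snd X) = 0" using null X by simp
  then have "(fst X)\<^sup>2 + snd X \<bullet> snd X = 0"
    using assms(3) by (simp add: conformal_form_def background_metric_def power2_eq_square)
  then show "X = 0" by (simp add: add_nonneg_eq_0_iff prod_eq_iff)
qed

text \<open>The time direction joined to a Euclidean orthonormal basis of the hyperplane tangent to
  the sphere is orthogonal for both products; Euclidean orthogonality gives independence.\<close>

lemma conformal_form_lorentzian:
  assumes "open J" "q \<in> conformal_model J" "S (fst q) \<noteq> 0"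
  shows "lorentzian_on (tangent_space (conformal_model J) q) (conformal_form S q)"
proof -
  let ?V = "{b. snd q \<bullet> b = 0}" and ?T = "{X :: cyl. snd q \<bullet> snd X = 0}"
  let ?\<iota> = "\<lambda>b. (0, b) :: cyl"
  have "subspace ?V" by (rule subspace_hyperplane)
  then obtain B where B: "B \<subseteq> ?V" "pairwise orthogonal B" "\<And>x. x \<in> B \<Longrightarrow> norm x = 1"
    "independent B" "span B = ?V"
    by (rule orthonormal_basis_subspace) (rule that)
  define e E where "e = ((1, 0) :: cyl)" and "E = ?\<iota> ` B"
  have lin: "linear ?\<iota>" by (intro linearI) simp_all
  have S: "0 < (S (fst q))\<^sup>2" using assms(3) by simp
  have "independent (insert e E)"
  proof (rule pairwise_orthogonal_independent)
    show "pairwise orthogonal (insert e E)"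
      using B(2) by (auto simp: pairwise_def e_def E_def orthogonal_def)
    show "0 \<notin> insert e E" using B(3) by (force simp: e_def E_def zero_prod_def)
  qed
  moreover have "span (insert e E) = ?T"
  proof
    have "subspace ?T" by (auto simp: subspace_def inner_add_right)
    moreover have "insert e E \<subseteq> ?T" using B(1) by (auto simp: e_def E_def)
    ultimately show "span (insert e E) \<subseteq> ?T" by (rule span_minimal[rotated])
  next
    have "span E = ?\<iota> ` ?V" unfolding E_def by (simp add: span_linear_image[OF lin] B(5))
    show "?T \<subseteq> span (insert e E)"
    proof
      fix X assume "X \<in> ?T"
      then have "(0, snd X) \<in> span E" using \<open>span E = ?\<iota> ` ?V\<close> by auto
      then have "(0, snd X) \<in> span (insert e E)" using span_mono[of E "insert e E"] by blast
      moreover have "fst X *\<^sub>R e \<in> span (insert e E)" by (intro span_scale span_base) simp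
      ultimately have "fst X *\<^sub>R e + (0, snd X) \<in> span (insert e E)" by (rule span_add[rotated])
      then show "X \<in> span (insert e E)" by (simp add: e_def)
    qed
  qed
  moreover have "finite E" using B(4) by (simp add: E_def independent_imp_finite)
  moreover have "e \<notin> E" by (auto simp: e_def E_def)
  moreover have "conformal_form S q e e < 0"
    using S by (simp add: conformal_form_def background_metric_def e_def)
  moreover have "\<forall>x\<in>E. 0 < conformal_form S q x x"
    using S B(3) by (auto simp: conformal_form_def background_metric_def E_def dot_square_norm)
  moreover have "\<forall>x\<in>insert e E. \<forall>y\<in>insert e E. x \<noteq> y \<longrightarrow> conformal_form S q x y = 0"
    using B(2) by (auto simp: conformal_form_def background_metric_def e_def E_def pairwise_def orthogonal_def)
  ultimately show ?thesis
    unfolding lorentzian_on_def tangent_space_conformal_model[OF assms(1,2)] by blast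
qed

section \<open>Energy conditions\<close>

locale maximal_spacetime = RW_spacetime I s \<Lambda> t0 \<aa> H + class_II_lattice L w1 w2 \<theta> \<omega> T H \<aa>
  for I :: "real set" and s :: "real \<Rightarrow> real" and \<Lambda> t0 \<aa> H :: real
    and L :: "complex set" and w1 w2 :: complex and \<theta> \<omega> T :: real +
  assumes maximal: "maximal_domain \<aa> H J S"
begin

lemma conformal_scale_profile:
  obtains z where "J = {z - T<..<z + T}" "\<And>\<tau>. \<tau> \<in> J \<Longrightarrow> S \<tau> = profile (\<tau> - z)"
  using maximal_solution_is_translate[OF conformal_solution_S maximal] by blast

lemma normalized_model:
  obtains c where "conformal_interval I s t0 c = {- T<..<T}"
    "\<And>x. \<bar>x\<bar> < T \<Longrightarrow> conformal_scale I s t0 c x = profile x"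
proof -
  obtain z where z: "J = {z - T<..<z + T}" "\<And>\<tau>. \<tau> \<in> J \<Longrightarrow> S \<tau> = profile (\<tau> - z)"
    by (rule conformal_scale_profile) (rule that)
  show ?thesis
  proof (rule that[of "- z"])
    show "conformal_interval I s t0 (- z) = {- T<..<T}"
      unfolding conformal_interval_shift[of I s t0 "- z"] z(1)
    proof (intro subset_antisym subsetI)
      fix x assume "x \<in> {- T<..<T}"
      then have "z + x \<in> {z - T<..<z + T}" by simp
      then show "x \<in> (+) (- z) ` {z - T<..<z + T}" by (rule rev_image_eqI) simp
    qed auto
    show "conformal_scale I s t0 (- z) x = profile x" if "\<bar>x\<bar> < T" for x
    proof -
      have "x + z \<in> J" using that by (simp add: z(1) abs_less_iff)
      then show ?thesis
        using conformal_scale_shift[OF inj_ct, of "x + z" "- z"] z(2)[of "x + z"] by simp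
    qed
  qed
qed

lemma s_surjective:
  assumes "0 < v"
  obtains t where "t \<in> P" "s t = v"
proof -
  obtain z where z: "J = {z - T<..<z + T}" "\<And>\<tau>. \<tau> \<in> J \<Longrightarrow> S \<tau> = profile (\<tau> - z)"
    by (rule conformal_scale_profile) (rule that)
  obtain x where x: "0 < x" "x < T" "profile x = v" using surjective[OF assms] by blast
  have "x + z \<in> J" using x by (simp add: z(1))
  then have "g (x + z) \<in> I" "s (g (x + z)) = v" using g_mem z(2)[of "x + z"] x by (simp_all add: S_eq)
  then show ?thesis using that assms by auto
qed

text \<open>For large \<open>s\<close> the energy density tends to
  \<open>- (\<aa> + \<Lambda>) / (8 * pi)\<close>, and it is never negative.\<close>

lemma lambda_bound: "\<aa> + \<Lambda> \<le> 0"
proof (rule ccontr)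
  assume "\<not> \<aa> + \<Lambda> \<le> 0"
  then have d: "0 < \<aa> + \<Lambda>" by simp
  \<comment> \<open>For \<open>1 \<le> v\<close> the two decaying terms together are at most
    \<open>k / v\<close>; \<open>v\<close> is chosen so large that this is below
    \<open>(\<aa> + \<Lambda>) / 2\<close>.\<close>
  define k where "k = 3 + 3 * H / 2"
  define v where "v = 1 + 2 * k / (\<aa> + \<Lambda>)"
  have k: "0 < k" using H by (simp add: k_def)
  then have v: "1 \<le> v" "2 * k / (\<aa> + \<Lambda>) < v" using d by (simp_all add: v_def)
  then have v0: "0 < v" by simp
  obtain t where t: "t \<in> P" "s t = v" using s_surjective[OF v0] by blast
  have "0 \<le> energy_density \<Lambda> s t"
    using closed_RW t unfolding closed_RW_spacetime_def by blast
  then have "0 \<le> 1 / (4 * pi) * (3 / v\<^sup>2 + 3 * H / (2 * v ^ 3) - (\<aa> + \<Lambda>) / 2)"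
    unfolding energy_density_eq[OF t(1)] t(2) .
  moreover have "0 < 1 / (4 * pi)" by simp
  ultimately have "0 \<le> 3 / v\<^sup>2 + 3 * H / (2 * v ^ 3) - (\<aa> + \<Lambda>) / 2"
    by (smt (verit, best) mult_pos_neg)
  moreover have "3 / v\<^sup>2 \<le> 3 / v"
    using v v0 by (intro divide_left_mono) (auto simp: power2_eq_square)
  moreover have "3 * H / (2 * v ^ 3) \<le> 3 * H / (2 * v)"
    using v v0 H self_le_power[of v 3] by (intro divide_left_mono) auto
  ultimately have "(\<aa> + \<Lambda>) / 2 \<le> k / v" by (simp add: k_def add_divide_distrib)
  then have "v \<le> 2 * k / (\<aa> + \<Lambda>)" using v0 d by (simp add: field_simps)
  then show False using v by simp
qed

lemma cosmological_parameter: "- \<aa> = 2 * (cosh (3 * \<theta>) - 1) / (9 * H\<^sup>2)"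
proof -
  have "H\<^sup>2 \<noteq> 0" using H by simp
  then show ?thesis using \<aa>_eq by (simp add: field_simps)
qed

text \<open>In the sum of density and pressure \<open>\<aa> + \<Lambda>\<close> cancels and positive
  terms remain; only the upper bound on the pressure uses \<open>lambda_bound\<close>.\<close>

lemma dominant: "dominant_energy_condition I s \<Lambda>"
  unfolding dominant_energy_condition_def
proof (intro ballI impI conjI)
  fix t assume "t \<in> I" "0 < s t"
  then have t: "t \<in> P" "0 < s t" by auto
  define u w where "u = 1 / (s t)\<^sup>2" and "w = H / s t ^ 3"
  have uw: "0 < u" "0 < w" using t H by (simp_all add: u_def w_def)
  have m: "energy_density \<Lambda> s t = 1 / (4 * pi) * (3 * u + 3 / 2 * w - (\<aa> + \<Lambda>) / 2)"
    unfolding energy_density_eq[OF t(1)] by (simp add: u_def w_def)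
  have p: "pressure \<Lambda> s t = 1 / (4 * pi) * ((\<aa> + \<Lambda>) / 2 - u)"
    using pressure_eq[OF t(1) H \<aa>] by (simp add: u_def)
  have "0 \<le> 1 / (4 * pi) * (2 * u + 3 / 2 * w)" using uw by (intro mult_nonneg_nonneg) auto
  then show "- energy_density \<Lambda> s t \<le> pressure \<Lambda> s t" unfolding m p by (simp add: algebra_simps)
  have "(\<aa> + \<Lambda>) / 2 - u \<le> 3 * u + 3 / 2 * w - (\<aa> + \<Lambda>) / 2" using uw lambda_bound by simp
  then show "pressure \<Lambda> s t \<le> energy_density \<Lambda> s t" unfolding m p by (intro mult_left_mono) auto
qed

text \<open>In the lower bound the terms in \<open>1 / (s t)\<^sup>2\<close> cancel and
  \<open>- (\<aa> + \<Lambda>) / 3 \<le> H / (2 * s t ^ 3)\<close> is left. The right-hand side has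
  infimum 0, which forces \<open>0 \<le> \<aa> + \<Lambda>\<close>; the opposite inequality is
  \<open>lambda_bound\<close>.\<close>

lemma strong_iff: "strong_energy_condition I s \<Lambda> \<longleftrightarrow> \<aa> + \<Lambda> = 0"
proof -
  have eq: "- energy_density \<Lambda> s t / 3 \<le> pressure \<Lambda> s t \<longleftrightarrow> - (\<aa> + \<Lambda>) / 3 \<le> H / (2 * s t ^ 3)"
    if "t \<in> I" "0 < s t" for t
  proof -
    have t: "t \<in> P" using that by simp
    define u w where "u = 1 / (s t)\<^sup>2" and "w = H / (2 * s t ^ 3)"
    have "energy_density \<Lambda> s t = 1 / (4 * pi) * (3 * u + 3 * w - (\<aa> + \<Lambda>) / 2)"
      unfolding energy_density_eq[OF t] by (simp add: u_def w_def)
    then have m: "- energy_density \<Lambda> s t / 3 = 1 / (4 * pi) * (- u - w + (\<aa> + \<Lambda>) / 6)"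
      by (simp add: field_simps)
    have p: "pressure \<Lambda> s t = 1 / (4 * pi) * ((\<aa> + \<Lambda>) / 2 - u)"
      using pressure_eq[OF t H \<aa>] by (simp add: u_def)
    have "- energy_density \<Lambda> s t / 3 \<le> pressure \<Lambda> s t \<longleftrightarrow> - u - w + (\<aa> + \<Lambda>) / 6 \<le> (\<aa> + \<Lambda>) / 2 - u"
      unfolding m p by (rule mult_le_cancel_left_pos) simp
    also have "\<dots> \<longleftrightarrow> - (\<aa> + \<Lambda>) / 3 \<le> w" by (rule iffI) (simp_all add: field_simps)
    finally show ?thesis unfolding w_def .
  qed
  show ?thesis
  proof
    assume strong: "strong_energy_condition I s \<Lambda>"
    show "\<aa> + \<Lambda> = 0"
    proof (rule ccontr)
      assume "\<aa> + \<Lambda> \<noteq> 0"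
      define d where "d = - (\<aa> + \<Lambda>)"
      have d: "0 < d" using lambda_bound \<open>\<aa> + \<Lambda> \<noteq> 0\<close> by (simp add: d_def)
      \<comment> \<open>For \<open>1 \<le> v\<close> the condition would give
        \<open>d / 3 \<le> H / (2 * v)\<close>, that is
        \<open>v \<le> 3 * H / (2 * d)\<close>.\<close>
      define v where "v = 1 + 3 * H / (2 * d)"
      have v: "1 \<le> v" "3 * H / (2 * d) < v" "0 < v" using H d by (simp_all add: v_def add_pos_pos)
      obtain t where t: "t \<in> P" "s t = v" using s_surjective[OF v(3)] by blast
      have "d / 3 \<le> H / (2 * v ^ 3)"
        using strong t eq[of t] unfolding strong_energy_condition_def d_def by blast
      also have "\<dots> \<le> H / (2 * v)" using v H self_le_power[of v 3] by (intro divide_left_mono) auto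
      finally have "v \<le> 3 * H / (2 * d)" using v d by (simp add: field_simps)
      then show False using v by simp
    qed
  next
    assume z: "\<aa> + \<Lambda> = 0"
    show "strong_energy_condition I s \<Lambda>"
      unfolding strong_energy_condition_def
    proof (intro ballI impI conjI)
      fix t assume t: "t \<in> I" "0 < s t"
      show "- energy_density \<Lambda> s t / 3 \<le> pressure \<Lambda> s t"
        unfolding eq[OF t] using z H t by simp
      show "pressure \<Lambda> s t \<le> energy_density \<Lambda> s t"
        using dominant t unfolding dominant_energy_condition_def by blast
    qed
  qed
qed

end

theorem theorem6:
  fixes I :: "real set" and s :: "real \<Rightarrow> real"
    and \<Lambda> t0 \<aa> H \<theta> \<omega> \<tau>' :: real and L :: "complex set"
  assumes "closed_RW_spacetime I s \<Lambda> t0"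
    and "\<not> s constant_on I"
    and "m_critical I s \<Lambda>"
    and "internal_parameters I s \<aa> H"
    and "maximal_domain \<aa> H (conformal_interval I s t0 0) (conformal_scale I s t0 0)"
    and "class_II \<aa> H"
    and "type_and_angle \<aa> H 1 \<theta>"
    and "0 < H"
    and "is_complex_lattice L"
    and "invariant_g2 L = of_real (1 / 12)"
    and "invariant_g3 L = of_real (- cosh (3 * \<theta>) / 216)"
    and "real_half_period L \<omega>"
    and "\<tau>' \<in> {0<..<\<omega>}"
    and "real_weierstrass_p L \<tau>' = 1 / 12"
  shows "\<Lambda> \<le> (2 * cosh (3 * \<theta>) - 2) / (9 * H\<^sup>2) \<and>
    (\<exists>c. let J = conformal_interval I s t0 c;
             S = conformal_scale I s t0 c;
             M = conformal_model J;
             S0 = {q \<in> M. fst q = 0}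
         in M = {-\<tau>'<..<\<tau>'} \<times> sphere 0 1 \<and>
            \<not> cyclic_model J S \<and>
            (\<forall>q\<in>M. \<forall>X\<in>tangent_space M q. \<forall>Y\<in>tangent_space M q.
               conformal_form S q X Y = weierstrass_factor L H (fst q) * background_metric X Y) \<and>
            spacelike_hypersurface M S0 \<and>
            totally_umbilical M S0 \<and>
            (\<forall>q\<in>S0. \<forall>X\<in>tangent_space M q. \<forall>Y\<in>tangent_space M q. conformal_form S q X Y = 0) \<and>
            (\<forall>q\<in>M - S0. nondegenerate_on (tangent_space M q) (conformal_form S q) \<and>
                         lorentzian_on (tangent_space M q) (conformal_form S q))) \<and>
    weak_energy_condition I s \<Lambda> \<and>
    dominant_energy_condition I s \<Lambda> \<and>
    (strong_energy_condition I s \<Lambda> \<longleftrightarrow> \<Lambda> = 2 * (cosh (3 * \<theta>) - 1) / (9 * H\<^sup>2))"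
proof -
  obtain w1 w2 where w: "Im (w2 / w1) \<noteq> 0" "L = {of_int m * w1 + of_int n * w2 | m n :: int. True}"
    using assms(9) unfolding is_complex_lattice_def by blast
  interpret maximal_spacetime I s \<Lambda> t0 \<aa> H L w1 w2 \<theta> \<omega> \<tau>'
    using w assms type_and_angle_parameter[OF assms(7)] by unfold_locales auto
  obtain c where J: "conformal_interval I s t0 c = {- \<tau>'<..<\<tau>'}"
    and S: "\<And>x. \<bar>x\<bar> < \<tau>' \<Longrightarrow> conformal_scale I s t0 c x = profile x"
    using normalized_model by blast
  let ?J = "conformal_interval I s t0 c" and ?S = "conformal_scale I s t0 c"
  let ?M = "conformal_model ?J"
  let ?Z = "{q \<in> ?M. fst q = 0}"
  have op: "open ?J" unfolding J by simp
  have mem: "\<bar>fst q\<bar> < \<tau>'" if "q \<in> ?M" for q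
    using that unfolding J conformal_model_def by (auto simp: abs_less_iff)
  have M: "?M = {- \<tau>'<..<\<tau>'} \<times> sphere 0 1" unfolding J conformal_model_def ..
  \<comment> \<open>Boundedness of the interval alone excludes cyclicity.\<close>
  have cyclic: "\<not> cyclic_model ?J ?S"
  proof
    assume "cyclic_model ?J ?S"
    then have "\<tau>' \<in> {- \<tau>'<..<\<tau>'}" unfolding cyclic_model_def J by simp
    then show False by simp
  qed
  have form: "conformal_form ?S q X Y = weierstrass_factor L H (fst q) * background_metric X Y"
    if "q \<in> ?M" for q X Y
    using S[OF mem[OF that]] weierstrass_factor_profile[OF mem[OF that]] by (simp add: conformal_form_def)
  have zero_form: "conformal_form ?S q X Y = 0" if "q \<in> ?Z" for q X Y
    using S[of 0] that mem[of q] zero by (simp add: conformal_form_def)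
  have nonzero: "?S (fst q) \<noteq> 0" if "q \<in> ?M - ?Z" for q
    using S[OF mem[of q]] positive[of "fst q"] that mem[of q] by force
  have lorentz: "nondegenerate_on (tangent_space ?M q) (conformal_form ?S q) \<and>
      lorentzian_on (tangent_space ?M q) (conformal_form ?S q)" if "q \<in> ?M - ?Z" for q
    using conformal_form_nondegenerate[where S = ?S, OF op] conformal_form_lorentzian[where S = ?S, OF op]
      nonzero[OF that] that by blast
  have bound: "\<Lambda> \<le> (2 * cosh (3 * \<theta>) - 2) / (9 * H\<^sup>2)"
    using lambda_bound cosmological_parameter by (simp add: algebra_simps)
  have strong: "strong_energy_condition I s \<Lambda> \<longleftrightarrow> \<Lambda> = 2 * (cosh (3 * \<theta>) - 1) / (9 * H\<^sup>2)"
    unfolding strong_iff cosmological_parameter[symmetric] by auto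
  have weak: "weak_energy_condition I s \<Lambda>"
    using dominant unfolding weak_energy_condition_def dominant_energy_condition_def by blast
  show ?thesis
    unfolding Let_def
    using bound weak dominant strong M cyclic form slice_spacelike[OF op] slice_totally_umbilical[OF op]
      zero_form lorentz
    by (intro conjI exI[of _ c] ballI) blast+
qed

end
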